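(* In the word RAM model with word size $\Theta(\log n)$, there is a representation of any $n$-node binary tree using $2n + n/(\log n)^{O(1)}$ bits that supports each of the following operations in $O(1)$ time: left-child, right-child, parent, subtree-size, LCA, inorder, and one of preorder or postorder.
   Context: For a node $u$ of the binary tree: left-child$(u)$ and right-child$(u)$ return the left and right child of $u$ (or null), parent$(u)$ returns its parent (or null), subtree-size$(u)$ returns the number of nodes in the subtree rooted at $u$, LCA$(u,v)$ returns the lowest common ancestor of nodes $u$ and $v$, and inorder$(u)$, preorder$(u)$, postorder$(u)$ return the rank of $u$ in the inorder, preorder, postorder traversal of the binary tree, respectively. *)

theory Defs
  imports
    "HOL-Library.Tree"
    "HOL-Library.Sublist"
    "HOL-Library.Landau_Symbols"
    Complex_Main
begin

unbundle bit_operations_syntax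

text \<open>
  Binary trees are unlabelled. A node is identified with the path leading to it from the root,
  and \<open>node_tree t\<close> is \<open>t\<close> with every node labelled by its own path, so that the traversals
  of \<open>HOL-Library.Tree\<close> list the nodes of \<open>t\<close>. A missing child or parent (null) is \<open>None\<close>.
\<close>

type_synonym bintree = "unit tree"

datatype dir = Left | Right

type_synonym node = "dir list"

fun node_tree :: "bintree \<Rightarrow> node tree" where
  "node_tree Leaf = Leaf"
| "node_tree (Node l _ r) =
     Node (map_tree (Cons Left) (node_tree l)) [] (map_tree (Cons Right) (node_tree r))"

definition nodes :: "bintree \<Rightarrow> node set" where
  "nodes t = set_tree (node_tree t)"

definition left_child :: "bintree \<Rightarrow> node \<Rightarrow> node option" where
  "left_child t u = (if u @ [Left] \<in> nodes t then Some (u @ [Left]) else None)"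

definition right_child :: "bintree \<Rightarrow> node \<Rightarrow> node option" where
  "right_child t u = (if u @ [Right] \<in> nodes t then Some (u @ [Right]) else None)"

definition parent :: "bintree \<Rightarrow> node \<Rightarrow> node option" where
  "parent t u = (if u = [] then None else Some (butlast u))"

fun subtree :: "bintree \<Rightarrow> node \<Rightarrow> bintree" where
  "subtree t [] = t"
| "subtree Leaf (_ # _) = Leaf"
| "subtree (Node l _ r) (Left # u) = subtree l u"
| "subtree (Node l _ r) (Right # u) = subtree r u"

definition subtree_size :: "bintree \<Rightarrow> node \<Rightarrow> nat" where
  "subtree_size t u = size (subtree t u)"

text \<open>
  \<open>a\<close> is an ancestor of \<open>u\<close> (every node being an ancestor of itself) iff \<open>a\<close> is a prefix
  of \<open>u\<close>, and the depth of a node is the length of its path.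
\<close>

definition lca :: "bintree \<Rightarrow> node \<Rightarrow> node \<Rightarrow> node" where
  "lca t u v = arg_max length (\<lambda>a. a \<in> nodes t \<and> prefix a u \<and> prefix a v)"

text \<open>Ranks count from 1.\<close>

definition rank_in :: "'a list \<Rightarrow> 'a \<Rightarrow> nat" where
  "rank_in xs x = Suc (length (takeWhile (\<lambda>y. y \<noteq> x) xs))"

definition inorder_rank :: "bintree \<Rightarrow> node \<Rightarrow> nat" where
  "inorder_rank t u = rank_in (inorder (node_tree t)) u"

definition preorder_rank :: "bintree \<Rightarrow> node \<Rightarrow> nat" where
  "preorder_rank t u = rank_in (preorder (node_tree t)) u"

definition postorder_rank :: "bintree \<Rightarrow> node \<Rightarrow> nat" where
  "postorder_rank t u = rank_in (postorder (node_tree t)) u"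

text \<open>
  With word size \<open>w\<close>, registers and memory cells hold naturals below \<open>2 ^ w\<close>, all results are
  reduced modulo \<open>2 ^ w\<close>, and since addresses come from registers only the first \<open>2 ^ w\<close> cells
  are accessible. The word size is not part of a program. Every instruction takes one time unit.
\<close>

datatype binop = Add | Sub | Mul | Div | Mod | And | Or | Xor | Shl | Shr

type_synonym register = nat

datatype instr =
    Const register nat
  | Arith binop register register register  \<comment> \<open>destination, operands\<close>
  | Load register register                  \<comment> \<open>destination, address\<close>
  | Store register register                 \<comment> \<open>address, source\<close>
  | Jump_eq register register nat           \<comment> \<open>operands, target\<close>
  | Jump_less register register nat         \<comment> \<open>operands, target\<close>

record state =
  pc :: nat
  regs :: "register \<Rightarrow> nat"
  mem :: "nat \<Rightarrow> nat"

text \<open>Division by zero follows the library: \<open>x div 0 = 0\<close> and \<open>x mod 0 = x\<close>.\<close>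

fun binop_val :: "nat \<Rightarrow> binop \<Rightarrow> nat \<Rightarrow> nat \<Rightarrow> nat" where
  "binop_val w Add x y = take_bit w (x + y)"
| "binop_val w Sub x y = take_bit w (2 ^ w + x - y)"
| "binop_val w Mul x y = take_bit w (x * y)"
| "binop_val w Div x y = take_bit w (x div y)"
| "binop_val w Mod x y = take_bit w (x mod y)"
| "binop_val w And x y = take_bit w (x AND y)"
| "binop_val w Or x y = take_bit w (x OR y)"
| "binop_val w Xor x y = take_bit w (x XOR y)"
| "binop_val w Shl x y = take_bit w (push_bit y x)"
| "binop_val w Shr x y = take_bit w (drop_bit y x)"

fun exec :: "nat \<Rightarrow> instr \<Rightarrow> state \<Rightarrow> state" where
  "exec w (Const d k) s = s\<lparr>pc := pc s + 1, regs := (regs s)(d := take_bit w k)\<rparr>"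
| "exec w (Arith f d a b) s =
     s\<lparr>pc := pc s + 1, regs := (regs s)(d := binop_val w f (regs s a) (regs s b))\<rparr>"
| "exec w (Load d a) s = s\<lparr>pc := pc s + 1, regs := (regs s)(d := mem s (regs s a))\<rparr>"
| "exec w (Store a b) s = s\<lparr>pc := pc s + 1, mem := (mem s)(regs s a := regs s b)\<rparr>"
| "exec w (Jump_eq a b l) s = s\<lparr>pc := (if regs s a = regs s b then l else pc s + 1)\<rparr>"
| "exec w (Jump_less a b l) s = s\<lparr>pc := (if regs s a < regs s b then l else pc s + 1)\<rparr>"

definition halted :: "instr list \<Rightarrow> state \<Rightarrow> bool" where
  "halted P s \<longleftrightarrow> pc s \<ge> length P"

definition step :: "nat \<Rightarrow> instr list \<Rightarrow> state \<Rightarrow> state" where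
  "step w P s = (if halted P s then s else exec w (P ! pc s) s)"

definition words_ok :: "nat \<Rightarrow> state \<Rightarrow> bool" where
  "words_ok w s \<longleftrightarrow> (\<forall>i. regs s i < 2 ^ w) \<and> (\<forall>i. mem s i < 2 ^ w)"

text \<open>The bit string \<open>bs\<close> is packed into the memory cells from address 0 on, \<open>w\<close> bits per cell.\<close>

definition holds_bits :: "nat \<Rightarrow> bool list \<Rightarrow> (nat \<Rightarrow> nat) \<Rightarrow> bool" where
  "holds_bits w bs m \<longleftrightarrow> (\<forall>k < length bs. bit (m (k div w)) (k mod w) = bs ! k)"

text \<open>
  Run on the data \<open>bs\<close> with the arguments in the first registers, the program returns \<open>res\<close> in
  register 0 within \<open>T\<close> steps. All other registers and memory bits may initially hold anything,
  so a program gets no information about the data except from \<open>bs\<close>. The data must be intact at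
  the end, so that arbitrarily many queries can be run one after the other.
\<close>

definition computes ::
    "nat \<Rightarrow> instr list \<Rightarrow> nat \<Rightarrow> bool list \<Rightarrow> nat list \<Rightarrow> nat \<Rightarrow> bool" where
  "computes w P T bs args res \<longleftrightarrow>
     (\<forall>s. pc s = 0 \<and> words_ok w s \<and> holds_bits w bs (mem s) \<and>
          (\<forall>i < length args. regs s i = args ! i) \<longrightarrow>
        (\<exists>k \<le> T. let s' = (step w P ^^ k) s in
           halted P s' \<and> regs s' 0 = res \<and> holds_bits w bs (mem s')))"

text \<open>
  A representation stores a tree \<open>t\<close> as the bit string \<open>enc t\<close>, and refers to its nodes by
  numbers \<open>num t u\<close>, which are to be \<open>1, \<dots>, size t\<close> in some order; null is referred to by 0.
  Handles are confined to this range because words may be longer than \<open>log n\<close> by any constant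
  factor, so that arbitrary one-word handles could carry data not counted in the size of \<open>enc t\<close>.
\<close>

definition valid_numbering :: "(bintree \<Rightarrow> node \<Rightarrow> nat) \<Rightarrow> bool" where
  "valid_numbering num \<longleftrightarrow> (\<forall>t. bij_betw (num t) (nodes t) {1..size t})"

fun handle :: "(node \<Rightarrow> nat) \<Rightarrow> node option \<Rightarrow> nat" where
  "handle f None = 0"
| "handle f (Some u) = f u"

text \<open>
  An operation is supported in constant time if one program answers it on all trees of all sizes,
  within a number of steps that does not depend on the tree.
\<close>

definition supports1 ::
    "(nat \<Rightarrow> nat) \<Rightarrow> (bintree \<Rightarrow> bool list) \<Rightarrow> (bintree \<Rightarrow> node \<Rightarrow> nat) \<Rightarrow>
      (bintree \<Rightarrow> node \<Rightarrow> nat) \<Rightarrow> bool" where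
  "supports1 w enc num f \<longleftrightarrow>
     (\<exists>P T. \<forall>t. \<forall>u \<in> nodes t. computes (w (size t)) P T (enc t) [num t u] (f t u))"

definition supports2 ::
    "(nat \<Rightarrow> nat) \<Rightarrow> (bintree \<Rightarrow> bool list) \<Rightarrow> (bintree \<Rightarrow> node \<Rightarrow> nat) \<Rightarrow>
      (bintree \<Rightarrow> node \<Rightarrow> node \<Rightarrow> nat) \<Rightarrow> bool" where
  "supports2 w enc num f \<longleftrightarrow>
     (\<exists>P T. \<forall>t. \<forall>u \<in> nodes t. \<forall>v \<in> nodes t.
        computes (w (size t)) P T (enc t) [num t u, num t v] (f t u v))"

end

theory Submission
  imports Defs "HOL-Library.Discrete_Functions" "HOL-Real_Asymp.Real_Asymp"
begin

text \<open>
  The tree is cut greedily into few connected clusters of polylogarithmic size, each with at most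
  two other clusters hanging below it. Sizes and ranks in the whole tree are the values within a
  cluster plus a constant number of summands stored with it; the lowest common ancestor of nodes in
  different clusters lies in a cluster found by a sparse table and is determined there by lookup of
  the nodes above which the two given nodes lie. So all operations reduce to the same operations on
  one cluster, at the cost of polylogarithmically many words for every cluster. Applying this
  reduction again, now with numbers of \<open>O(log log n)\<close> bits (here even a small power of
  \<open>log n\<close> is affordable), leaves clusters of less than \<open>log n\<close> nodes. They are stored by a
  code of two bits per node and looked up in tables.
\<close>

section \<open>Straight-line programs from expressions\<close>

text \<open>Handles must be exactly the numbers from 1 to \<open>size t\<close>, so a handle cannot
  just be a pair of a cluster and a local handle. Hence the numbering by chunks, and a table for
  decoding it. With \<open>r\<close> about the eighth root of \<open>log n\<close>, the exponents
  balance these demands: codes of fewer than \<open>4 * r ^ 7\<close> bits fit into a word of more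
  than \<open>r ^ 8\<close> bits, and a table over all such bit strings still has far fewer than
  \<open>n\<close> entries; numbers of \<open>r\<close> bits suffice inside a cluster of fewer than
  \<open>2 * r ^ 32\<close> nodes, as \<open>r ^ 40 \<le> 2 ^ r\<close>; and about
  \<open>r ^ 32\<close> nodes pay for the row of about \<open>w\<close> words that the whole tree
  stores for a cluster, as \<open>w \<le> r ^ 9\<close>. One level alone would fail: clusters small
  enough for table lookup cannot pay for rows of whole words. Programs are fixed while all
  parameters grow, so the word size and the powers of \<open>r\<close> are stored with the data; the
  finitely many word sizes for which the estimates fail are treated by exhaustive case
  distinction.\<close>

text \<open>
  Expressions have no local bindings: subexpressions are simply repeated, which costs only a
  constant factor.
\<close>

datatype expr =
    Arg nat
  | Cst nat
  | Bin binop expr expr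
  | Ld expr
  | Cond bool expr expr expr expr  \<comment> \<open>compares with \<open><\<close> if the flag is set, with \<open>=\<close> otherwise\<close>

definition compare :: "bool \<Rightarrow> nat \<Rightarrow> nat \<Rightarrow> bool" where
  "compare b x y \<longleftrightarrow> (if b then x < y else x = y)"

definition jump :: "bool \<Rightarrow> register \<Rightarrow> register \<Rightarrow> nat \<Rightarrow> instr" where
  "jump b = (if b then Jump_less else Jump_eq)"

lemma exec_jump:
  "exec w (jump b x y l) s = s\<lparr>pc := (if compare b (regs s x) (regs s y) then l else pc s + 1)\<rparr>"
  by (simp add: jump_def compare_def)

fun ev :: "nat \<Rightarrow> (nat \<Rightarrow> nat) \<Rightarrow> (nat \<Rightarrow> nat) \<Rightarrow> expr \<Rightarrow> nat" where
  "ev w m a (Arg i) = a i"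
| "ev w m a (Cst k) = take_bit w k"
| "ev w m a (Bin f e1 e2) = binop_val w f (ev w m a e1) (ev w m a e2)"
| "ev w m a (Ld e) = m (ev w m a e)"
| "ev w m a (Cond b e1 e2 e3 e4) =
     (if compare b (ev w m a e1) (ev w m a e2) then ev w m a e3 else ev w m a e4)"

fun arity_bound :: "expr \<Rightarrow> nat" where
  "arity_bound (Arg i) = Suc i"
| "arity_bound (Cst k) = 0"
| "arity_bound (Bin f e1 e2) = max (arity_bound e1) (arity_bound e2)"
| "arity_bound (Ld e) = arity_bound e"
| "arity_bound (Cond b e1 e2 e3 e4) =
     max (max (arity_bound e1) (arity_bound e2)) (max (arity_bound e3) (arity_bound e4))"

fun code_size :: "expr \<Rightarrow> nat" where
  "code_size (Arg i) = 1"
| "code_size (Cst k) = 1"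
| "code_size (Bin f e1 e2) = code_size e1 + code_size e2 + 1"
| "code_size (Ld e) = code_size e + 1"
| "code_size (Cond b e1 e2 e3 e4) = code_size e1 + code_size e2 + code_size e3 + code_size e4 + 2"

text \<open>
  The code for \<open>e\<close>, to be placed at address \<open>p\<close>, leaves the value of \<open>e\<close> in register \<open>r\<close> and
  changes no register below \<open>r\<close>.
\<close>

fun compile :: "expr \<Rightarrow> register \<Rightarrow> nat \<Rightarrow> instr list" where
  "compile (Arg i) r p = [Arith Or r i i]"
| "compile (Cst k) r p = [Const r k]"
| "compile (Bin f e1 e2) r p =
     compile e1 r p @ compile e2 (Suc r) (p + code_size e1) @ [Arith f r r (Suc r)]"
| "compile (Ld e) r p = compile e r p @ [Load r r]"
| "compile (Cond b e1 e2 e3 e4) r p =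
     (let p2 = p + code_size e1; p4 = p2 + code_size e2 + 1; p3 = p4 + code_size e4 + 1 in
      compile e1 r p @ compile e2 (Suc r) p2 @ [jump b r (Suc r) p3] @
      compile e4 r p4 @ [jump False r r (p3 + code_size e3)] @ compile e3 r p3)"

lemma length_compile [simp]: "length (compile e r p) = code_size e"
  by (induction e r p rule: compile.induct) (auto simp: Let_def)

definition steps :: "nat \<Rightarrow> instr list \<Rightarrow> nat \<Rightarrow> state \<Rightarrow> state \<Rightarrow> bool" where
  "steps w P T s s' \<longleftrightarrow> (\<exists>k \<le> T. (step w P ^^ k) s = s')"

lemma steps_trans: "steps w P T s s' \<Longrightarrow> steps w P T' s' s'' \<Longrightarrow> steps w P (T + T') s s''"
proof -
  assume "steps w P T s s'" "steps w P T' s' s''"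
  then obtain k k' where "k \<le> T" "k' \<le> T'" "(step w P ^^ k) s = s'" "(step w P ^^ k') s' = s''"
    unfolding steps_def by blast
  then show ?thesis unfolding steps_def
    by (intro exI[of _ "k' + k"]) (simp add: funpow_add)
qed

lemma steps_exec:
  assumes "P = us @ i # vs" "pc s = length us"
  shows "steps w P 1 s (exec w i s)"
  using assms unfolding steps_def
  by (intro exI[of _ 1]) (simp add: step_def halted_def nth_append)

lemma steps_mono: "steps w P T s s' \<Longrightarrow> T \<le> T' \<Longrightarrow> steps w P T' s s'"
  unfolding steps_def using le_trans by blast

lemma binop_val_less: "binop_val w f x y < 2 ^ w"
  by (cases f) (simp_all only: binop_val.simps take_bit_nat_less_exp)

definition delivers :: "nat \<Rightarrow> register \<Rightarrow> nat \<Rightarrow> nat \<Rightarrow> state \<Rightarrow> state \<Rightarrow> bool" where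
  "delivers w r q v s s' \<longleftrightarrow>
     pc s' = q \<and> mem s' = mem s \<and> (\<forall>i<r. regs s' i = regs s i) \<and> regs s' r = v \<and> words_ok w s'"

text \<open>The code of an operand overwrites registers from \<open>r\<close> on. The arguments lie
  below, so the next operand still has the value it would have had at the start.\<close>

lemma ev_cong: "(\<And>i. i < arity_bound e \<Longrightarrow> a i = b i) \<Longrightarrow> ev w m a e = ev w m b e"
  by (induction e) auto

lemma words_ok_binop: "words_ok w s \<Longrightarrow> words_ok w (exec w (Arith f d a b) s)"
  by (simp add: words_ok_def binop_val_less)

text \<open>Jump targets are absolute, so the surrounding code \<open>us\<close> and
  \<open>vs\<close> is arbitrary and the induction hypotheses speak about parts of one program
  \<open>P\<close>. The bound on \<open>r\<close> keeps scratch registers above the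
  arguments.\<close>

lemma compile_correct:
  assumes "P = us @ compile e r (length us) @ vs" "pc s = length us" "words_ok w s"
    "arity_bound e \<le> r"
  shows "\<exists>s'. steps w P (code_size e) s s' \<and>
    delivers w r (length us + code_size e) (ev w (mem s) (regs s) e) s s'"
  using assms
proof (induction e arbitrary: r us vs s)
  case (Arg i)
  have "steps w P 1 s (exec w (Arith Or r i i) s)"
    using Arg.prems by (intro steps_exec[of _ us _ vs]) auto
  \<comment> \<open>There is no move instruction: \<open>Or\<close> of a register with itself copies
    it, since reduction modulo \<open>2 ^ w\<close> does not change a word.\<close>
  moreover have "regs s i < 2 ^ w" using Arg.prems(3) by (auto simp: words_ok_def)
  then have "delivers w r (length us + 1) (regs s i) s (exec w (Arith Or r i i) s)"
    using Arg.prems words_ok_binop[OF Arg.prems(3), of Or r i i]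
    by (simp add: delivers_def take_bit_nat_eq_self)
  ultimately show ?case by auto
next
  case (Cst k)
  have "steps w P 1 s (exec w (Const r k) s)"
    using Cst.prems by (intro steps_exec[of _ us _ vs]) auto
  moreover have "delivers w r (length us + 1) (take_bit w k) s (exec w (Const r k) s)"
    using Cst.prems by (simp add: delivers_def words_ok_def)
  ultimately show ?case by auto
next
  case (Bin f e1 e2)
  let ?e = "\<lambda>e. ev w (mem s) (regs s) e"
  let ?c1 = "compile e1 r (length us)"
  let ?us2 = "us @ ?c1"
  let ?c2 = "compile e2 (Suc r) (length ?us2)"
  have P: "P = us @ ?c1 @ (?c2 @ Arith f r r (Suc r) # vs)"
    "P = ?us2 @ ?c2 @ (Arith f r r (Suc r) # vs)"
    "P = (?us2 @ ?c2) @ Arith f r r (Suc r) # vs"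
    using Bin.prems(1) by auto
  obtain s1 where s1: "steps w P (code_size e1) s s1"
    "delivers w r (length ?us2) (?e e1) s s1"
    using Bin.IH(1)[OF P(1) Bin.prems(2,3)] Bin.prems(4) by auto
  have ok1: "words_ok w s1" "pc s1 = length ?us2" using s1(2) by (auto simp: delivers_def)
  have eq: "ev w (mem s1) (regs s1) e2 = ?e e2"
    using s1(2) Bin.prems(4) by (auto simp: delivers_def intro: ev_cong)
  obtain s2 where s2: "steps w P (code_size e2) s1 s2"
    "delivers w (Suc r) (length (?us2 @ ?c2)) (?e e2) s1 s2"
    using Bin.IH(2)[OF P(2) ok1(2,1)] Bin.prems(4) eq by (auto simp: add.assoc)
  have "pc s2 = length (?us2 @ ?c2)" using s2(2) by (auto simp: delivers_def)
  from steps_exec[OF P(3) this]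
  have s3: "steps w P 1 s2 (exec w (Arith f r r (Suc r)) s2)" .
  have "words_ok w (exec w (Arith f r r (Suc r)) s2)"
    using words_ok_binop s2(2) unfolding delivers_def by blast
  then have "delivers w r (length us + code_size (Bin f e1 e2)) (?e (Bin f e1 e2)) s
    (exec w (Arith f r r (Suc r)) s2)"
    using s1(2) s2(2) by (auto simp: delivers_def)
  then show ?case
    using steps_trans[OF steps_trans[OF s1(1) s2(1)] s3] by auto
next
  case (Ld e)
  let ?c = "compile e r (length us)"
  have P: "P = us @ ?c @ (Load r r # vs)" "P = (us @ ?c) @ Load r r # vs"
    using Ld.prems(1) by auto
  obtain s1 where s1: "steps w P (code_size e) s s1"
    "delivers w r (length (us @ ?c)) (ev w (mem s) (regs s) e) s s1"
    using Ld.IH[OF P(1) Ld.prems(2,3)] Ld.prems(4) by auto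
  have "pc s1 = length (us @ ?c)" using s1(2) by (auto simp: delivers_def)
  from steps_exec[OF P(2) this] have s2: "steps w P 1 s1 (exec w (Load r r) s1)" .
  have "delivers w r (length us + code_size (Ld e)) (ev w (mem s) (regs s) (Ld e)) s
    (exec w (Load r r) s1)"
    using s1(2) by (auto simp: delivers_def words_ok_def)
  then show ?case using steps_trans[OF s1(1) s2] by auto
next
  case (Cond b e1 e2 e3 e4)
  let ?e = "\<lambda>e. ev w (mem s) (regs s) e"
  let ?c1 = "compile e1 r (length us)"
  let ?us2 = "us @ ?c1"
  let ?c2 = "compile e2 (Suc r) (length ?us2)"
  let ?p3 = "length us + code_size e1 + code_size e2 + 1 + code_size e4 + 1"
  let ?j = "jump b r (Suc r) ?p3"
  let ?us4 = "?us2 @ ?c2 @ [?j]"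
  let ?c4 = "compile e4 r (length ?us4)"
  \<comment> \<open>Comparing a register with itself for equality makes the jump unconditional; it
    skips the code of \<open>e3\<close>, which stands last.\<close>
  let ?k = "jump False r r (?p3 + code_size e3)"
  let ?us3 = "?us4 @ ?c4 @ [?k]"
  let ?c3 = "compile e3 r (length ?us3)"
  have P: "P = us @ ?c1 @ (?c2 @ ?j # ?c4 @ ?k # ?c3 @ vs)"
    "P = ?us2 @ ?c2 @ (?j # ?c4 @ ?k # ?c3 @ vs)"
    "P = (?us2 @ ?c2) @ ?j # (?c4 @ ?k # ?c3 @ vs)"
    "P = ?us4 @ ?c4 @ (?k # ?c3 @ vs)"
    "P = (?us4 @ ?c4) @ ?k # (?c3 @ vs)"
    "P = ?us3 @ ?c3 @ vs"
    using Cond.prems(1) by (auto simp: Let_def ac_simps)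
  obtain s1 where s1: "steps w P (code_size e1) s s1"
    "delivers w r (length ?us2) (?e e1) s s1"
    using Cond.IH(1)[OF P(1) Cond.prems(2,3)] Cond.prems(4) by auto
  have ok1: "words_ok w s1" "pc s1 = length ?us2" using s1(2) by (auto simp: delivers_def)
  have eq: "ev w (mem s1) (regs s1) e2 = ?e e2"
    using s1(2) Cond.prems(4) by (auto simp: delivers_def intro: ev_cong)
  obtain s2 where s2: "steps w P (code_size e2) s1 s2"
    "delivers w (Suc r) (length (?us2 @ ?c2)) (?e e2) s1 s2"
    using Cond.IH(2)[OF P(2) ok1(2,1)] Cond.prems(4) eq by (auto simp: add.assoc)
  have "pc s2 = length (?us2 @ ?c2)" using s2(2) by (auto simp: delivers_def)
  define t where "t = exec w ?j s2"
  from steps_exec[OF P(3) \<open>pc s2 = _\<close>] have s3: "steps w P 1 s2 t" unfolding t_def .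
  note s123 = steps_trans[OF steps_trans[OF s1(1) s2(1)] s3]
  have s3': "mem t = mem s" "\<forall>i<r. regs t i = regs s i" "words_ok w t"
    "pc t = (if compare b (?e e1) (?e e2) then length ?us3 else length ?us4)"
    using s1(2) s2(2) by (auto simp: t_def delivers_def words_ok_def exec_jump)
  have eq3: "ev w (mem t) (regs t) e3 = ?e e3" "ev w (mem t) (regs t) e4 = ?e e4"
    unfolding s3'(1) by (intro ev_cong; use s3'(2) Cond.prems(4) in auto)+
  show ?case
  proof (cases "compare b (?e e1) (?e e2)")
    case True
    obtain s4 where s4: "steps w P (code_size e3) t s4"
      "delivers w r (length ?us3 + code_size e3) (?e e3) t s4"
      using Cond.IH(3)[OF P(6) _ s3'(3)] s3'(4) True eq3 Cond.prems(4) by (auto simp: add.assoc)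
    have "delivers w r (length us + code_size (Cond b e1 e2 e3 e4)) (?e (Cond b e1 e2 e3 e4)) s s4"
      using s4(2) s3' True by (auto simp: delivers_def)
    moreover have "steps w P (code_size (Cond b e1 e2 e3 e4)) s s4"
      using steps_trans[OF s123 s4(1)] by (rule steps_mono) auto
    ultimately show ?thesis by blast
  next
    case False
    obtain s4 where s4: "steps w P (code_size e4) t s4"
      "delivers w r (length (?us4 @ ?c4)) (?e e4) t s4"
      using Cond.IH(4)[OF P(4) _ s3'(3)] s3'(4) False eq3 Cond.prems(4) by (auto simp: add.assoc)
    have "pc s4 = length (?us4 @ ?c4)" using s4(2) by (auto simp: delivers_def)
    from steps_exec[OF P(5) this] have s5: "steps w P 1 s4 (exec w ?k s4)" .
    have "delivers w r (length us + code_size (Cond b e1 e2 e3 e4)) (?e (Cond b e1 e2 e3 e4)) s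
      (exec w ?k s4)"
      using s4(2) s3' False by (auto simp: delivers_def words_ok_def exec_jump compare_def)
    moreover have "steps w P (code_size (Cond b e1 e2 e3 e4)) s (exec w ?k s4)"
      using steps_trans[OF steps_trans[OF s123 s4(1)] s5] by (rule steps_mono) auto
    ultimately show ?thesis by blast
  qed
qed

lemma ev_less: "(\<And>i. m i < 2 ^ w) \<Longrightarrow> (\<And>i. a i < 2 ^ w) \<Longrightarrow> ev w m a e < 2 ^ w"
  by (induction e) (auto simp: binop_val_less)

text \<open>Scratch registers start above the arguments and above register 0, and expressions never
  store. So arguments and data survive until the final \<open>Or\<close> copies the result into
  register 0.\<close>

theorem computes_expr:
  assumes "\<And>s. pc s = 0 \<Longrightarrow> words_ok w s \<Longrightarrow> holds_bits w bs (mem s) \<Longrightarrow>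
    (\<forall>i < length args. regs s i = args ! i) \<Longrightarrow> ev w (mem s) (regs s) e = res"
  shows "computes w
    (compile e (arity_bound e + 1) 0 @ [Arith Or 0 (arity_bound e + 1) (arity_bound e + 1)])
    (code_size e + 1) bs args res"
  unfolding computes_def
proof (intro allI impI, elim conjE)
  fix s :: state
  let ?r = "arity_bound e + 1"
  let ?i = "Arith Or 0 ?r ?r"
  let ?P = "compile e ?r 0 @ [?i]"
  assume s: "pc s = 0" "words_ok w s" "holds_bits w bs (mem s)"
    "\<forall>i < length args. regs s i = args ! i"
  obtain s1 where s1: "steps w ?P (code_size e) s s1"
    "delivers w ?r (code_size e) (ev w (mem s) (regs s) e) s s1"
    using compile_correct[of ?P "[]" e ?r "[?i]" s w] s by auto
  have s2: "steps w ?P 1 s1 (exec w ?i s1)"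
    using s1(2) by (intro steps_exec[of _ "compile e ?r 0" _ "[]"]) (auto simp: delivers_def)
  have "ev w (mem s) (regs s) e < 2 ^ w"
    using s1(2) unfolding delivers_def words_ok_def by metis
  then have "halted ?P (exec w ?i s1) \<and> regs (exec w ?i s1) 0 = res \<and>
    holds_bits w bs (mem (exec w ?i s1))"
    using s1(2) s assms[OF s] by (auto simp: delivers_def halted_def take_bit_nat_eq_self[of "ev _ _ _ _"])
  moreover obtain k where "k \<le> code_size e + 1" "(step w ?P ^^ k) s = exec w ?i s1"
    using steps_trans[OF s1(1) s2] unfolding steps_def by blast
  ultimately show "\<exists>k \<le> code_size e + 1. let s' = (step w ?P ^^ k) s in
      halted ?P s' \<and> regs s' 0 = res \<and> holds_bits w bs (mem s')"
    by (auto simp only: Let_def intro!: exI[of _ k])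
qed

section \<open>Functions computable in constant time\<close>

text \<open>
  The type \<open>'x\<close> stands for the possible inputs together with everything that they represent, in
  particular the tree. A function of it is \<open>ram\<close> on \<open>D\<close> if a single expression computes it for
  all inputs in \<open>D\<close>. So programs are never written down: closure properties yield them together
  with their correctness.
\<close>

locale machine =
  fixes wd :: "'x \<Rightarrow> nat" and mm :: "'x \<Rightarrow> nat \<Rightarrow> nat" and ar :: "'x \<Rightarrow> nat \<Rightarrow> nat"
  assumes mm_less: "mm x i < 2 ^ wd x" and ar_less: "ar x i < 2 ^ wd x"
begin

definition ram :: "'x set \<Rightarrow> ('x \<Rightarrow> nat) \<Rightarrow> bool" where
  "ram D f \<longleftrightarrow> (\<exists>e. \<forall>x\<in>D. ev (wd x) (mm x) (ar x) e = f x)"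

lemma ram_less: "ram D f \<Longrightarrow> x \<in> D \<Longrightarrow> f x < 2 ^ wd x"
  unfolding ram_def using ev_less mm_less ar_less by metis

lemma ram_cong: "ram D f \<Longrightarrow> (\<And>x. x \<in> D \<Longrightarrow> f x = g x) \<Longrightarrow> ram D g"
  unfolding ram_def by auto

lemma ram_mono: "ram D f \<Longrightarrow> D' \<subseteq> D \<Longrightarrow> ram D' f"
  unfolding ram_def by blast

lemma ram_arg: "ram D (\<lambda>x. ar x i)"
  unfolding ram_def by (rule exI[of _ "Arg i"]) simp

lemma ram_take_bit_const: "ram D (\<lambda>x. take_bit (wd x) k)"
  unfolding ram_def by (rule exI[of _ "Cst k"]) simp

lemma ram_const: "(\<And>x. x \<in> D \<Longrightarrow> k < 2 ^ wd x) \<Longrightarrow> ram D (\<lambda>x. k)"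
  by (rule ram_cong[OF ram_take_bit_const[of _ k]]) (simp add: take_bit_nat_eq_self)

lemma ram_0: "ram D (\<lambda>x. 0)"
  by (rule ram_const) simp

lemma ram_load: "ram D f \<Longrightarrow> ram D (\<lambda>x. mm x (f x))"
  unfolding ram_def by (metis ev.simps(4))

lemma ram_binop: "ram D f \<Longrightarrow> ram D g \<Longrightarrow> ram D (\<lambda>x. binop_val (wd x) b (f x) (g x))"
  unfolding ram_def by (metis ev.simps(3))

lemma ram_add:
  assumes "ram D f" "ram D g" "\<And>x. x \<in> D \<Longrightarrow> f x + g x < 2 ^ wd x"
  shows "ram D (\<lambda>x. f x + g x)"
  by (rule ram_cong[OF ram_binop[OF assms(1,2), of Add]]) (simp add: assms take_bit_nat_eq_self)

lemma ram_diff: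
  assumes "ram D f" "ram D g" "\<And>x. x \<in> D \<Longrightarrow> g x \<le> f x"
  shows "ram D (\<lambda>x. f x - g x)"
proof (rule ram_cong[OF ram_binop[OF assms(1,2), of Sub]])
  fix x assume x: "x \<in> D"
  have "(2 ^ wd x + f x - g x) mod 2 ^ wd x = (f x - g x) mod 2 ^ wd x"
    using assms(3)[OF x] by (metis Nat.add_diff_assoc mod_add_self1)
  also have "\<dots> = f x - g x" using ram_less[OF assms(1) x] by (simp add: less_imp_diff_less)
  finally show "binop_val (wd x) Sub (f x) (g x) = f x - g x" by (simp add: take_bit_eq_mod)
qed

lemma ram_mult:
  assumes "ram D f" "ram D g" "\<And>x. x \<in> D \<Longrightarrow> f x * g x < 2 ^ wd x"
  shows "ram D (\<lambda>x. f x * g x)"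
  by (rule ram_cong[OF ram_binop[OF assms(1,2), of Mul]]) (simp add: assms take_bit_nat_eq_self)

lemma ram_div:
  assumes "ram D f" "ram D g"
  shows "ram D (\<lambda>x. f x div g x)"
proof (rule ram_cong[OF ram_binop[OF assms(1,2), of Div]])
  fix x assume "x \<in> D"
  then have "f x div g x < 2 ^ wd x"
    using ram_less[OF assms(1)] div_le_dividend le_less_trans by blast
  then show "binop_val (wd x) Div (f x) (g x) = f x div g x" by (simp add: take_bit_nat_eq_self)
qed

lemma ram_mod:
  assumes "ram D f" "ram D g"
  shows "ram D (\<lambda>x. f x mod g x)"
proof (rule ram_cong[OF ram_binop[OF assms(1,2), of Mod]])
  fix x assume "x \<in> D"
  then have "f x mod g x < 2 ^ wd x"
    using ram_less[OF assms(1)] mod_less_eq_dividend le_less_trans by blast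
  then show "binop_val (wd x) Mod (f x) (g x) = f x mod g x" by (simp add: take_bit_nat_eq_self)
qed

text \<open>Each branch has to be correct only on the inputs that reach it. Hence it may rely on the
  test, for instance to exclude overflow or a missing hole.\<close>

lemma ram_Cond:
  assumes "ram D f" "ram D g"
    "ram {x\<in>D. compare b (f x) (g x)} h" "ram {x\<in>D. \<not> compare b (f x) (g x)} h'"
  shows "ram D (\<lambda>x. if compare b (f x) (g x) then h x else h' x)"
proof -
  from assms obtain e1 e2 e3 e4 where
    "\<forall>x\<in>D. ev (wd x) (mm x) (ar x) e1 = f x" "\<forall>x\<in>D. ev (wd x) (mm x) (ar x) e2 = g x"
    "\<forall>x\<in>{x\<in>D. compare b (f x) (g x)}. ev (wd x) (mm x) (ar x) e3 = h x"
    "\<forall>x\<in>{x\<in>D. \<not> compare b (f x) (g x)}. ev (wd x) (mm x) (ar x) e4 = h' x"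
    unfolding ram_def by blast
  then show ?thesis unfolding ram_def by (intro exI[of _ "Cond b e1 e2 e3 e4"]) auto
qed

lemma ram_if_eq:
  assumes "ram D f" "ram D g" "ram {x\<in>D. f x = g x} h" "ram {x\<in>D. f x \<noteq> g x} h'"
  shows "ram D (\<lambda>x. if f x = g x then h x else h' x)"
  using ram_Cond[of D f g False h h'] assms by (simp add: compare_def)

lemma ram_if_less:
  assumes "ram D f" "ram D g" "ram {x\<in>D. f x < g x} h" "ram {x\<in>D. \<not> f x < g x} h'"
  shows "ram D (\<lambda>x. if f x < g x then h x else h' x)"
  using ram_Cond[of D f g True h h'] assms by (simp add: compare_def)

text \<open>The same function may be computed by different expressions on two parts of the domain,
  as long as a computable test tells the parts apart.\<close>

lemma ram_split_eq:
  assumes "ram D f" "ram D g" "ram {x\<in>D. f x = g x} h" "ram {x\<in>D. f x \<noteq> g x} h"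
  shows "ram D h"
  using ram_if_eq[OF assms] by simp

lemma ram_split_less:
  assumes "ram D f" "ram D g" "ram {x\<in>D. f x < g x} h" "ram {x\<in>D. \<not> f x < g x} h"
  shows "ram D h"
  using ram_if_less[OF assms] by simp

lemma ram_min:
  assumes "ram D f" "ram D g"
  shows "ram D (\<lambda>x. min (f x) (g x))"
proof -
  have "ram D (\<lambda>x. if f x < g x then f x else g x)"
    by (rule ram_if_less) (auto intro: assms ram_mono)
  then show ?thesis by (rule ram_cong) auto
qed

subsection \<open>Functions of finitely many bounded quantities\<close>

text \<open>A program sees the word size through truncation: the constant \<open>2 ^ j\<close>
  becomes 0 exactly if the word size is at most \<open>j\<close>. This separates the sizes up to
  \<open>W\<close> from each other and from all larger ones.\<close>

lemma ram_bounded_wd: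
  assumes "\<And>j. j \<le> W \<Longrightarrow> ram {x\<in>D. wd x = j} f" "ram {x\<in>D. W < wd x} f"
  shows "ram D f"
proof -
  have split: "ram E f" if "ram {x\<in>E. wd x \<le> j} f" "ram {x\<in>E. \<not> wd x \<le> j} f" for E j
  proof -
    have eq: "take_bit (wd x) (2 ^ j :: nat) = take_bit (wd x) 0 \<longleftrightarrow> wd x \<le> j" for x
    proof (cases "wd x \<le> j")
      case True
      then show ?thesis by (simp add: take_bit_eq_0_iff le_imp_power_dvd)
    next
      case False
      then have "take_bit (wd x) (2 ^ j :: nat) = 2 ^ j" by (intro take_bit_nat_eq_self) simp
      with False show ?thesis by simp
    qed
    show ?thesis
      by (rule ram_split_eq[OF ram_take_bit_const[of _ "2 ^ j"] ram_take_bit_const[of _ 0]])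
        (use that in \<open>simp_all only: eq\<close>)
  qed
  have "ram {x\<in>D. wd x < j} f" if "j \<le> Suc W" for j using that
  proof (induction j)
    case 0
    then show ?case unfolding ram_def by auto
  next
    case (Suc j)
    have "{x \<in> {x \<in> D. wd x < Suc j}. wd x < j} = {x\<in>D. wd x < j}"
      "{x \<in> {x \<in> D. wd x < Suc j}. \<not> wd x < j} = {x\<in>D. wd x = j}" by auto
    show ?case
    proof (cases j)
      case 0
      then have "{x \<in> D. wd x < Suc j} = {x\<in>D. wd x = j}" by auto
      then show ?thesis using assms(1)[of j] Suc.prems by simp
    next
      case (Suc i)
      have "{x \<in> {x \<in> D. wd x < Suc j}. wd x \<le> i} = {x\<in>D. wd x < j}"
        "{x \<in> {x \<in> D. wd x < Suc j}. \<not> wd x \<le> i} = {x\<in>D. wd x = j}" using Suc by auto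
      then show ?thesis using split[of "{x\<in>D. wd x < Suc j}" i] Suc.IH assms(1)[of j] Suc.prems
        by simp
    qed
  qed
  from this[of "Suc W"] have "ram {x\<in>D. wd x \<le> W} f" by (simp add: less_Suc_eq_le)
  then show ?thesis using split[of D W] assms(2) by (simp add: not_le)
qed

text \<open>A decision tree compares every \<open>g i\<close> with each of its at most
  \<open>2 ^ W\<close> values; at its leaves \<open>f\<close> is constant. The tree is huge but
  fixed.\<close>

lemma ram_determined:
  fixes k :: nat
  assumes "\<And>i. i < k \<Longrightarrow> ram D (g i)" "\<And>x. x \<in> D \<Longrightarrow> wd x = W" "\<And>x. x \<in> D \<Longrightarrow> f x < 2 ^ W"
    "\<And>x y. x \<in> D \<Longrightarrow> y \<in> D \<Longrightarrow> (\<And>i. i < k \<Longrightarrow> g i x = g i y) \<Longrightarrow> f x = f y"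
  shows "ram D f"
  using assms
proof (induction k arbitrary: D)
  case 0
  show ?case
  proof (cases "D = {}")
    case True
    then show ?thesis by (simp add: ram_def)
  next
    case False
    then obtain x where x: "x \<in> D" by blast
    have "ram D (\<lambda>_. f x)" by (rule ram_const) (simp add: 0(2,3) x)
    then show ?thesis by (rule ram_cong) (rule 0(4)[OF x], auto)
  qed
next
  case (Suc k)
  have 1: "ram {x\<in>D. g k x = v} f" for v
  proof (rule Suc.IH)
    show "ram {x \<in> D. g k x = v} (g i)" if "i < k" for i
      using ram_mono[OF Suc.prems(1)[of i]] that by auto
    fix x y assume xy: "x \<in> {x \<in> D. g k x = v}" "y \<in> {x \<in> D. g k x = v}"
      "\<And>i. i < k \<Longrightarrow> g i x = g i y"
    show "f x = f y" by (rule Suc.prems(4)) (use xy in \<open>auto elim!: less_SucE\<close>)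
  qed (simp_all add: Suc.prems(2,3))
  have gk: "ram D (g k)" using Suc.prems(1) by blast
  note W = Suc.prems(2)
  have "ram {x\<in>D. g k x < V} f" if "V \<le> 2 ^ W" for V using that
  proof (induction V)
    case 0
    then show ?case by (simp add: ram_def)
  next
    case (Suc V)
    let ?D = "{x\<in>D. g k x < Suc V}"
    have "ram ?D (g k)" by (rule ram_mono[OF gk]) auto
    moreover have "ram ?D (\<lambda>_. V)" 
    proof (rule ram_const)
      fix x assume "x \<in> ?D"
      then have "wd x = W" using W[of x] by blast
      then show "V < 2 ^ wd x" using Suc.prems by auto
    qed
    moreover have "{x\<in>?D. g k x = V} = {x\<in>D. g k x = V}" "{x\<in>?D. g k x \<noteq> V} = {x\<in>D. g k x < V}"
      by auto
    moreover have "ram {x\<in>D. g k x < V} f" using Suc.IH Suc.prems by linarith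
    ultimately show ?case using 1[of V] ram_split_eq[of ?D "g k" "\<lambda>_. V" f] by metis
  qed
  from this[of "2 ^ W"] have "ram {x\<in>D. g k x < 2 ^ W} f" by simp
  moreover have "{x\<in>D. g k x < 2 ^ W} = D" using ram_less[OF gk] W by force
  ultimately show ?case by simp
qed

end

section \<open>Bit strings in memory\<close>

text \<open>Generalizes \<open>holds_bits\<close> to data starting at cell \<open>A\<close>, so that
  word-aligned parts of the data can be treated on their own.\<close>

definition seg :: "nat \<Rightarrow> (nat \<Rightarrow> nat) \<Rightarrow> nat \<Rightarrow> bool list \<Rightarrow> bool" where
  "seg w m A bs \<longleftrightarrow> (\<forall>k < length bs. bit (m (A + k div w)) (k mod w) = bs ! k)"

lemma holds_bits_seg: "holds_bits w bs m \<longleftrightarrow> seg w m 0 bs"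
  by (simp add: holds_bits_def seg_def)

lemma seg_append1: "seg w m A (xs @ ys) \<Longrightarrow> seg w m A xs"
  by (auto simp: seg_def nth_append split: if_splits)

lemma seg_append2:
  assumes "seg w m A (xs @ ys)" "length xs = l * w" "w > 0"
  shows "seg w m (A + l) ys"
  unfolding seg_def
proof (intro allI impI)
  fix k assume "k < length ys"
  then have "bit (m (A + (length xs + k) div w)) ((length xs + k) mod w) = (xs @ ys) ! (length xs + k)"
    using assms(1) unfolding seg_def by (metis length_append nat_add_left_cancel_less)
  moreover have "(length xs + k) mod w = k mod w" using assms(2) by simp
  moreover have "(length xs + k) div w = l + k div w" using assms(2,3) by simp
  ultimately show "bit (m (A + l + k div w)) (k mod w) = ys ! k"
    by (simp add: nth_append add.assoc)
qed

definition nat_of_bits :: "bool list \<Rightarrow> nat" where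
  "nat_of_bits bs = horner_sum of_bool 2 bs"

definition bits_of_nat :: "nat \<Rightarrow> nat \<Rightarrow> bool list" where
  "bits_of_nat b n = map (bit n) [0..<b]"

lemma length_bits_of_nat [simp]: "length (bits_of_nat b n) = b"
  by (simp add: bits_of_nat_def)

lemma bit_nat_of_bits: "bit (nat_of_bits bs) j \<longleftrightarrow> j < length bs \<and> bs ! j"
  by (auto simp: nat_of_bits_def bit_horner_sum_bit_iff)

lemma bit_less: "(n::nat) < 2 ^ b \<Longrightarrow> bit n j \<Longrightarrow> j < b"
  by (metis bit_take_bit_iff take_bit_nat_eq_self)

lemma nat_of_bits_of_nat: "n < 2 ^ b \<Longrightarrow> nat_of_bits (bits_of_nat b n) = n"
  by (rule bit_eqI) (auto simp: bit_nat_of_bits bits_of_nat_def dest: bit_less)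

lemma nat_of_bits_less: "nat_of_bits bs < 2 ^ length bs"
  unfolding nat_of_bits_def by (simp add: horner_sum_of_bool_2_less)

text \<open>Defined from the memory and not from a bit string, so a window may run past the end of
  the data; its last bits are then arbitrary.\<close>

definition window :: "nat \<Rightarrow> (nat \<Rightarrow> nat) \<Rightarrow> nat \<Rightarrow> nat \<Rightarrow> nat \<Rightarrow> nat" where
  "window w m A p b =
     nat_of_bits (map (\<lambda>j. bit (m (A + (p + j) div w)) ((p + j) mod w)) [0..<b])"

lemma bit_window:
  "bit (window w m A p b) j \<longleftrightarrow> j < b \<and> bit (m (A + (p + j) div w)) ((p + j) mod w)"
  by (auto simp: window_def bit_nat_of_bits)

lemma window_less: "window w m A p b < 2 ^ b"
  using nat_of_bits_less[of "map (\<lambda>j. bit (m (A + (p + j) div w)) ((p + j) mod w)) [0..<b]"]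
  by (simp add: window_def)

lemma seg_window:
  assumes "seg w m A bs" "p + b \<le> length bs"
  shows "window w m A p b = nat_of_bits (take b (drop p bs))"
  using assms by (auto intro!: bit_eqI simp: bit_window bit_nat_of_bits seg_def)

lemma seg_word:
  assumes "seg w m A (bits_of_nat w n @ bs)" "n < 2 ^ w" "m A < 2 ^ w"
  shows "m A = n"
proof (rule bit_eqI)
  fix j
  show "bit (m A) j = bit n j"
  proof (cases "j < w")
    case True
    then show ?thesis using assms(1) unfolding seg_def
      by (auto simp: nth_append bits_of_nat_def dest: spec[of _ j])
  next
    case False
    then show ?thesis using assms(2,3) bit_less by blast
  qed
qed

context machine begin

text \<open>As \<open>b x < wd x\<close>, the window meets at most two cells. The second one is
  always read, which requires its address to be a word.\<close>

lemma ram_window: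
  assumes "ram D A" "ram D p" "ram D b" "ram D wd"
    and "\<And>x. x \<in> D \<Longrightarrow> b x < wd x" "\<And>x. x \<in> D \<Longrightarrow> A x + p x div wd x + 1 < 2 ^ wd x"
  shows "ram D (\<lambda>x. window (wd x) (mm x) (A x) (p x) (b x))"
proof -
  let ?q = "\<lambda>x. A x + p x div wd x"
  let ?r = "\<lambda>x. p x mod wd x"
  have q: "ram D ?q" by (intro ram_add ram_div assms(1,2,4)) (use assms(6) in force)
  have one: "ram D (\<lambda>_. 1)" by (rule ram_const) (use assms(6) in force)
  have q1: "ram D (\<lambda>x. ?q x + 1)" by (intro ram_add q one) (use assms(6) in force)
  have r: "ram D ?r" by (intro ram_mod assms)
  have wr: "ram D (\<lambda>x. wd x - ?r x)"
    by (intro ram_diff r assms(4)) (metis assms(5) mod_less_divisor less_imp_le less_nat_zero_code neq0_conv)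
  let ?lo = "\<lambda>x. binop_val (wd x) Shr (mm x (?q x)) (?r x)"
  \<comment> \<open>For an aligned window this shift is by the whole word size and truncation leaves
    0, so both cases share one formula.\<close>
  let ?hi = "\<lambda>x. binop_val (wd x) Shl (mm x (?q x + 1)) (wd x - ?r x)"
  have "ram D (\<lambda>x. (binop_val (wd x) Or (?lo x) (?hi x)) mod (binop_val (wd x) Shl 1 (b x)))"
    by (intro ram_mod ram_binop ram_load q q1 r wr one assms)
  then show ?thesis
  proof (rule ram_cong)
    fix x assume x: "x \<in> D"
    define w where "w = wd x"
    have b: "b x < w" and w: "w > 0" using assms(5)[OF x] by (auto simp: w_def)
    have m: "bit (mm x i) j \<Longrightarrow> j < w" for i j
      using bit_less[OF mm_less] unfolding w_def .
    have pow: "take_bit w (push_bit (b x) (1::nat)) = 2 ^ b x"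
      using b by (simp add: push_bit_eq_mult take_bit_nat_eq_self)
    let ?v = "take_bit w (take_bit w (drop_bit (p x mod w) (mm x (?q x))) OR
      take_bit w (push_bit (w - p x mod w) (mm x (?q x + 1))))"
    have "?v mod 2 ^ b x = window w (mm x) (A x) (p x) (b x)"
    proof (rule bit_eqI)
      fix j
      have "p x + j = (p x mod w + j) + (p x div w) * w" by simp
      then have dm: "(p x + j) div w = p x div w + (p x mod w + j) div w"
        "(p x + j) mod w = (p x mod w + j) mod w"
        using w by (metis div_mult_self1 less_not_refl2, metis mod_mult_self1)
      have v: "bit (?v mod 2 ^ b x) j \<longleftrightarrow> j < b x \<and> (bit (mm x (?q x)) (p x mod w + j) \<or>
          w - p x mod w \<le> j \<and> bit (mm x (?q x + 1)) (j - (w - p x mod w)))"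
        unfolding take_bit_eq_mod[symmetric] bit_take_bit_iff bit_or_iff bit_drop_bit_eq
          bit_push_bit_iff o_def
        using b by auto
      have pm: "p x mod w < w" using w by simp
      show "bit (?v mod 2 ^ b x) j = bit (window w (mm x) (A x) (p x) (b x)) j"
      proof (cases "p x mod w + j < w")
        case True
        then have "\<not> w - p x mod w \<le> j" by linarith
        with True show ?thesis unfolding v bit_window dm by (simp add: w_def)
      next
        case False
        have "\<not> bit (mm x (?q x)) (p x mod w + j)" using m False by blast
        moreover have "j < b x \<Longrightarrow> (p x mod w + j) div w = 1"
          by (rule div_nat_eqI) (use False b pm add_strict_mono[OF pm, of j w] in auto)
        moreover have "j < b x \<Longrightarrow> (p x mod w + j) mod w = j - (w - p x mod w)"
          using False b add_strict_mono[OF pm, of j w] by (simp add: le_mod_geq)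
        ultimately show ?thesis using False unfolding v bit_window dm by (auto simp: w_def)
      qed
    qed
    then show "(binop_val (wd x) Or (?lo x) (?hi x)) mod (binop_val (wd x) Shl 1 (b x)) =
      window (wd x) (mm x) (A x) (p x) (b x)"
      unfolding w_def[symmetric] binop_val.simps pow .
  qed
qed

end

section \<open>Trees as sets of paths\<close>

lemma nodes_Leaf [simp]: "nodes Leaf = {}"
  by (simp add: nodes_def)

lemma nodes_Node: "nodes (Node l a r) = insert [] (Cons Left ` nodes l \<union> Cons Right ` nodes r)"
  by (auto simp: nodes_def tree.set_map)

lemma Nil_in_nodes: "[] \<in> nodes t \<longleftrightarrow> t \<noteq> Leaf"
  by (cases t) (auto simp: nodes_Node)

lemma Cons_in_nodes:
  "d # u \<in> nodes t \<longleftrightarrow> (case t of Leaf \<Rightarrow> False | Node l _ r \<Rightarrow> u \<in> nodes (if d = Left then l else r))"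
  by (cases t; cases d) (auto simp: nodes_Node)

lemma finite_nodes [simp]: "finite (nodes t)"
  by (induction t) (auto simp: nodes_Node)

lemma card_nodes: "card (nodes t) = size t"
proof (induction t)
  case (Node l a r)
  have "card (nodes (Node l a r)) = Suc (card (Cons Left ` nodes l \<union> Cons Right ` nodes r))"
    unfolding nodes_Node by (subst card_insert_disjoint) auto
  also have "card (Cons Left ` nodes l \<union> Cons Right ` nodes r) = card (nodes l) + card (nodes r)"
    by (subst card_Un_disjoint) (auto simp: card_image)
  finally show ?case using Node by simp
qed simp

lemma nodes_prefix: "v \<in> nodes t \<Longrightarrow> prefix u v \<Longrightarrow> u \<in> nodes t"
proof (induction t arbitrary: u v)
  case (Node l a r)
  then show ?case by (cases u; cases v) (auto simp: Cons_in_nodes Nil_in_nodes split: if_splits)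
qed simp

text \<open>A cluster arises as a set of paths; this makes it a tree again, to which the same
  operations and a further decomposition apply. The induction passes to the paths that remain after
  a first step left or right.\<close>

lemma ex_tree_nodes:
  assumes "finite S" "\<And>u v. v \<in> S \<Longrightarrow> prefix u v \<Longrightarrow> u \<in> S"
  shows "\<exists>t. nodes t = S"
  using assms
proof (induction "card S" arbitrary: S rule: less_induct)
  case less
  show ?case
  proof (cases "S = {}")
    case True
    then show ?thesis using nodes_Leaf by blast
  next
    case False
    then have nil: "[] \<in> S" using less.prems(2) by (metis Nil_prefix ex_in_conv)
    define S' where "S' d = {u. d # u \<in> S}" for d
    have "\<exists>t. nodes t = S' d" for d
    proof (rule less.hyps)
      have img: "Cons d ` S' d \<subseteq> S - {[]}" by (auto simp: S'_def)
      then show "finite (S' d)"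
        using less.prems(1) by (metis finite_Diff finite_imageD finite_subset inj_onI list.inject)
      have "card (S' d) = card (Cons d ` S' d)" by (simp add: card_image)
      also have "\<dots> \<le> card (S - {[]})" using img less.prems(1) by (intro card_mono) auto
      also have "\<dots> < card S" using nil less.prems(1) by (meson card_Diff1_less)
      finally show "card (S' d) < card S" .
    qed (use less.prems(2) in \<open>auto simp: S'_def\<close>)
    then obtain l r where "nodes l = S' Left" "nodes r = S' Right" by metis
    then have "nodes (Node l () r) = S"
      using nil by (auto simp: nodes_Node S'_def image_iff) (metis dir.exhaust neq_Nil_conv)
    then show ?thesis by blast
  qed
qed

lemma nodes_subtree: "u \<in> nodes t \<Longrightarrow> nodes (subtree t u) = {v. u @ v \<in> nodes t}"
proof (induction t u rule: subtree.induct)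
  case (3 l a r u)
  then show ?case by (auto simp: Cons_in_nodes)
next
  case (4 l a r u)
  then show ?case by (auto simp: Cons_in_nodes)
qed auto

lemma subtree_size_card:
  assumes "u \<in> nodes t"
  shows "subtree_size t u = card {v \<in> nodes t. prefix u v}"
proof -
  have "{v \<in> nodes t. prefix u v} = (@) u ` nodes (subtree t u)"
    using assms by (auto simp: nodes_subtree prefix_def)
  moreover have "inj_on ((@) u) (nodes (subtree t u))" by (simp add: inj_on_def)
  ultimately show ?thesis by (simp add: subtree_size_def card_nodes[symmetric] card_image)
qed

text \<open>All prefixes of a node are nodes, so the tree can be forgotten; and common prefixes are
  linearly ordered, so \<open>length\<close> has only one maximal argument.\<close>

lemma lca_eq:
  assumes "u \<in> nodes t" "v \<in> nodes t"
  shows "lca t u v = longest_common_prefix u v"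
proof -
  let ?l = "longest_common_prefix u v"
  let ?P = "\<lambda>a. a \<in> nodes t \<and> prefix a u \<and> prefix a v"
  have l: "?P ?l" using assms nodes_prefix longest_common_prefix_prefix1 longest_common_prefix_prefix2
    by metis
  have "a = ?l" if "is_arg_max length ?P a" for a
  proof -
    have a: "?P a" "\<not> length ?l > length a" using that l by (auto simp: is_arg_max_def)
    then have "prefix a ?l" using longest_common_prefix_max_prefix by blast
    then show ?thesis using a(2) by (metis le_neq_implies_less not_equal_is_parallel parallelE prefix_length_le prefix_order.antisym prefix_length_prefix prefix_order.order_refl not_less)
  qed
  moreover have "is_arg_max length ?P ?l"
    using l by (auto simp: is_arg_max_def not_less intro!: prefix_length_le longest_common_prefix_max_prefix)
  ultimately show ?thesis unfolding lca_def arg_max_def by (metis (no_types, lifting) someI)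
qed

text \<open>Both orders are lexicographic with \<open>Left\<close> before \<open>Right\<close>; the
  end of a path comes first in \<open>pre_less\<close>, and between \<open>Left\<close> and
  \<open>Right\<close> in \<open>in_less\<close>. They refer to no tree, so one relation serves for
  a cluster, for the whole tree, and for comparing nodes of a cluster with the root of a
  hole.\<close>

fun pre_less :: "node \<Rightarrow> node \<Rightarrow> bool" where
  "pre_less u [] = False"
| "pre_less [] (b # v) = True"
| "pre_less (a # u) (b # v) = (if a = b then pre_less u v else a = Left)"

fun in_less :: "node \<Rightarrow> node \<Rightarrow> bool" where
  "in_less [] [] = False"
| "in_less [] (b # v) = (b = Right)"
| "in_less (a # u) [] = (a = Left)"
| "in_less (a # u) (b # v) = (if a = b then in_less u v else a = Left)"

lemma pre_less_irrefl [simp]: "\<not> pre_less u u"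
  by (induction u) auto

lemma in_less_irrefl [simp]: "\<not> in_less u u"
  by (induction u) auto

lemma pre_less_asym: "pre_less u v \<Longrightarrow> \<not> pre_less v u"
  by (induction u v rule: pre_less.induct) (auto split: if_splits)

lemma in_less_asym: "in_less u v \<Longrightarrow> \<not> in_less v u"
  by (induction u v rule: in_less.induct) (auto split: if_splits)

lemma in_less_trans: "in_less u v \<Longrightarrow> in_less v w \<Longrightarrow> in_less u w"
proof (induction u v arbitrary: w rule: in_less.induct)
  case (2 b v)
  then show ?case by (cases w) (auto split: if_splits)
next
  case (3 a u)
  then show ?case by (cases w) (auto split: if_splits)
next
  case (4 a u b v)
  then show ?case by (cases w) (auto split: if_splits)
qed simp

lemma in_less_total: "u \<noteq> v \<Longrightarrow> in_less u v \<or> in_less v u"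
  by (induction u v rule: in_less.induct) (auto, (metis dir.exhaust)+)

lemma pre_less_append [simp]: "pre_less (p @ u) (p @ v) \<longleftrightarrow> pre_less u v"
  by (induction p) auto

lemma in_less_append [simp]: "in_less (p @ u) (p @ v) \<longleftrightarrow> in_less u v"
  by (induction p) auto

lemma pre_less_prefix: "strict_prefix u v \<Longrightarrow> pre_less u v"
  by (induction u v rule: pre_less.induct) auto

text \<open>If \<open>e\<close> is not a prefix of \<open>u\<close>, the comparison is decided
  within \<open>e\<close>. So all nodes below a hole lie on the same side of a node that is not
  below it.\<close>

lemma pre_less_extend1: "\<not> prefix e u \<Longrightarrow> pre_less (e @ v) u \<longleftrightarrow> pre_less e u"
  by (induction e u rule: pre_less.induct) auto

lemma pre_less_extend2: "\<not> prefix e u \<Longrightarrow> pre_less u (e @ v) \<longleftrightarrow> pre_less u e"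
  by (induction u e rule: pre_less.induct) (auto simp: neq_Nil_conv)

lemma in_less_extend1: "\<not> prefix e u \<Longrightarrow> in_less (e @ v) u \<longleftrightarrow> in_less e u"
  by (induction e u rule: in_less.induct) auto

lemma in_less_extend2: "\<not> prefix e u \<Longrightarrow> in_less u (e @ v) \<longleftrightarrow> in_less u e"
  by (induction u e rule: in_less.induct) auto

text \<open>A first differing step decides here, and the two orders agree on steps.\<close>

lemma pre_less_iff_in_less: "\<not> prefix u v \<Longrightarrow> \<not> prefix v u \<Longrightarrow> pre_less u v \<longleftrightarrow> in_less u v"
  by (induction u v rule: pre_less.induct) auto

text \<open>The descendants of a node form an interval in preorder: a path outside of this subtree
  compares in the same way with all of them.\<close>

lemma prefix_between:
  assumes "prefix p a" "prefix p c" "a = b \<or> pre_less a b" "b = c \<or> pre_less b c"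
  shows "prefix p b"
proof (rule ccontr)
  assume nb: "\<not> prefix p b"
  obtain a' c' where "a = p @ a'" "c = p @ c'" using assms(1,2) by (auto simp: prefix_def)
  then have "pre_less p b" "pre_less b p" using assms nb pre_less_extend1 pre_less_extend2 by auto
  then show False using pre_less_asym by blast
qed

lemma inorder_map_tree: "inorder (map_tree f t) = map f (inorder t)"
  by (induction t) auto

lemma preorder_map_tree: "preorder (map_tree f t) = map f (preorder t)"
  by (induction t) auto

lemma set_inorder_nodes: "set (inorder (node_tree t)) = nodes t"
  by (simp add: nodes_def)

lemma set_preorder_nodes: "set (preorder (node_tree t)) = nodes t"
  by (simp add: nodes_def)

lemma sorted_preorder: "sorted_wrt pre_less (preorder (node_tree t))"
  by (induction t) (auto simp: preorder_map_tree sorted_wrt_append sorted_wrt_map)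

lemma sorted_inorder: "sorted_wrt in_less (inorder (node_tree t))"
  by (induction t) (auto simp: inorder_map_tree sorted_wrt_append sorted_wrt_map)

text \<open>Ranks become cardinalities, which can be split along the clusters, whereas the traversal
  lists interleave them.\<close>

lemma rank_in_sorted:
  assumes "sorted_wrt R xs" "x \<in> set xs" "\<And>x. \<not> R x x" "\<And>x y. R x y \<Longrightarrow> \<not> R y x"
  shows "rank_in xs x = Suc (card {y \<in> set xs. R y x})"
proof -
  obtain ys zs where xs: "xs = ys @ x # zs" "x \<notin> set ys" using split_list_first[OF assms(2)] by blast
  have "distinct xs" using assms(1,3)
    by (induction xs) auto
  moreover have "{y \<in> set xs. R y x} = set ys"
  proof -
    have "R y x" if "y \<in> set ys" for y using assms(1) that unfolding xs by (simp add: sorted_wrt_append)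
    moreover have "\<not> R y x" if "y \<in> set (x # zs)" for y
      using assms(1,3) assms(4)[of x y] that unfolding xs by (auto simp: sorted_wrt_append)
    ultimately show ?thesis unfolding xs by auto
  qed
  moreover have "takeWhile (\<lambda>y. y \<noteq> x) xs = ys"
    unfolding xs(1) by (rule takeWhile_tail[THEN trans]) (use xs(2) in \<open>auto simp: takeWhile_eq_all_conv\<close>)
  ultimately show ?thesis by (simp add: rank_in_def xs(1) distinct_card)
qed

lemma inorder_rank_card:
  assumes "u \<in> nodes t"
  shows "inorder_rank t u = Suc (card {v \<in> nodes t. in_less v u})"
  unfolding inorder_rank_def set_inorder_nodes[symmetric]
  by (rule rank_in_sorted[OF sorted_inorder])
    (simp_all only: set_inorder_nodes assms in_less_irrefl in_less_asym not_False_eq_True)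

lemma preorder_rank_card:
  assumes "u \<in> nodes t"
  shows "preorder_rank t u = Suc (card {v \<in> nodes t. pre_less v u})"
  unfolding preorder_rank_def set_preorder_nodes[symmetric]
  by (rule rank_in_sorted[OF sorted_preorder])
    (simp_all only: set_preorder_nodes assms pre_less_irrefl pre_less_asym not_False_eq_True)

fun tree_code :: "bintree \<Rightarrow> bool list" where
  "tree_code Leaf = [False]"
| "tree_code (Node l _ r) = True # tree_code l @ tree_code r"

lemma length_tree_code [simp]: "length (tree_code t) = 2 * size t + 1"
  by (induction t) auto

text \<open>Being self-delimiting, codes can be stored without their lengths: a window that starts
  with a code determines the tree. The induction also needs the equality of the remainders.\<close>

lemma tree_code_prefix_free: "tree_code t @ xs = tree_code t' @ ys \<Longrightarrow> t = t'"
proof -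
  have "tree_code t @ xs = tree_code t' @ ys \<Longrightarrow> t = t' \<and> xs = ys"
  proof (induction t arbitrary: t' xs ys)
    case Leaf
    then show ?case by (cases t') auto
  next
    case (Node l a r)
    obtain l' a' r' where t': "t' = Node l' a' r'" using Node.prems by (cases t') auto
    with Node.prems have "tree_code l @ (tree_code r @ xs) = tree_code l' @ (tree_code r' @ ys)" by simp
    then have "l = l' \<and> tree_code r @ xs = tree_code r' @ ys" using Node.IH(1) by blast
    then show ?case using Node.IH(2)[of xs r' ys] t' by simp
  qed
  then show "tree_code t @ xs = tree_code t' @ ys \<Longrightarrow> t = t'" by blast
qed

section \<open>Decomposition into small clusters\<close>

text \<open>
  The nodes in \<open>R\<close> are the roots of the clusters. The holes of a cluster are the roots of the
  clusters hanging below it.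
\<close>

definition cluster :: "node set \<Rightarrow> node set \<Rightarrow> node \<Rightarrow> node set" where
  "cluster V R r = {v \<in> V. prefix r v \<and> (\<forall>p\<in>R. prefix p v \<longrightarrow> prefix p r)}"

definition holes :: "node set \<Rightarrow> node \<Rightarrow> node set" where
  "holes R r = {e \<in> R. strict_prefix r e \<and> (\<forall>p\<in>R. strict_prefix p e \<longrightarrow> prefix p r)}"

text \<open>The state of the greedy procedure at the root of a subtree: the top nodes that belong to
  no closed cluster yet, and the closed clusters hanging immediately below them.\<close>

definition open_part :: "node set \<Rightarrow> node set \<Rightarrow> node set" where
  "open_part V R = {v \<in> V. \<forall>p\<in>R. \<not> prefix p v}"

definition open_holes :: "node set \<Rightarrow> node set" where
  "open_holes R = {e \<in> R. \<forall>p\<in>R. \<not> strict_prefix p e}"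

text \<open>The closing step of the greedy procedure. Existing clusters and their holes are not
  affected, because the new root is a prefix of all their roots.\<close>

lemma insert_root:
  assumes "[] \<notin> R"
  shows "r \<in> R \<Longrightarrow> cluster V (insert [] R) r = cluster V R r"
    "r \<in> R \<Longrightarrow> holes (insert [] R) r = holes R r"
    "cluster V (insert [] R) [] = open_part V R"
    "holes (insert [] R) [] = open_holes R"
    "open_part V (insert [] R) = {}"
    "open_holes (insert [] R) = {[]}"
proof -
  have nil: "x \<in> R \<Longrightarrow> strict_prefix [] x" for x
    using assms by (cases x) auto
  show "r \<in> R \<Longrightarrow> cluster V (insert [] R) r = cluster V R r"
    "r \<in> R \<Longrightarrow> holes (insert [] R) r = holes R r"
    "cluster V (insert [] R) [] = open_part V R"
    "holes (insert [] R) [] = open_holes R"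
    "open_part V (insert [] R) = {}"
    "open_holes (insert [] R) = {[]}"
    using assms nil by (auto simp: cluster_def holes_def open_part_def open_holes_def)
qed

definition join_roots :: "node set \<Rightarrow> node set \<Rightarrow> node set" where
  "join_roots A B = Cons Left ` A \<union> Cons Right ` B"

lemma card_join_roots: "finite A \<Longrightarrow> finite B \<Longrightarrow> card (join_roots A B) = card A + card B"
  unfolding join_roots_def by (subst card_Un_disjoint) (auto simp: card_image)

lemma join_roots_facts:
  fixes l r :: bintree and a :: unit
  defines "V \<equiv> nodes (Node l a r)"
  shows "cluster V (join_roots A B) (Left # p) = Cons Left ` cluster (nodes l) A p"
    "cluster V (join_roots A B) (Right # p) = Cons Right ` cluster (nodes r) B p"
    "holes (join_roots A B) (Left # p) = Cons Left ` holes A p"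
    "holes (join_roots A B) (Right # p) = Cons Right ` holes B p"
    "open_part V (join_roots A B) = insert [] (join_roots (open_part (nodes l) A) (open_part (nodes r) B))"
    "open_holes (join_roots A B) = join_roots (open_holes A) (open_holes B)"
  by (auto simp: V_def nodes_Node cluster_def holes_def open_part_def open_holes_def join_roots_def
      strict_prefix_def ball_Un)

lemma open_holes_nonempty:
  assumes "finite R" "R \<noteq> {}"
  shows "open_holes R \<noteq> {}"
proof -
  obtain e where e: "e \<in> R" "\<forall>p\<in>R. length e \<le> length p"
    using ex_has_least_nat[of "\<lambda>e. e \<in> R" _ length] assms(2) by blast
  then have "\<not> strict_prefix p e" if "p \<in> R" for p
    using that prefix_length_less[of p e] by (meson leD)
  then show ?thesis using e(1) by (auto simp: open_holes_def)
qed

text \<open>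
  Bottom-up, a cluster is closed as soon as it has \<open>K\<close> nodes or two holes. The last inequality
  charges a cluster of the first kind to its nodes, and one of the second kind to the two closed
  parts that it joins.
\<close>

lemma greedy_roots:
  assumes "K \<ge> 1"
  shows "\<exists>R \<subseteq> nodes t. card (open_part (nodes t) R) < K \<and> card (open_holes R) \<le> 1 \<and>
    (\<forall>r\<in>R. card (cluster (nodes t) R r) < 2 * K \<and> card (holes R r) \<le> 2) \<and>
    (R \<noteq> {} \<longrightarrow> K * (card R + 1) + 2 * card (open_part (nodes t) R) \<le> 2 * size t)"
proof (induction t)
  case Leaf
  show ?case using assms by (intro exI[of _ "{}"]) (auto simp: open_part_def open_holes_def)
next
  case (Node l a r)
  from Node.IH obtain A B where
    A: "A \<subseteq> nodes l" "card (open_part (nodes l) A) < K" "card (open_holes A) \<le> 1"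
      "\<forall>p\<in>A. card (cluster (nodes l) A p) < 2 * K \<and> card (holes A p) \<le> 2"
      "A \<noteq> {} \<longrightarrow> K * (card A + 1) + 2 * card (open_part (nodes l) A) \<le> 2 * size l" and
    B: "B \<subseteq> nodes r" "card (open_part (nodes r) B) < K" "card (open_holes B) \<le> 1"
      "\<forall>p\<in>B. card (cluster (nodes r) B p) < 2 * K \<and> card (holes B p) \<le> 2"
      "B \<noteq> {} \<longrightarrow> K * (card B + 1) + 2 * card (open_part (nodes r) B) \<le> 2 * size r"
    by blast
  let ?V = "nodes (Node l a r)"
  let ?a = "card (open_part (nodes l) A)" and ?b = "card (open_part (nodes r) B)"
  define R where "R = join_roots A B"
  have fin: "finite A" "finite B" using A(1) B(1) finite_subset finite_nodes by metis+
  have sub: "R \<subseteq> ?V" using A(1) B(1) by (auto simp: R_def join_roots_def nodes_Node)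
  have nil: "[] \<notin> R" by (auto simp: R_def join_roots_def)
  have cl: "card (cluster ?V R p) < 2 * K \<and> card (holes R p) \<le> 2" if "p \<in> R" for p
    using that A(4) B(4) unfolding R_def
    by (subst (asm) join_roots_def) (auto simp: join_roots_facts card_image)
  have cR: "card R = card A + card B" unfolding R_def using fin by (rule card_join_roots)
  have "finite (open_part (nodes l) A)" "finite (open_part (nodes r) B)" by (auto simp: open_part_def)
  then have cO: "card (open_part ?V R) = Suc (?a + ?b)"
    unfolding R_def join_roots_facts by (subst card_insert_disjoint)
      (auto simp: card_join_roots, auto simp: join_roots_def)
  have "finite (open_holes A)" "finite (open_holes B)" using fin by (auto simp: open_holes_def)
  then have cH: "card (open_holes R) = card (open_holes A) + card (open_holes B)"
    unfolding R_def join_roots_facts by (rule card_join_roots)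
  have hA: "A \<noteq> {} \<Longrightarrow> card (open_holes A) \<ge> 1"
    using open_holes_nonempty[OF fin(1)] \<open>finite (open_holes A)\<close>
    by (simp add: card_gt_0_iff Suc_le_eq)
  have hB: "B \<noteq> {} \<Longrightarrow> card (open_holes B) \<ge> 1"
    using open_holes_nonempty[OF fin(2)] \<open>finite (open_holes B)\<close>
    by (simp add: card_gt_0_iff Suc_le_eq)
  have eA: "A = {} \<Longrightarrow> ?a = size l" "A = {} \<Longrightarrow> card (open_holes A) = 0"
    by (auto simp: open_part_def open_holes_def card_nodes)
  have eB: "B = {} \<Longrightarrow> ?b = size r" "B = {} \<Longrightarrow> card (open_holes B) = 0"
    by (auto simp: open_part_def open_holes_def card_nodes)
  have R_empty: "R = {} \<longleftrightarrow> A = {} \<and> B = {}" by (auto simp: R_def join_roots_def)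
  show ?case
  proof (cases "card (open_part ?V R) < K \<and> card (open_holes R) \<le> 1")
    case True
    have "K * (card R + 1) + 2 * card (open_part ?V R) \<le> 2 * size (Node l a r)" if "R \<noteq> {}"
    proof (cases "A = {}")
      case True
      then show ?thesis using B(5) eA that R_empty unfolding cO cR by auto
    next
      case False
      \<comment> \<open>Each side with roots contributes an open hole, and only one is allowed
        here.\<close>
      then have "B = {}" using True hA hB unfolding cH by linarith
      then show ?thesis using A(5) eB False unfolding cO cR by auto
    qed
    then show ?thesis using True sub cl by (intro exI[of _ R]) blast
  next
    case False
    let ?R = "insert [] R"
    have "finite R" using sub finite_subset finite_nodes by metis
    then have cR': "card ?R = card A + card B + 1" using nil cR by simp
    have "?a \<le> size l" "?b \<le> size r"
      unfolding card_nodes[symmetric] by (auto intro!: card_mono simp: open_part_def)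
    \<comment> \<open>With roots on both sides the two inequalities add up. Otherwise there is at
      most one open hole, so the closing was forced by at least \<open>K\<close> open nodes, and
      twice their number pays for what is missing.\<close>
    then have "K * (card A + card B + 2) \<le> 2 * size (Node l a r)"
      using False A(5) B(5) A(3) B(3) eA eB unfolding cO cH
      by (cases "A = {}"; cases "B = {}") (auto simp: algebra_simps)
    moreover have "card (cluster ?V ?R p) < 2 * K \<and> card (holes ?R p) \<le> 2" if "p \<in> ?R" for p
    proof (cases "p = []")
      case True
      then show ?thesis using insert_root(3,4)[OF nil] A(2,3) B(2,3) cO cH by simp
    next
      case False
      then show ?thesis using insert_root(1,2)[OF nil] that cl by simp
    qed
    moreover have "?R \<subseteq> ?V" using sub by (simp add: nodes_Node)
    ultimately show ?thesis using insert_root(5,6)[OF nil] cR' assms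
      by (intro exI[of _ ?R]) (simp add: algebra_simps)
  qed
qed

definition good_roots :: "nat \<Rightarrow> bintree \<Rightarrow> node set \<Rightarrow> bool" where
  "good_roots K t R \<longleftrightarrow> [] \<in> R \<and> R \<subseteq> nodes t \<and>
     (\<forall>r\<in>R. card (cluster (nodes t) R r) < 2 * K \<and> card (holes R r) \<le> 2) \<and>
     K * card R \<le> 2 * size t + K"

text \<open>The root of the tree has to be a cluster root as well, however small the open part left
  there; the summand \<open>K\<close> in \<open>good_roots\<close> allows for this cluster.\<close>

lemma ex_good_roots:
  assumes "K \<ge> 1" "t \<noteq> Leaf"
  shows "\<exists>R. good_roots K t R"
proof -
  obtain R where R: "R \<subseteq> nodes t" "card (open_part (nodes t) R) < K" "card (open_holes R) \<le> 1"
    "\<forall>r\<in>R. card (cluster (nodes t) R r) < 2 * K \<and> card (holes R r) \<le> 2"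
    "R \<noteq> {} \<longrightarrow> K * (card R + 1) + 2 * card (open_part (nodes t) R) \<le> 2 * size t"
    using greedy_roots[OF assms(1), of t] by blast
  show ?thesis
  proof (cases "[] \<in> R")
    case True
    then show ?thesis using R by (intro exI[of _ R]) (auto simp: good_roots_def)
  next
    case False
    have "finite R" using R(1) finite_subset finite_nodes by metis
    then have "K * card (insert [] R) \<le> 2 * size t + K" using R(5) False by (cases "R = {}") auto
    then show ?thesis using R False assms(2) insert_root[OF False]
      by (intro exI[of _ "insert [] R"]) (auto simp: good_roots_def Nil_in_nodes)
  qed
qed

section \<open>Dense numbering of pairs\<close>

text \<open>
  The pairs \<open>(c, l)\<close> with \<open>c < N\<close> and \<open>l < s c\<close> are numbered such that \<open>c\<close> can be recovered from
  a short table: full chunks of \<open>g\<close> consecutive \<open>l\<close> come first and are aligned to multiples of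
  \<open>g\<close>, and only the remaining pairs, at most \<open>g - 1\<close> for every \<open>c\<close>, are tabulated one by one.
\<close>

definition psum :: "(nat \<Rightarrow> nat) \<Rightarrow> nat \<Rightarrow> nat" where
  "psum f c = (\<Sum>i<c. f i)"

lemma psum_Suc [simp]: "psum f (Suc c) = psum f c + f c"
  by (simp add: psum_def)

lemma psum_0 [simp]: "psum f 0 = 0"
  by (simp add: psum_def)

lemma psum_mono: "c \<le> d \<Longrightarrow> psum f c \<le> psum f d"
  unfolding psum_def by (rule sum_mono2) auto

text \<open>Intervals of lengths \<open>f 0\<close>, \<open>f 1\<close>, and so on are laid out from
  0; this is the index of the one containing \<open>i\<close>.\<close>

definition owner :: "(nat \<Rightarrow> nat) \<Rightarrow> nat \<Rightarrow> nat" where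
  "owner f i = (LEAST c. i < psum f (Suc c))"

lemma owner_eq:
  assumes "psum f c \<le> i" "i < psum f c + f c"
  shows "owner f i = c"
  unfolding owner_def
proof (rule Least_equality)
  fix d assume "i < psum f (Suc d)"
  then show "c \<le> d" using assms psum_mono[of "Suc d" c f] by (meson leI le_less_trans not_less Suc_leI)
qed (use assms in simp)

definition thr :: "nat \<Rightarrow> (nat \<Rightarrow> nat) \<Rightarrow> nat \<Rightarrow> nat" where
  "thr g s c = s c div g * g"

definition full :: "nat \<Rightarrow> (nat \<Rightarrow> nat) \<Rightarrow> nat \<Rightarrow> nat" where
  "full g s N = psum (\<lambda>c. s c div g) N"

definition base_full :: "nat \<Rightarrow> (nat \<Rightarrow> nat) \<Rightarrow> nat \<Rightarrow> nat" where
  "base_full g s c = full g s c * g"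

text \<open>An offset to be added to \<open>l\<close> itself, although only
  \<open>l - thr g s c\<close> counts among the remaining pairs. For \<open>c < N\<close> the
  subtraction is exact, as the chunks of \<open>c\<close> are among the full ones.\<close>

definition base_rest :: "nat \<Rightarrow> (nat \<Rightarrow> nat) \<Rightarrow> nat \<Rightarrow> nat \<Rightarrow> nat" where
  "base_rest g s N c = full g s N * g + psum (\<lambda>c. s c mod g) c - thr g s c"

definition fwd :: "nat \<Rightarrow> (nat \<Rightarrow> nat) \<Rightarrow> nat \<Rightarrow> nat \<Rightarrow> nat \<Rightarrow> nat" where
  "fwd g s N c l = l + (if l < thr g s c then base_full g s c else base_rest g s N c)"

text \<open>The numbers in a full chunk have the same owner and share a slot; each remaining number
  has a slot of its own.\<close>

definition slot :: "nat \<Rightarrow> (nat \<Rightarrow> nat) \<Rightarrow> nat \<Rightarrow> nat \<Rightarrow> nat" where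
  "slot g s N y = (if y < full g s N * g then y div g else full g s N + (y - full g s N * g))"

definition slot_owner :: "nat \<Rightarrow> (nat \<Rightarrow> nat) \<Rightarrow> nat \<Rightarrow> nat \<Rightarrow> nat" where
  "slot_owner g s N i = (if i < full g s N then owner (\<lambda>c. s c div g) i
     else owner (\<lambda>c. s c mod g) (i - full g s N))"

definition slots :: "nat \<Rightarrow> (nat \<Rightarrow> nat) \<Rightarrow> nat \<Rightarrow> nat" where
  "slots g s N = full g s N + psum (\<lambda>c. s c mod g) N"

lemma full_Suc_le: "c < N \<Longrightarrow> full g s c + s c div g \<le> full g s N"
  unfolding full_def using psum_mono[of "Suc c" N] by force

lemma thr_le: "c < N \<Longrightarrow> thr g s c \<le> full g s N * g"
  unfolding thr_def using full_Suc_le[of c N g s] mult_le_mono1[of "s c div g" "full g s N" g] by linarith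

lemma full_rest: "full g s N * g + psum (\<lambda>c. s c mod g) N = psum s N"
  by (induction N) (auto simp: full_def add_mult_distrib algebra_simps)

lemma fwd_full:
  assumes "c < N" "l < thr g s c"
  shows "fwd g s N c l < full g s N * g" "slot g s N (fwd g s N c l) = full g s c + l div g"
    "l div g < s c div g"
proof -
  have g: "g > 0" using assms by (cases g) (auto simp: thr_def)
  have lt: "l div g < s c div g" using assms(2) g by (simp add: thr_def div_less_iff_less_mult)
  have eq: "fwd g s N c l = full g s c * g + l" using assms by (simp add: fwd_def base_full_def)
  have "full g s c * g + l < (full g s c + s c div g) * g"
    using assms(2) by (simp add: thr_def add_mult_distrib)
  also have "\<dots> \<le> full g s N * g" using full_Suc_le[OF assms(1)] mult_le_mono1 by blast
  finally show *: "fwd g s N c l < full g s N * g" using eq by simp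
  then show "slot g s N (fwd g s N c l) = full g s c + l div g" using eq g by (simp add: slot_def)
  show "l div g < s c div g" by (fact lt)
qed

lemma fwd_rest:
  assumes "c < N" "l < s c" "\<not> l < thr g s c"
  shows "fwd g s N c l = full g s N * g + (psum (\<lambda>c. s c mod g) c + (l - thr g s c))"
    "l - thr g s c < s c mod g"
    "psum (\<lambda>c. s c mod g) c + s c mod g \<le> psum (\<lambda>c. s c mod g) N"
proof -
  show "fwd g s N c l = full g s N * g + (psum (\<lambda>c. s c mod g) c + (l - thr g s c))"
    using assms thr_le[OF assms(1), of g s] by (simp add: fwd_def base_rest_def)
  have "s c = thr g s c + s c mod g" by (simp add: thr_def)
  then show "l - thr g s c < s c mod g" using assms by linarith
  show "psum (\<lambda>c. s c mod g) c + s c mod g \<le> psum (\<lambda>c. s c mod g) N"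
    using psum_mono[of "Suc c" N "\<lambda>c. s c mod g"] assms(1) by simp
qed

lemma fwd_less:
  assumes "c < N" "l < s c"
  shows "fwd g s N c l < psum s N"
proof (cases "l < thr g s c")
  case True
  then show ?thesis using fwd_full(1)[OF assms(1) True] full_rest[of g s N] by linarith
next
  case False
  then show ?thesis using fwd_rest[OF assms False] full_rest[of g s N] by linarith
qed

text \<open>This is how a number is decoded: its slot is computed, a table of
  \<open>slot_owner\<close> yields \<open>c\<close>, and the side of the boundary
  \<open>full g s N * g\<close> on which the number lies tells which of two offsets was
  added.\<close>

lemma slot_fwd:
  assumes "c < N" "l < s c"
  shows "slot g s N (fwd g s N c l) < slots g s N"
    "slot_owner g s N (slot g s N (fwd g s N c l)) = c"
    "l = fwd g s N c l - (if fwd g s N c l < full g s N * g then base_full g s c else base_rest g s N c)"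
proof -
  have "slot g s N (fwd g s N c l) < slots g s N \<and> slot_owner g s N (slot g s N (fwd g s N c l)) = c \<and>
    l = fwd g s N c l - (if fwd g s N c l < full g s N * g then base_full g s c else base_rest g s N c)"
  proof (cases "l < thr g s c")
    case True
    note f = fwd_full[OF assms(1) True]
    have "full g s c + l div g < full g s N" using full_Suc_le[OF assms(1), of g s] f(3) by linarith
    moreover have "owner (\<lambda>c. s c div g) (full g s c + l div g) = c"
      by (rule owner_eq) (use f(3) in \<open>auto simp: full_def\<close>)
    ultimately show ?thesis using f True by (simp add: slots_def slot_owner_def fwd_def)
  next
    case False
    note f = fwd_rest[OF assms False]
    have s: "slot g s N (fwd g s N c l) = full g s N + (psum (\<lambda>c. s c mod g) c + (l - thr g s c))"
      by (simp add: slot_def f(1))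
    moreover have "owner (\<lambda>c. s c mod g) (psum (\<lambda>c. s c mod g) c + (l - thr g s c)) = c"
      by (rule owner_eq) (use f(2) in auto)
    moreover have "\<not> fwd g s N c l < full g s N * g" by (simp add: f(1))
    moreover have "l = fwd g s N c l - base_rest g s N c" using False by (simp add: fwd_def)
    ultimately show ?thesis using f(2,3) by (simp add: slots_def slot_owner_def)
  qed
  then show "slot g s N (fwd g s N c l) < slots g s N"
    "slot_owner g s N (slot g s N (fwd g s N c l)) = c"
    "l = fwd g s N c l - (if fwd g s N c l < full g s N * g then base_full g s c else base_rest g s N c)"
    by blast+
qed

text \<open>The table costs one entry per \<open>g\<close> pairs and up to \<open>g\<close> entries
  per cluster, so \<open>g\<close> should lie well between 1 and the size of a cluster:
  \<open>r ^ 3\<close> will go with \<open>r ^ 7\<close>, and \<open>r ^ 16\<close> with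
  \<open>r ^ 32\<close>.\<close>

lemma slots_le:
  assumes "g \<ge> 1"
  shows "g * slots g s N \<le> psum s N + N * g * g" 
proof -
  have "psum (\<lambda>c. s c mod g) N \<le> N * g"
    using sum_bounded_above[of "{..<N}" "\<lambda>c. s c mod g" g] assms
    by (auto simp: psum_def less_imp_le)
  then have "g * psum (\<lambda>c. s c mod g) N \<le> N * g * g" by (metis mult.commute mult_le_mono2)
  then show ?thesis using full_rest[of g s N]
    unfolding slots_def add_mult_distrib2 by (metis add_le_mono le_add1 mult.commute)
qed

section \<open>Tree operations by clusters\<close>

text \<open>
  The clusters of a tree are numbered from 0 to \<open>ncl - 1\<close> in the preorder of their roots \<open>rt\<close>.
  Cluster \<open>c\<close> is the set \<open>cl c\<close> of nodes of the whole tree, also seen as the tree \<open>ctree c\<close>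
  in itself, and \<open>hl c\<close> lists the numbers of the clusters at its holes. A node \<open>v\<close> is the
  node \<open>loc v\<close> of cluster \<open>cid v\<close>.
\<close>

definition roots :: "nat \<Rightarrow> bintree \<Rightarrow> node set" where
  "roots K t = (SOME R. good_roots K t R)"

definition rlist :: "nat \<Rightarrow> bintree \<Rightarrow> node list" where
  "rlist K t = filter (\<lambda>v. v \<in> roots K t) (preorder (node_tree t))"

definition ncl :: "nat \<Rightarrow> bintree \<Rightarrow> nat" where
  "ncl K t = length (rlist K t)"

definition rt :: "nat \<Rightarrow> bintree \<Rightarrow> nat \<Rightarrow> node" where
  "rt K t c = rlist K t ! c"

definition cl :: "nat \<Rightarrow> bintree \<Rightarrow> nat \<Rightarrow> node set" where
  "cl K t c = cluster (nodes t) (roots K t) (rt K t c)"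

definition cid :: "nat \<Rightarrow> bintree \<Rightarrow> node \<Rightarrow> nat" where
  "cid K t v = (THE c. c < ncl K t \<and> v \<in> cl K t c)"

definition loc :: "nat \<Rightarrow> bintree \<Rightarrow> node \<Rightarrow> node" where
  "loc K t v = drop (length (rt K t (cid K t v))) v"

definition ctree :: "nat \<Rightarrow> bintree \<Rightarrow> nat \<Rightarrow> bintree" where
  "ctree K t c = (SOME t'. nodes t' = {u. rt K t c @ u \<in> cl K t c})"

definition hl :: "nat \<Rightarrow> bintree \<Rightarrow> nat \<Rightarrow> nat list" where
  "hl K t c = filter (\<lambda>e. rt K t e \<in> holes (roots K t) (rt K t c)) [0..<ncl K t]"

lemma lcp_commute: "longest_common_prefix u v = longest_common_prefix v (u :: node)"
  by (rule prefix_order.antisym; rule longest_common_prefix_max_prefix;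
      rule longest_common_prefix_prefix1 longest_common_prefix_prefix2)

locale decomp =
  fixes K :: nat and t :: bintree
  assumes K: "K \<ge> 1" and t: "t \<noteq> Leaf"
begin

abbreviation "V \<equiv> nodes t"
abbreviation "R \<equiv> roots K t"
abbreviation "N \<equiv> ncl K t"
abbreviation "crt \<equiv> rt K t"

lemma good: "good_roots K t R"
  unfolding roots_def using ex_good_roots[OF K t] by (rule someI_ex)

lemma R_sub: "R \<subseteq> V" and nil_R: "[] \<in> R"
  using good by (auto simp: good_roots_def)

lemma finite_R: "finite R"
  using R_sub finite_subset finite_nodes by blast

lemma set_rlist: "set (rlist K t) = R"
  using R_sub by (auto simp: rlist_def nodes_def)

lemma sorted_rlist: "sorted_wrt pre_less (rlist K t)"
  unfolding rlist_def using sorted_preorder by (rule sorted_wrt_filter)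

lemma root_less: "c < d \<Longrightarrow> d < N \<Longrightarrow> pre_less (crt c) (crt d)"
  using sorted_rlist by (simp add: rt_def ncl_def sorted_wrt_iff_nth_less)

lemma root_inj: "c < N \<Longrightarrow> d < N \<Longrightarrow> crt c = crt d \<Longrightarrow> c = d"
  using root_less by (metis linorder_neqE_nat pre_less_irrefl)

lemma root_less_iff: "c < N \<Longrightarrow> d < N \<Longrightarrow> pre_less (crt c) (crt d) \<longleftrightarrow> c < d"
  using root_less by (metis linorder_neqE_nat pre_less_irrefl pre_less_asym)

lemma root_R: "c < N \<Longrightarrow> crt c \<in> R"
  using set_rlist nth_mem unfolding rt_def ncl_def by metis

lemma R_root: "r \<in> R \<Longrightarrow> \<exists>c<N. crt c = r"
  using set_rlist by (metis in_set_conv_nth rt_def ncl_def)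

lemma N_card: "N = card R"
proof -
  have "distinct (rlist K t)"
    using root_inj by (auto simp: distinct_conv_nth rt_def ncl_def)
  then show ?thesis using set_rlist distinct_card unfolding ncl_def by metis
qed

lemma N_le: "K * N \<le> 2 * size t + K" "N \<le> size t" "N > 0"
proof -
  show "K * N \<le> 2 * size t + K" using good N_card by (simp add: good_roots_def)
  show "N \<le> size t" unfolding N_card card_nodes[symmetric] using R_sub by (rule card_mono[rotated]) simp
  show "N > 0" unfolding N_card using finite_R nil_R by (auto simp: card_gt_0_iff)
qed

lemma cl_nodes: "v \<in> cl K t c \<Longrightarrow> v \<in> V" and cl_prefix: "v \<in> cl K t c \<Longrightarrow> prefix (crt c) v"
  by (auto simp: cl_def cluster_def)

lemma root_cl: "c < N \<Longrightarrow> crt c \<in> cl K t c"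
  using root_R R_sub by (auto simp: cl_def cluster_def)

lemma cl_unique: "v \<in> cl K t c \<Longrightarrow> v \<in> cl K t d \<Longrightarrow> c < N \<Longrightarrow> d < N \<Longrightarrow> c = d"
  using root_R by (intro root_inj) (auto simp: cl_def cluster_def intro: prefix_order.antisym)

lemma ex_cl:
  assumes "v \<in> V"
  shows "\<exists>c<N. v \<in> cl K t c"
proof -
  obtain r where r: "r \<in> R" "prefix r v" "\<And>p. p \<in> R \<Longrightarrow> prefix p v \<Longrightarrow> length p \<le> length r"
    using ex_has_greatest_nat[of "\<lambda>p. p \<in> R \<and> prefix p v" "[]" length "Suc (length v)"] nil_R
    by (auto dest: prefix_length_le simp: less_Suc_eq_le)
  then have "v \<in> cluster V R r"
    using assms by (auto simp: cluster_def intro: prefix_length_prefix)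
  then show ?thesis using R_root[OF r(1)] by (auto simp: cl_def)
qed

lemma cid_cl: "v \<in> V \<Longrightarrow> cid K t v < N \<and> v \<in> cl K t (cid K t v)"
  unfolding cid_def using theI'[of "\<lambda>c. c < N \<and> v \<in> cl K t c"] ex_cl cl_unique by blast

lemma cid_less: "v \<in> V \<Longrightarrow> cid K t v < N"
  using cid_cl by blast

lemma cid_eq: "v \<in> cl K t c \<Longrightarrow> c < N \<Longrightarrow> cid K t v = c"
  using cid_cl cl_nodes cl_unique by blast

lemma cl_closed: "v \<in> cl K t c \<Longrightarrow> prefix (crt c) u \<Longrightarrow> prefix u v \<Longrightarrow> u \<in> cl K t c"
  using nodes_prefix by (auto simp: cl_def cluster_def)

lemma nodes_ctree: "nodes (ctree K t c) = {u. crt c @ u \<in> cl K t c}"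
proof -
  have "finite {u. crt c @ u \<in> cl K t c}"
  proof (rule finite_subset)
    show "{u. crt c @ u \<in> cl K t c} \<subseteq> drop (length (crt c)) ` V"
      using cl_nodes by (force simp: image_iff)
  qed simp
  then have "\<exists>t'. nodes t' = {u. crt c @ u \<in> cl K t c}"
    by (rule ex_tree_nodes) (auto intro: cl_closed)
  then show ?thesis unfolding ctree_def by (rule someI_ex)
qed

lemma loc_append: "v \<in> V \<Longrightarrow> crt (cid K t v) @ loc K t v = v"
  using cid_cl[of v] cl_prefix by (metis append_eq_conv_conj loc_def prefix_def)

lemma loc_nodes: "v \<in> V \<Longrightarrow> loc K t v \<in> nodes (ctree K t (cid K t v))"
  using cid_cl[of v] loc_append[of v] by (simp add: nodes_ctree)

lemma glob:
  assumes "c < N" "u \<in> nodes (ctree K t c)"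
  shows "crt c @ u \<in> cl K t c" "crt c @ u \<in> V" "cid K t (crt c @ u) = c" "loc K t (crt c @ u) = u"
proof -
  show 1: "crt c @ u \<in> cl K t c" using assms by (simp add: nodes_ctree)
  then show "crt c @ u \<in> V" by (rule cl_nodes)
  show "cid K t (crt c @ u) = c" using 1 assms(1) by (rule cid_eq)
  then show "loc K t (crt c @ u) = u" by (simp add: loc_def)
qed

lemma card_cl_eq: "card {v \<in> cl K t c. P v} = card {u \<in> nodes (ctree K t c). P (crt c @ u)}"
proof -
  have "{v \<in> cl K t c. P v} = (@) (crt c) ` {u \<in> nodes (ctree K t c). P (crt c @ u)}"
    using cl_prefix by (force simp: nodes_ctree prefix_def image_iff)
  moreover have "inj_on ((@) (crt c)) {u \<in> nodes (ctree K t c). P (crt c @ u)}"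
    by (simp add: inj_on_def)
  ultimately show ?thesis by (simp add: card_image)
qed

lemma size_ctree: "size (ctree K t c) = card (cl K t c)"
  using card_cl_eq[of c "\<lambda>_. True"] by (simp add: card_nodes)

lemma size_ctree_less: "c < N \<Longrightarrow> size (ctree K t c) < 2 * K"
  using good root_R by (simp add: size_ctree cl_def good_roots_def)

lemma ctree_not_Leaf: "c < N \<Longrightarrow> ctree K t c \<noteq> Leaf"
  using root_cl[of c] by (simp add: Nil_in_nodes[symmetric] nodes_ctree)

lemma sum_size_ctree: "(\<Sum>c<N. size (ctree K t c)) = size t"
proof -
  have "V = (\<Union>c<N. cl K t c)" using ex_cl cl_nodes by blast
  then have "size t = card (\<Union>c<N. cl K t c)" by (simp add: card_nodes[symmetric])
  also have "\<dots> = (\<Sum>c<N. card (cl K t c))"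
    using cl_unique by (intro card_UN_disjoint) (auto simp: cl_def cluster_def)
  finally show ?thesis by (simp add: size_ctree)
qed

lemma set_hl: "e \<in> set (hl K t c) \<longleftrightarrow> e < N \<and> crt e \<in> holes R (crt c)"
  by (auto simp: hl_def)

lemma length_hl: "c < N \<Longrightarrow> length (hl K t c) \<le> 2"
proof -
  assume c: "c < N"
  have "length (hl K t c) = card (set (hl K t c))" 
    by (rule distinct_card[symmetric]) (simp add: hl_def)
  also have "\<dots> = card (crt ` set (hl K t c))"
    using root_inj by (intro card_image[symmetric]) (auto simp: inj_on_def set_hl)
  also have "\<dots> \<le> card (holes R (crt c))"
    using finite_R by (intro card_mono) (auto simp: set_hl holes_def)
  also have "\<dots> \<le> 2" using good root_R[OF c] by (simp add: good_roots_def)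
  finally show ?thesis .
qed

lemma sorted_hl: "sorted_wrt (<) (hl K t c)"
  unfolding hl_def by (intro sorted_wrt_filter) simp

lemma hl_cases:
  assumes "c < N"
  obtains "hl K t c = []" | e where "hl K t c = [e]" | e e' where "hl K t c = [e, e']" "e < e'"
proof -
  have "length (hl K t c) = 0 \<or> length (hl K t c) = 1 \<or> length (hl K t c) = 2"
    using length_hl[OF assms] by linarith
  then consider "hl K t c = []" | e where "hl K t c = [e]" | e e' where "hl K t c = [e, e']"
    by (auto simp: length_Suc_conv numeral_2_eq_2)
  then show ?thesis using that sorted_hl[of c] by cases auto
qed

text \<open>No root lies strictly between the root of the cluster and that of the hole, so the
  parent of the latter still belongs to the cluster. It stands for the hole in queries about
  children, descendants and common ancestors.\<close>

lemma hole:
  assumes "c < N" "e \<in> set (hl K t c)"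
  shows "crt e \<noteq> []" "butlast (crt e) \<in> cl K t c" "strict_prefix (crt c) (crt e)"
proof -
  have e: "crt e \<in> R" "strict_prefix (crt c) (crt e)"
    "\<And>p. p \<in> R \<Longrightarrow> strict_prefix p (crt e) \<Longrightarrow> prefix p (crt c)"
    using assms(2) by (auto simp: set_hl holes_def)
  show "strict_prefix (crt c) (crt e)" by (fact e(2))
  show ne: "crt e \<noteq> []" using e(2) by auto
  then obtain q d where q: "crt e = q @ [d]" by (metis append_butlast_last_id)
  have "prefix (crt c) q" using e(2) q by (auto simp: strict_prefix_def prefix_snoc)
  moreover have "q \<in> V" using e(1) R_sub q nodes_prefix[of "crt e" t q] by auto
  moreover have "prefix p (crt c)" if "p \<in> R" "prefix p q" for p
    using e(3)[OF that(1)] that(2) q prefix_length_le[OF that(2)]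
    by (cases "p = q @ [d]") (auto simp: strict_prefix_def)
  ultimately show "butlast (crt e) \<in> cl K t c" using q by (auto simp: cl_def cluster_def)
qed

lemma child_hole:
  assumes "c < N" "q \<in> cl K t c" "q @ [d] \<in> V" "q @ [d] \<notin> cl K t c"
  shows "\<exists>e \<in> set (hl K t c). crt e = q @ [d]"
proof -
  let ?v = "q @ [d]"
  have pq: "prefix (crt c) q" and cq: "\<And>p. p \<in> R \<Longrightarrow> prefix p q \<Longrightarrow> prefix p (crt c)"
    using assms(2) by (auto simp: cl_def cluster_def)
  obtain p where "p \<in> R" "prefix p ?v" "\<not> prefix p (crt c)"
    using assms(3,4) pq by (auto simp: cl_def cluster_def)
  then have "?v \<in> R" using cq by (auto simp: prefix_snoc)
  moreover have "strict_prefix (crt c) ?v" using pq by (auto simp: strict_prefix_def prefix_def)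
  moreover have "prefix p (crt c)" if "p \<in> R" "strict_prefix p ?v" for p
    using that cq by (auto simp: strict_prefix_def prefix_snoc)
  ultimately have "?v \<in> holes R (crt c)" by (auto simp: holes_def)
  then show ?thesis using R_root[OF \<open>?v \<in> R\<close>] by (auto simp: set_hl)
qed

text \<open>The hole is the shortest root that is a prefix of \<open>v\<close> but not of the root
  of \<open>c\<close>.\<close>

lemma below_hole:
  assumes "c < N" "v \<in> V" "prefix (crt c) v" "v \<notin> cl K t c"
  shows "\<exists>e \<in> set (hl K t c). prefix (crt e) v"
proof -
  have "\<exists>p. p \<in> R \<and> prefix p v \<and> \<not> prefix p (crt c)"
    using assms by (auto simp: cl_def cluster_def)
  then obtain p where p: "p \<in> R" "prefix p v" "\<not> prefix p (crt c)"
    "\<And>q. q \<in> R \<Longrightarrow> prefix q v \<Longrightarrow> \<not> prefix q (crt c) \<Longrightarrow> length p \<le> length q"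
    using ex_has_least_nat[of "\<lambda>p. p \<in> R \<and> prefix p v \<and> \<not> prefix p (crt c)" _ length] by metis
  have "strict_prefix (crt c) p"
    using p(2,3) assms(3) by (metis prefix_same_cases strict_prefix_def)
  moreover have "prefix q (crt c)" if "q \<in> R" "strict_prefix q p" for q
    using p(4)[OF that(1)] that(2) p(2) prefix_length_less[OF that(2)]
    by (metis leD prefix_order.trans strict_prefix_def)
  ultimately have "p \<in> holes R (crt c)" using p(1) by (auto simp: holes_def)
  then show ?thesis using R_root[OF p(1)] p(2) by (auto simp: set_hl)
qed

lemma hole_not_cl: "e \<in> set (hl K t c) \<Longrightarrow> prefix (crt e) v \<Longrightarrow> v \<notin> cl K t c"
  by (auto simp: set_hl holes_def cl_def cluster_def)

lemma holes_disjoint: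
  assumes "e \<in> set (hl K t c)" "e' \<in> set (hl K t c)" "prefix (crt e) v" "prefix (crt e') v"
  shows "e = e'"
proof (rule ccontr)
  assume ne: "e \<noteq> e'"
  have h: "e < N" "e' < N" "crt e \<in> holes R (crt c)" "crt e' \<in> holes R (crt c)"
    using assms(1,2) by (auto simp: set_hl)
  then have "crt e \<noteq> crt e'" using ne root_inj by blast
  then have "strict_prefix (crt e) (crt e') \<or> strict_prefix (crt e') (crt e)"
    using prefix_same_cases[OF assms(3,4)] by (auto simp: strict_prefix_def)
  then show False using h unfolding holes_def
    by (auto dest: prefix_order.le_less_trans prefix_order.less_le_trans)
qed

section \<open>Ranks and subtree sizes from the data of a cluster\<close>

lemma card_below:
  assumes "c < N"
  shows "card {v \<in> V. prefix (crt c) v \<and> P v} =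
    card {v \<in> cl K t c. P v} + (\<Sum>e\<leftarrow>hl K t c. card {v \<in> V. prefix (crt e) v \<and> P v})"
proof -
  let ?A = "{v \<in> cl K t c. P v}" and ?B = "\<lambda>e. {v \<in> V. prefix (crt e) v \<and> P v}"
  have eq: "{v \<in> V. prefix (crt c) v \<and> P v} = ?A \<union> (\<Union>e\<in>set (hl K t c). ?B e)"
  proof (intro set_eqI iffI)
    fix v assume "v \<in> {v \<in> V. prefix (crt c) v \<and> P v}"
    then show "v \<in> ?A \<union> (\<Union>e\<in>set (hl K t c). ?B e)" using below_hole[OF assms, of v] by blast
  next
    fix v assume "v \<in> ?A \<union> (\<Union>e\<in>set (hl K t c). ?B e)"
    moreover have "prefix (crt c) v" if "e \<in> set (hl K t c)" "prefix (crt e) v" for e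
      using hole(3)[OF assms that(1)] that(2) by (metis prefix_order.trans strict_prefix_def)
    ultimately show "v \<in> {v \<in> V. prefix (crt c) v \<and> P v}" using cl_nodes cl_prefix by blast
  qed
  have fin: "finite ?A" by (rule finite_subset[of _ V]) (auto dest: cl_nodes)
  have "card (?A \<union> (\<Union>e\<in>set (hl K t c). ?B e)) = card ?A + card (\<Union>e\<in>set (hl K t c). ?B e)"
    using fin hole_not_cl by (intro card_Un_disjoint) auto
  also have "card (\<Union>e\<in>set (hl K t c). ?B e) = (\<Sum>e\<in>set (hl K t c). card (?B e))"
    using holes_disjoint by (intro card_UN_disjoint) auto
  also have "\<dots> = (\<Sum>e\<leftarrow>hl K t c. card (?B e))"
    by (rule sum_list_distinct_conv_sum_set[symmetric]) (simp add: hl_def)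
  finally show ?thesis using eq by simp
qed

text \<open>The common scheme of subtree sizes and both ranks: with respect to a node of the cluster
  all nodes below one hole behave alike, so they count all or not at all.\<close>

lemma card_below_const:
  assumes "c < N" "\<And>e v. e \<in> set (hl K t c) \<Longrightarrow> v \<in> V \<Longrightarrow> prefix (crt e) v \<Longrightarrow> P v \<longleftrightarrow> P (crt e)"
  shows "card {v \<in> V. P v} = card {v \<in> V. \<not> prefix (crt c) v \<and> P v} + card {v \<in> cl K t c. P v} +
    (\<Sum>e\<leftarrow>hl K t c. if P (crt e) then subtree_size t (crt e) else 0)"
proof -
  let ?A = "{v \<in> V. \<not> prefix (crt c) v \<and> P v}" and ?B = "{v \<in> V. prefix (crt c) v \<and> P v}"
  have "{v \<in> V. P v} = ?A \<union> ?B" by blast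
  moreover have "card (?A \<union> ?B) = card ?A + card ?B" by (rule card_Un_disjoint) auto
  ultimately have "card {v \<in> V. P v} = card ?A + card ?B" by simp
  moreover have "card {v \<in> V. prefix (crt e) v \<and> P v} =
    (if P (crt e) then subtree_size t (crt e) else 0)" if e: "e \<in> set (hl K t c)" for e
  proof -
    have "crt e \<in> V" using e root_R R_sub by (auto simp: set_hl)
    note size = subtree_size_card[OF this]
    show ?thesis
    proof (cases "P (crt e)")
      case True
      then have "{v \<in> V. prefix (crt e) v \<and> P v} = {v \<in> V. prefix (crt e) v}"
        using assms(2)[OF e] by blast
      with True show ?thesis using size by simp
    next
      case False
      then have none: "{v \<in> V. prefix (crt e) v \<and> P v} = {}" using assms(2)[OF e] by blast
      show ?thesis unfolding none using False by simp
    qed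
  qed
  then have "(\<Sum>e\<leftarrow>hl K t c. card {v \<in> V. prefix (crt e) v \<and> P v}) =
    (\<Sum>e\<leftarrow>hl K t c. if P (crt e) then subtree_size t (crt e) else 0)"
    by (intro arg_cong[where f = sum_list] map_cong refl)
  ultimately show ?thesis unfolding card_below[OF assms(1), of P] by (simp only: add.assoc)
qed

text \<open>Counted relative to the root of the cluster, because a node outside of its subtree
  compares in the same way with every node of the cluster. So one number per cluster is
  enough.\<close>

definition inbase :: "nat \<Rightarrow> nat" where
  "inbase c = card {v \<in> V. \<not> prefix (crt c) v \<and> in_less v (crt c)}"

definition prebase :: "nat \<Rightarrow> nat" where
  "prebase c = card {v \<in> V. \<not> prefix (crt c) v \<and> pre_less v (crt c)}"

definition hole_parent :: "nat \<Rightarrow> node" where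
  "hole_parent e = butlast (crt e)"

text \<open>In \<open>ctree K t c\<close> a hole is a null child and has no rank; what is stored
  instead is the position of this gap in the inorder sequence of the cluster.\<close>

definition null_rank :: "nat \<Rightarrow> nat \<Rightarrow> nat" where
  "null_rank c e = card {v \<in> cl K t c. in_less v (crt e)}"

text \<open>In a linear order, elements compare like their numbers of predecessors. The hole itself
  is not in the cluster and ranks count from 1, hence the strict inequality.\<close>

lemma in_less_hole:
  assumes "c < N" "e \<in> set (hl K t c)" "u \<in> nodes (ctree K t c)"
  shows "in_less (crt e) (crt c @ u) \<longleftrightarrow> null_rank c e < inorder_rank (ctree K t c) u"
proof -
  let ?u = "crt c @ u"
  have fin: "finite {v \<in> cl K t c. P v}" for P by (rule finite_subset[of _ V]) (auto dest: cl_nodes)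
  have rank: "inorder_rank (ctree K t c) u = Suc (card {v \<in> cl K t c. in_less v ?u})"
    using assms(3) by (simp add: inorder_rank_card card_cl_eq)
  have u: "?u \<in> cl K t c" using glob(1)[OF assms(1,3)] .
  show ?thesis
  proof
    assume less: "in_less (crt e) ?u"
    have "null_rank c e \<le> card {v \<in> cl K t c. in_less v ?u}"
      unfolding null_rank_def using less in_less_trans by (intro card_mono fin) blast
    then show "null_rank c e < inorder_rank (ctree K t c) u" using rank by simp
  next
    assume less: "null_rank c e < inorder_rank (ctree K t c) u"
    show "in_less (crt e) ?u"
    proof (rule ccontr)
      assume "\<not> in_less (crt e) ?u"
      moreover have "crt e \<noteq> ?u" using hole_not_cl[OF assms(2), of ?u] u by auto
      ultimately have less': "in_less ?u (crt e)" using in_less_total by blast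
      have "insert ?u {v \<in> cl K t c. in_less v ?u} \<subseteq> {v \<in> cl K t c. in_less v (crt e)}"
        using less' u in_less_trans by blast
      then have "card (insert ?u {v \<in> cl K t c. in_less v ?u}) \<le> null_rank c e"
        unfolding null_rank_def by (intro card_mono fin)
      moreover have "card (insert ?u {v \<in> cl K t c. in_less v ?u}) = inorder_rank (ctree K t c) u"
        unfolding rank using fin by (subst card_insert_disjoint) auto
      ultimately show False using less by simp
    qed
  qed
qed

lemma inorder_rank_cluster:
  assumes "c < N" "u \<in> nodes (ctree K t c)"
  shows "inorder_rank t (crt c @ u) = inbase c + inorder_rank (ctree K t c) u +
    (\<Sum>e\<leftarrow>hl K t c. if in_less (crt e) (crt c @ u) then subtree_size t (crt e) else 0)"
proof -
  let ?u = "crt c @ u"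
  have u: "?u \<in> cl K t c" "?u \<in> V" using glob(1,2)[OF assms] .
  have "in_less v ?u \<longleftrightarrow> in_less (crt e) ?u" if "e \<in> set (hl K t c)" "prefix (crt e) v" for e v
    using in_less_extend1[of "crt e" ?u] hole_not_cl[OF that(1), of ?u] u that(2)
    by (auto simp: prefix_def)
  then have "card {v \<in> V. in_less v ?u} =
    card {v \<in> V. \<not> prefix (crt c) v \<and> in_less v ?u} + card {v \<in> cl K t c. in_less v ?u} +
    (\<Sum>e\<leftarrow>hl K t c. if in_less (crt e) ?u then subtree_size t (crt e) else 0)"
    by (rule card_below_const[OF assms(1)])
  moreover have "{v \<in> V. \<not> prefix (crt c) v \<and> in_less v ?u} = {v \<in> V. \<not> prefix (crt c) v \<and> in_less v (crt c)}"
    using in_less_extend2 by blast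
  moreover have "inorder_rank t ?u = Suc (card {v \<in> V. in_less v ?u})"
    using u(2) by (rule inorder_rank_card)
  moreover have "inorder_rank (ctree K t c) u = Suc (card {v \<in> cl K t c. in_less v ?u})"
    unfolding inorder_rank_card[OF assms(2)] card_cl_eq in_less_append ..
  ultimately show ?thesis by (simp only: inbase_def)
qed

text \<open>A hole precedes \<open>u\<close> in preorder iff it does so in inorder and does not lie
  below \<open>u\<close>. Both tests are available anyway, so preorder costs only the additional
  number \<open>prebase c\<close>.\<close>

lemma preorder_rank_cluster:
  assumes "c < N" "u \<in> nodes (ctree K t c)"
  shows "preorder_rank t (crt c @ u) = prebase c + preorder_rank (ctree K t c) u +
    (\<Sum>e\<leftarrow>hl K t c. if in_less (crt e) (crt c @ u) \<and> \<not> prefix (crt c @ u) (crt e)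
       then subtree_size t (crt e) else 0)"
proof -
  let ?u = "crt c @ u"
  have u: "?u \<in> cl K t c" "?u \<in> V" using glob(1,2)[OF assms] .
  have np: "\<not> prefix (crt e) ?u" if "e \<in> set (hl K t c)" for e
    using hole_not_cl[OF that, of ?u] u by auto
  have "pre_less v ?u \<longleftrightarrow> pre_less (crt e) ?u" if "e \<in> set (hl K t c)" "prefix (crt e) v" for e v
    using pre_less_extend1[of "crt e" ?u] np that by (auto simp: prefix_def)
  then have "card {v \<in> V. pre_less v ?u} =
    card {v \<in> V. \<not> prefix (crt c) v \<and> pre_less v ?u} + card {v \<in> cl K t c. pre_less v ?u} +
    (\<Sum>e\<leftarrow>hl K t c. if pre_less (crt e) ?u then subtree_size t (crt e) else 0)"
    by (rule card_below_const[OF assms(1)])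
  moreover have "{v \<in> V. \<not> prefix (crt c) v \<and> pre_less v ?u} = {v \<in> V. \<not> prefix (crt c) v \<and> pre_less v (crt c)}"
    using pre_less_extend2 by blast
  moreover have "preorder_rank t ?u = Suc (card {v \<in> V. pre_less v ?u})"
    using u(2) by (rule preorder_rank_card)
  moreover have "preorder_rank (ctree K t c) u = Suc (card {v \<in> cl K t c. pre_less v ?u})"
    unfolding preorder_rank_card[OF assms(2)] card_cl_eq pre_less_append ..
  ultimately have "preorder_rank t ?u = prebase c + preorder_rank (ctree K t c) u +
    (\<Sum>e\<leftarrow>hl K t c. if pre_less (crt e) ?u then subtree_size t (crt e) else 0)"
    by (simp only: prebase_def)
  moreover have "pre_less (crt e) ?u \<longleftrightarrow> in_less (crt e) ?u \<and> \<not> prefix ?u (crt e)"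
    if "e \<in> set (hl K t c)" for e
  proof (cases "prefix ?u (crt e)")
    case True
    then have "strict_prefix ?u (crt e)" using np[OF that] by (auto simp: strict_prefix_def)
    then show ?thesis using True pre_less_prefix pre_less_asym by blast
  next
    case False
    then show ?thesis using pre_less_iff_in_less[of "crt e" ?u] np[OF that] by blast
  qed
  ultimately show ?thesis by (simp cong: map_cong)
qed

lemma subtree_size_cluster:
  assumes "c < N" "u \<in> nodes (ctree K t c)"
  shows "subtree_size t (crt c @ u) = subtree_size (ctree K t c) u +
    (\<Sum>e\<leftarrow>hl K t c. if prefix (crt c @ u) (crt e) then subtree_size t (crt e) else 0)"
proof -
  let ?u = "crt c @ u"
  have u: "?u \<in> cl K t c" "?u \<in> V" using glob(1,2)[OF assms] .
  have "prefix ?u v \<longleftrightarrow> prefix ?u (crt e)" if "e \<in> set (hl K t c)" "prefix (crt e) v" for e v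
  proof
    assume "prefix ?u v"
    then have "prefix ?u (crt e) \<or> prefix (crt e) ?u"
      using that(2) prefix_same_cases by blast
    then show "prefix ?u (crt e)" using hole_not_cl[OF that(1), of ?u] u by auto
  qed (use that(2) prefix_order.trans in blast)
  then have "card {v \<in> V. prefix ?u v} =
    card {v \<in> V. \<not> prefix (crt c) v \<and> prefix ?u v} + card {v \<in> cl K t c. prefix ?u v} +
    (\<Sum>e\<leftarrow>hl K t c. if prefix ?u (crt e) then subtree_size t (crt e) else 0)"
    by (rule card_below_const[OF assms(1)])
  moreover have none: "{v \<in> V. \<not> prefix (crt c) v \<and> prefix ?u v} = {}"
    using append_prefixD by blast
  moreover have "subtree_size (ctree K t c) u = card {v \<in> cl K t c. prefix ?u v}"
    unfolding subtree_size_card[OF assms(2)] card_cl_eq same_prefix_prefix ..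
  ultimately show ?thesis unfolding subtree_size_card[OF u(2)] by (simp only: none) simp
qed

lemma hole_parent:
  assumes "c < N" "e \<in> set (hl K t c)"
  shows "hole_parent e \<in> V" "cid K t (hole_parent e) = c"
    "crt c @ loc K t (hole_parent e) = hole_parent e" "loc K t (hole_parent e) \<in> nodes (ctree K t c)"
proof -
  have h: "hole_parent e \<in> cl K t c" using hole(2)[OF assms] by (simp add: hole_parent_def)
  then show V: "hole_parent e \<in> V" by (rule cl_nodes)
  show c: "cid K t (hole_parent e) = c" using h assms(1) by (rule cid_eq)
  show "crt c @ loc K t (hole_parent e) = hole_parent e" using loc_append[OF V] c by simp
  show "loc K t (hole_parent e) \<in> nodes (ctree K t c)" using loc_nodes[OF V] c by simp
qed

text \<open>Turns the test whether a hole lies below \<open>u\<close> into an operation on the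
  cluster: the root of the hole, which is not in the cluster, is replaced by its parent, and
  ancestry is expressed by \<open>lca\<close>.\<close>

lemma prefix_hole:
  assumes "c < N" "e \<in> set (hl K t c)" "u \<in> nodes (ctree K t c)"
  shows "prefix (crt c @ u) (crt e) \<longleftrightarrow> lca (ctree K t c) u (loc K t (hole_parent e)) = u"
proof -
  let ?q = "loc K t (hole_parent e)"
  note q = hole_parent[OF assms(1,2)]
  obtain d where d: "crt e = hole_parent e @ [d]"
    using hole(1)[OF assms(1,2)] unfolding hole_parent_def by (metis append_butlast_last_id)
  have "crt c @ u \<noteq> crt e" using glob(1)[OF assms(1,3)] hole_not_cl[OF assms(2), of "crt e"] by auto
  then have "prefix (crt c @ u) (crt e) \<longleftrightarrow> prefix (crt c @ u) (hole_parent e)"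
    unfolding d by auto
  also have "\<dots> \<longleftrightarrow> prefix u ?q" using q(3) by (metis same_prefix_prefix)
  also have "\<dots> \<longleftrightarrow> longest_common_prefix u ?q = u"
    by (metis longest_common_prefix_max_prefix longest_common_prefix_prefix1
        longest_common_prefix_prefix2 prefix_order.antisym prefix_order.order_refl)
  finally show ?thesis using lca_eq[OF assms(3) q(4)] by simp
qed

section \<open>Lowest common ancestors of nodes in different clusters\<close>

text \<open>Ancestors come first in the preorder of the roots. Therefore the minimum of cluster
  numbers selects the higher of two clusters on a path, which makes it the operation of the sparse
  table.\<close>

lemma cid_mono:
  assumes "v \<in> V" "prefix u v"
  shows "cid K t u \<le> cid K t v"
proof -
  have u: "u \<in> V" using assms nodes_prefix by blast
  have "prefix (crt (cid K t u)) v" using cid_cl[OF u] cl_prefix assms(2) prefix_order.trans by blast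
  moreover have "crt (cid K t u) \<in> R" using root_R cid_less u by blast
  ultimately have "prefix (crt (cid K t u)) (crt (cid K t v))"
    using cid_cl[OF assms(1)] by (auto simp: cl_def cluster_def)
  then have "crt (cid K t u) = crt (cid K t v) \<or> pre_less (crt (cid K t u)) (crt (cid K t v))"
    using pre_less_prefix by (auto simp: strict_prefix_def)
  then show ?thesis using root_less_iff root_inj cid_less u assms(1)
    by (metis less_imp_le order_refl)
qed

definition lcid :: "nat \<Rightarrow> nat \<Rightarrow> nat" where
  "lcid c d = cid K t (longest_common_prefix (crt c) (crt d))"

lemma lcp_root_V: "c < N \<Longrightarrow> longest_common_prefix (crt c) u \<in> V"
  using root_R R_sub nodes_prefix longest_common_prefix_prefix1 by blast

text \<open>
  Two overlapping intervals suffice: if the longest common prefix of the end points were shorter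
  than those of both intervals, a common element would extend it in the same way at both ends.
\<close>

lemma lcid_interval:
  assumes "a \<le> b'" "b' \<le> b" "b \<le> d" "d < N"
  shows "lcid a d = min (lcid a b) (lcid b' d)"
proof -
  let ?x = "longest_common_prefix (crt a) (crt d)"
  let ?y = "longest_common_prefix (crt a) (crt b)"
  let ?z = "longest_common_prefix (crt b') (crt d)"
  have le: "i \<le> j \<Longrightarrow> j < N \<Longrightarrow> crt i = crt j \<or> pre_less (crt i) (crt j)" for i j
    using root_less by (metis le_neq_implies_less)
  have between: "prefix p (crt j)" if "prefix p (crt i)" "prefix p (crt k)" "i \<le> j" "j \<le> k" "k < N" for p i j k
    using prefix_between[OF that(1,2)] le that(3-5) by (meson le_less_trans)
  have x: "prefix ?x (crt a)" "prefix ?x (crt d)"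
    by (rule longest_common_prefix_prefix1 longest_common_prefix_prefix2)+
  have xb: "prefix ?x (crt b)" "prefix ?x (crt b')"
    using between[OF x] assms by auto
  have xy: "prefix ?x ?y" "prefix ?x ?z" using x xb longest_common_prefix_max_prefix by blast+
  have "?x = ?y \<or> ?x = ?z"
  proof (rule ccontr)
    assume "\<not> ?thesis"
    then obtain i j ys zs where y: "?y = ?x @ i # ys" and z: "?z = ?x @ j # zs"
      using xy unfolding prefix_def by (metis append_Nil2 neq_Nil_conv)
    have "prefix (?x @ [i]) (crt a)" "prefix (?x @ [i]) (crt b)"
      using y longest_common_prefix_prefix1[of "crt a" "crt b"]
        longest_common_prefix_prefix2[of "crt a" "crt b"]
      by (metis append.assoc append_Cons append_Nil append_prefixD)+
    then have i: "prefix (?x @ [i]) (crt a)" "prefix (?x @ [i]) (crt b')"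
      using between[of _ a b b'] assms by auto
    have j: "prefix (?x @ [j]) (crt b')" "prefix (?x @ [j]) (crt d)"
      using z longest_common_prefix_prefix1[of "crt b'" "crt d"]
        longest_common_prefix_prefix2[of "crt b'" "crt d"]
      by (metis append.assoc append_Cons append_Nil append_prefixD)+
    have "i = j" using prefix_same_cases[OF i(2) j(1)] by auto
    then have "prefix (?x @ [i]) ?x" using i(1) j(2) longest_common_prefix_max_prefix by blast
    then show False by (simp add: prefix_def)
  qed
  moreover have "lcid a d \<le> lcid a b" "lcid a d \<le> lcid b' d"
    unfolding lcid_def using cid_mono xy lcp_root_V assms by auto
  ultimately show ?thesis unfolding lcid_def by (auto simp: min_def)
qed

text \<open>Clusters are numbered in preorder, so those below the first hole precede the second
  hole, and one comparison finds the hole above cluster \<open>c\<close>.\<close>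

definition toward :: "nat \<Rightarrow> nat \<Rightarrow> nat" where
  "toward C c = (if length (hl K t C) = 2 \<and> hl K t C ! 1 \<le> c then hl K t C ! 1 else hl K t C ! 0)"

lemma toward:
  assumes "C < N" "c < N" "strict_prefix (crt C) (crt c)"
  shows "toward C c \<in> set (hl K t C)" "prefix (crt (toward C c)) (crt c)"
proof -
  have "crt c \<notin> cl K t C"
    using cl_unique[OF root_cl[OF assms(2)] _ assms(2,1)] assms(3) by auto
  then obtain e where e: "e \<in> set (hl K t C)" "prefix (crt e) (crt c)"
    using below_hole[OF assms(1), of "crt c"] assms root_R R_sub
    by (auto simp: strict_prefix_def)
  have "toward C c = e"
  proof (cases rule: hl_cases[OF assms(1)])
    case 1
    then show ?thesis using e by simp
  next
    case (2 e1)
    then show ?thesis using e by (simp add: toward_def)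
  next
    case (3 e1 e2)
    then have e12: "e1 \<in> set (hl K t C)" "e2 \<in> set (hl K t C)" by auto
    then have less: "e1 < N" "e2 < N" by (auto simp: set_hl)
    have np: "\<not> prefix (crt e1) (crt e2)" 
      using holes_disjoint[OF e12, of "crt e2"] 3(2) by auto
    have "e2 \<le> c" if "e = e2"
      using e(2) that root_less_iff[OF less(2) assms(2)] root_inj[OF less(2) assms(2)] pre_less_prefix
      by (metis less_imp_le order_refl strict_prefix_def)
    moreover have "c < e2" if "e = e1"
    proof -
      have "pre_less (crt e1) (crt e2)" using root_less 3(2) less by blast
      then have "pre_less (crt c) (crt e2)"
        using e(2) that pre_less_extend1[OF np] by (auto simp: prefix_def)
      then show ?thesis using root_less_iff[OF assms(2) less(2)] by simp
    qed
    ultimately show ?thesis using e 3 by (auto simp: toward_def)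
  qed
  then show "toward C c \<in> set (hl K t C)" "prefix (crt (toward C c)) (crt c)" using e by auto
qed

text \<open>
  If cluster \<open>C\<close> contains the lowest common ancestor of nodes from different clusters, then the
  nodes may be replaced by their lowest ancestors in \<open>C\<close>.
\<close>

definition project :: "nat \<Rightarrow> node \<Rightarrow> node" where
  "project C u = (if cid K t u = C then u else hole_parent (toward C (cid K t u)))"

text \<open>The paths \<open>u\<close> and \<open>v\<close> part no later than at \<open>q\<close>,
  so what \<open>v\<close> does beyond \<open>q\<close> has no influence.\<close>

lemma lcp_extend:
  assumes "\<not> prefix (q @ [d]) u" "prefix (q @ [d]) v"
  shows "longest_common_prefix u v = longest_common_prefix u q"
proof (rule prefix_order.antisym)
  let ?l = "longest_common_prefix u v"
  have l: "prefix ?l u" "prefix ?l v" by (rule longest_common_prefix_prefix1 longest_common_prefix_prefix2)+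
  then have "prefix ?l (q @ [d])" using assms by (meson prefix_order.trans prefix_same_cases)
  then have "prefix ?l q" using l assms(1) by auto
  then show "prefix ?l (longest_common_prefix u q)" using l longest_common_prefix_max_prefix by blast
  show "prefix (longest_common_prefix u q) ?l"
    using assms(2) longest_common_prefix_max_prefix longest_common_prefix_prefix1
      longest_common_prefix_prefix2 by (metis append_prefixD prefix_order.trans)
qed

lemma project:
  assumes "u \<in> V" "c = cid K t u" "C < N" "prefix (crt C) (crt c)"
  shows "project C u \<in> V" "cid K t (project C u) = C"
proof -
  have "cid K t u \<noteq> C \<Longrightarrow> strict_prefix (crt C) (crt c)"
    using assms root_inj cid_less[OF assms(1)] by (auto simp: strict_prefix_def)
  then show "project C u \<in> V" "cid K t (project C u) = C"
    using assms cid_less[OF assms(1)] toward[of C c] hole_parent[OF assms(3)]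
    by (auto simp: project_def)
qed

text \<open>The cluster is found from the two cluster roots alone: their common prefix may be
  shorter than that of \<open>u\<close> and \<open>v\<close>, but it lies in the same
  cluster.\<close>

lemma lca_cluster:
  assumes "u \<in> V" "v \<in> V" and neq: "cid K t u \<noteq> cid K t v" and C: "C = lcid (cid K t u) (cid K t v)"
  shows "lca t u v = longest_common_prefix (project C u) (project C v)"
    "C < N" "prefix (crt C) (crt (cid K t u))" "prefix (crt C) (crt (cid K t v))"
proof -
  let ?c = "cid K t u" and ?d = "cid K t v"
  have cd: "?c < N" "?d < N" using assms cid_less by auto
  define x where "x = longest_common_prefix (crt ?c) (crt ?d)"
  have x: "prefix x (crt ?c)" "prefix x (crt ?d)"
    unfolding x_def by (rule longest_common_prefix_prefix1 longest_common_prefix_prefix2)+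
  have xV: "x \<in> V" unfolding x_def using cd lcp_root_V by blast
  have Cx: "C = cid K t x" unfolding C lcid_def x_def ..
  show CN: "C < N" using Cx cid_less xV by simp
  have xC: "x \<in> cl K t C" "prefix (crt C) x" using Cx cid_cl[OF xV] cl_prefix by auto
  show pc: "prefix (crt C) (crt ?c)" using xC x prefix_order.trans by blast
  show pd: "prefix (crt C) (crt ?d)" using xC x prefix_order.trans by blast
  have tw: "\<exists>q i. toward C c = e \<longrightarrow> e \<in> set (hl K t C) \<and> prefix (crt e) (crt c) \<and>
      crt e = q @ [i] \<and> hole_parent e = q" if "C \<noteq> c" "c < N" "prefix (crt C) (crt c)" for c e
  proof -
    have "strict_prefix (crt C) (crt c)"
      using that root_inj CN by (auto simp: strict_prefix_def)
    note tc = toward[OF CN that(2) this]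
    show ?thesis using tc hole(1)[OF CN tc(1)] by (metis append_butlast_last_id hole_parent_def)
  qed
  have pu: "prefix (crt ?c) u" "prefix (crt ?d) v" using cid_cl assms(1,2) cl_prefix by auto
  have "longest_common_prefix u v = longest_common_prefix (project C u) (project C v)"
  proof (cases "C = ?c")
    case True
    then have Cd: "C \<noteq> ?d" using neq by simp
    obtain q i where e: "toward C ?d \<in> set (hl K t C)" "prefix (crt (toward C ?d)) (crt ?d)"
      "crt (toward C ?d) = q @ [i]" "hole_parent (toward C ?d) = q"
      using tw[OF Cd cd(2) pd] by blast
    have "u \<in> cl K t C" using cid_cl[OF assms(1)] True by simp
    then have "\<not> prefix (q @ [i]) u" using hole_not_cl[OF e(1)] e(3) by metis
    moreover have "prefix (q @ [i]) v" using e(2,3) pu(2) by (metis prefix_order.trans)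
    ultimately show ?thesis using lcp_extend[of q i u v] True Cd e(4) by (simp add: project_def)
  next
    case Cc: False
    obtain q i where e: "toward C ?c \<in> set (hl K t C)" "prefix (crt (toward C ?c)) (crt ?c)"
      "crt (toward C ?c) = q @ [i]" "hole_parent (toward C ?c) = q"
      using tw[OF Cc cd(1) pc] by blast
    have qu: "prefix (q @ [i]) u" using e(2,3) pu(1) by (metis prefix_order.trans)
    show ?thesis
    proof (cases "C = ?d")
      case True
      then have "v \<in> cl K t C" using cid_cl[OF assms(2)] by simp
      then have "\<not> prefix (q @ [i]) v" using hole_not_cl[OF e(1)] e(3) by metis
      then have "longest_common_prefix v u = longest_common_prefix v q"
        using qu by (rule lcp_extend)
      then show ?thesis using True Cc e(4) by (simp add: project_def lcp_commute[of v])
    next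
      case Cd: False
      obtain q' i' where e': "toward C ?d \<in> set (hl K t C)" "prefix (crt (toward C ?d)) (crt ?d)"
        "crt (toward C ?d) = q' @ [i']" "hole_parent (toward C ?d) = q'"
        using tw[OF Cd cd(2) pd] by blast
      have qv: "prefix (q' @ [i']) v" using e'(2,3) pu(2) by (metis prefix_order.trans)
      \<comment> \<open>Otherwise the common prefix \<open>x\<close> of the roots would lie below
        that hole, hence outside of \<open>C\<close>.\<close>
      have ne: "toward C ?c \<noteq> toward C ?d"
      proof
        assume eq: "toward C ?c = toward C ?d"
        then have "prefix (crt (toward C ?c)) x"
          using e(2) e'(2) longest_common_prefix_max_prefix unfolding x_def by metis
        then show False using hole_not_cl[OF e(1)] xC(1) by blast
      qed
      have dis: "\<not> (prefix (crt (toward C ?c)) z \<and> prefix (crt (toward C ?d)) z)" for z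
        using holes_disjoint[OF e(1) e'(1)] ne by blast
      have "\<not> prefix (q' @ [i']) u" using dis[of u] e(3) e'(3) qu by metis
      then have 1: "longest_common_prefix u v = longest_common_prefix u q'" using qv by (rule lcp_extend)
      have "\<not> prefix (q @ [i]) q'"
        using dis[of "crt (toward C ?d)"] unfolding e(3) e'(3) by (auto simp: prefix_snoc)
      then have "longest_common_prefix q' u = longest_common_prefix q' q" using qu by (rule lcp_extend)
      then show ?thesis using 1 Cc Cd e(4) e'(4) by (simp add: project_def lcp_commute[of q'])
    qed
  qed
  then show "lca t u v = longest_common_prefix (project C u) (project C v)"
    using lca_eq assms(1,2) by simp
qed

lemma lca_same_cluster:
  assumes "u \<in> V" "v \<in> V" "cid K t u = c" "cid K t v = c"
  shows "longest_common_prefix u v = crt c @ lca (ctree K t c) (loc K t u) (loc K t v)"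
    "lca (ctree K t c) (loc K t u) (loc K t v) \<in> nodes (ctree K t c)"
proof -
  let ?u = "loc K t u" and ?v = "loc K t v"
  have n: "?u \<in> nodes (ctree K t c)" "?v \<in> nodes (ctree K t c)" using loc_nodes assms by metis+
  have "longest_common_prefix (p @ x) (p @ y) = p @ longest_common_prefix x y" for p x y :: node
    by (induction p) auto
  then show "longest_common_prefix u v = crt c @ lca (ctree K t c) ?u ?v"
    using lca_eq[OF n] loc_append assms by metis
  show "lca (ctree K t c) ?u ?v \<in> nodes (ctree K t c)"
    using lca_eq[OF n] n nodes_prefix longest_common_prefix_prefix1 by metis
qed

end

section \<open>The data of one level\<close>

lemma length_concat_map:
  "(\<And>c. c < N \<Longrightarrow> length (f c) = F) \<Longrightarrow> length (concat (map f [0..<N])) = N * F"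
  by (induction N) auto

lemma nth_concat_map:
  assumes "\<And>c. c < N \<Longrightarrow> length (f c) = F" "i < N" "j < F"
  shows "concat (map f [0..<N]) ! (i * F + j) = f i ! j"
  using assms
proof (induction N)
  case (Suc N)
  have len: "length (concat (map f [0..<N])) = N * F" using Suc.prems by (intro length_concat_map) auto
  show ?case
  proof (cases "i = N")
    case True
    then show ?thesis using len by (simp add: nth_append)
  next
    case False
    then have i: "i < N" using Suc.prems(2) by simp
    have "i * F + j < Suc i * F" using Suc.prems(3) by simp
    also have "\<dots> \<le> N * F" using i by (intro mult_le_mono1) simp
    finally have "i * F + j < N * F" .
    then show ?thesis using len i Suc by (simp add: nth_append)
  qed
qed simp

definition csize :: "nat \<Rightarrow> bintree \<Rightarrow> nat \<Rightarrow> nat" where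
  "csize K t c = size (ctree K t c)"

text \<open>Handles and local numbers count from 1, pairs from 0. Any numbering \<open>\<nu>\<close>
  of the cluster trees may be plugged in, so the construction can be nested.\<close>

definition cnum :: "nat \<Rightarrow> nat \<Rightarrow> (bintree \<Rightarrow> node \<Rightarrow> nat) \<Rightarrow> bintree \<Rightarrow> node \<Rightarrow> nat" where
  "cnum K g \<nu> t v = Suc (fwd g (csize K t) (ncl K t) (cid K t v)
     (\<nu> (ctree K t (cid K t v)) (loc K t v) - 1))"

definition numbering :: "(bintree \<Rightarrow> node \<Rightarrow> nat) \<Rightarrow> bool" where
  "numbering \<nu> \<longleftrightarrow> (\<forall>t. bij_betw (\<nu> t) (nodes t) {1..size t})"

lemma numbering_range: "numbering \<nu> \<Longrightarrow> u \<in> nodes t \<Longrightarrow> 1 \<le> \<nu> t u \<and> \<nu> t u \<le> size t"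
  unfolding numbering_def bij_betw_def by (metis atLeastAtMost_iff imageI)

lemma numbering_eq: "numbering \<nu> \<Longrightarrow> u \<in> nodes t \<Longrightarrow> v \<in> nodes t \<Longrightarrow> \<nu> t u = \<nu> t v \<longleftrightarrow> u = v"
  unfolding numbering_def bij_betw_def inj_on_def by blast

lemma ex_numbering: "\<exists>\<nu>. numbering \<nu>"
proof -
  have "\<exists>h. bij_betw h (nodes t) {1..size t}" for t
    using finite_same_card_bij[of "nodes t" "{1..size t}"] by (simp add: card_nodes)
  then show ?thesis unfolding numbering_def by metis
qed

text \<open>
  A missing hole is recognized by its size 0, and its cluster number exceeds all others. After the
  data of the cluster and of its two holes follows its part of a sparse table that yields, for any
  two clusters, the cluster of the lowest common ancestor of their roots.
\<close>

definition hole_fields :: "nat \<Rightarrow> nat \<Rightarrow> (bintree \<Rightarrow> node \<Rightarrow> nat) \<Rightarrow> bintree \<Rightarrow> nat \<Rightarrow> nat \<Rightarrow> nat list" where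
  "hole_fields K g \<nu> t c j = (if j < length (hl K t c) then
     (let e = hl K t c ! j in
       [\<nu> (ctree K t c) (loc K t (decomp.hole_parent K t e)), if last (rt K t e) = Left then 0 else 1,
        e, cnum K g \<nu> t (rt K t e), subtree_size t (rt K t e), decomp.null_rank K t c e])
     else [\<nu> (ctree K t c) [], 0, ncl K t, 0, 0, 0])"

text \<open>\<open>lc c\<close> locates the data of cluster \<open>c\<close> itself: a bit offset on
  the lower level, an address on the upper one. Sparse table entries that would pass the last
  cluster are capped only to keep the row length fixed; they are never read.\<close>

definition fields :: "nat \<Rightarrow> nat \<Rightarrow> nat \<Rightarrow> (bintree \<Rightarrow> node \<Rightarrow> nat) \<Rightarrow> (nat \<Rightarrow> nat) \<Rightarrow> bintree \<Rightarrow> nat \<Rightarrow> nat list" where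
  "fields K g L \<nu> lc t c =
     [handle (cnum K g \<nu> t) (parent t (rt K t c)), decomp.inbase K t c, decomp.prebase K t c,
      thr g (csize K t) c, base_full g (csize K t) c, base_rest g (csize K t) (ncl K t) c, lc c] @
     hole_fields K g \<nu> t c 0 @ hole_fields K g \<nu> t c 1 @
     map (\<lambda>k. decomp.lcid K t c (min (c + 2 ^ k) (ncl K t - 1))) [0..<L]"

text \<open>The two leading numbers, the position of the slot table and the boundary between full
  chunks and the rest, are what the decoding of a handle starts from. Rows of equal length need no
  directory.\<close>

definition level_nums :: "nat \<Rightarrow> nat \<Rightarrow> nat \<Rightarrow> (bintree \<Rightarrow> node \<Rightarrow> nat) \<Rightarrow> (nat \<Rightarrow> nat) \<Rightarrow> bintree \<Rightarrow> nat list" where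
  "level_nums K g L \<nu> lc t =
     [2 + ncl K t * (19 + L), full g (csize K t) (ncl K t) * g] @
     concat (map (fields K g L \<nu> lc t) [0..<ncl K t]) @
     map (slot_owner g (csize K t) (ncl K t)) [0..<slots g (csize K t) (ncl K t)]"

lemma length_hole_fields [simp]: "length (hole_fields K g \<nu> t c j) = 6"
  by (simp add: hole_fields_def Let_def)

lemma length_fields [simp]: "length (fields K g L \<nu> lc t c) = 19 + L"
  by (simp add: fields_def)

lemma length_level_nums:
  "length (level_nums K g L \<nu> lc t) = 2 + ncl K t * (19 + L) + slots g (csize K t) (ncl K t)"
  by (simp add: level_nums_def length_concat_map)

lemma level_nums_field:
  assumes "c < ncl K t" "j < 19 + L"
  shows "2 + (c * (19 + L) + j) < length (level_nums K g L \<nu> lc t)"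
    "level_nums K g L \<nu> lc t ! (2 + (c * (19 + L) + j)) = fields K g L \<nu> lc t c ! j"
proof -
  have "c * (19 + L) + j < Suc c * (19 + L)" using assms(2) by simp
  also have "\<dots> \<le> ncl K t * (19 + L)" using assms(1) by (intro mult_le_mono1) simp
  finally have *: "c * (19 + L) + j < ncl K t * (19 + L)" .
  then show "2 + (c * (19 + L) + j) < length (level_nums K g L \<nu> lc t)"
    by (simp add: length_level_nums)
  have "length (concat (map (fields K g L \<nu> lc t) [0..<ncl K t])) = ncl K t * (19 + L)"
    by (rule length_concat_map) simp
  then have "level_nums K g L \<nu> lc t ! (2 + (c * (19 + L) + j)) =
      concat (map (fields K g L \<nu> lc t) [0..<ncl K t]) ! (c * (19 + L) + j)"
    using * by (simp add: level_nums_def nth_append)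
  then show "level_nums K g L \<nu> lc t ! (2 + (c * (19 + L) + j)) = fields K g L \<nu> lc t c ! j"
    using nth_concat_map[of "ncl K t" "fields K g L \<nu> lc t" "19 + L" c j] assms by simp
qed

lemma level_nums_slot:
  assumes "i < slots g (csize K t) (ncl K t)"
  shows "2 + ncl K t * (19 + L) + i < length (level_nums K g L \<nu> lc t)"
    "level_nums K g L \<nu> lc t ! (2 + ncl K t * (19 + L) + i) = slot_owner g (csize K t) (ncl K t) i"
proof -
  show "2 + ncl K t * (19 + L) + i < length (level_nums K g L \<nu> lc t)"
    using assms by (simp add: length_level_nums)
  have "length (concat (map (fields K g L \<nu> lc t) [0..<ncl K t])) = ncl K t * (19 + L)"
    by (rule length_concat_map) simp
  then show "level_nums K g L \<nu> lc t ! (2 + ncl K t * (19 + L) + i) = slot_owner g (csize K t) (ncl K t) i"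
    using assms by (simp add: level_nums_def nth_append)
qed

lemma level_nums_head:
  "level_nums K g L \<nu> lc t ! 0 = 2 + ncl K t * (19 + L)"
  "level_nums K g L \<nu> lc t ! 1 = full g (csize K t) (ncl K t) * g"
  "level_nums K g L \<nu> lc t ! Suc 0 = full g (csize K t) (ncl K t) * g"
  "2 \<le> length (level_nums K g L \<nu> lc t)"
  by (simp_all add: level_nums_def length_level_nums)

context decomp begin

lemma psum_csize: "psum (csize K t) N = size t"
  using sum_size_ctree by (simp add: psum_def csize_def)

context
  fixes \<nu> :: "bintree \<Rightarrow> node \<Rightarrow> nat"
  assumes \<nu>: "numbering \<nu>"
begin

lemma local_num:
  assumes "v \<in> V"
  shows "\<nu> (ctree K t (cid K t v)) (loc K t v) \<ge> 1"
    "\<nu> (ctree K t (cid K t v)) (loc K t v) - 1 < csize K t (cid K t v)"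
  using numbering_range[OF \<nu> loc_nodes[OF assms]] by (auto simp: csize_def)

lemma cnum_range: "v \<in> V \<Longrightarrow> cnum K g \<nu> t v \<in> {1..size t}"
  unfolding cnum_def
  using fwd_less[of "cid K t v" N _ "csize K t" g] cid_less[of v] local_num(2)[of v] psum_csize
  by (auto simp: Suc_le_eq)

text \<open>Decoding by \<open>slot_fwd\<close> recovers first the cluster, then the local
  number.\<close>

lemma inj_cnum: "inj_on (cnum K g \<nu> t) V"
proof (rule inj_onI)
  fix u v assume uv: "u \<in> V" "v \<in> V" "cnum K g \<nu> t u = cnum K g \<nu> t v"
  let ?l = "\<lambda>v. \<nu> (ctree K t (cid K t v)) (loc K t v)"
  have eq: "fwd g (csize K t) N (cid K t u) (?l u - 1) = fwd g (csize K t) N (cid K t v) (?l v - 1)"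
    using uv(3) by (simp add: cnum_def)
  have c: "cid K t u = cid K t v"
    using slot_fwd(2)[where s = "csize K t" and g = g, OF cid_less[OF uv(1)] local_num(2)[OF uv(1)]]
      slot_fwd(2)[where s = "csize K t" and g = g, OF cid_less[OF uv(2)] local_num(2)[OF uv(2)]] eq by metis
  have "?l u - 1 = ?l v - 1"
    using slot_fwd(3)[where s = "csize K t" and g = g, OF cid_less[OF uv(1)] local_num(2)[OF uv(1)]]
      slot_fwd(3)[where s = "csize K t" and g = g, OF cid_less[OF uv(2)] local_num(2)[OF uv(2)]] eq c by metis
  then have "?l u = ?l v" using local_num(1)[OF uv(1)] local_num(1)[OF uv(2)] by linarith
  then have "loc K t u = loc K t v"
    using c numbering_eq[OF \<nu>] loc_nodes[OF uv(1)] loc_nodes[OF uv(2)] by metis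
  then show "u = v" using c loc_append[OF uv(1)] loc_append[OF uv(2)] by metis
qed

end

end

lemma numbering_cnum:
  assumes "K \<ge> 1" "numbering \<nu>"
  shows "numbering (cnum K g \<nu>)"
  unfolding numbering_def
proof
  fix t
  show "bij_betw (cnum K g \<nu> t) (nodes t) {1..size t}"
  proof (cases "t = Leaf")
    case False
    interpret decomp K t by standard (use assms False in auto)
    have "cnum K g \<nu> t ` nodes t = {1..size t}"
      using cnum_range[OF assms(2)] inj_cnum[OF assms(2)]
      by (intro card_subset_eq) (auto simp: card_image card_nodes)
    then show ?thesis using inj_cnum[OF assms(2)] by (simp add: bij_betw_def)
  qed (simp add: bij_betw_def)
qed

definition child :: "dir \<Rightarrow> bintree \<Rightarrow> node \<Rightarrow> node option" where
  "child d t u = (if u @ [d] \<in> nodes t then Some (u @ [d]) else None)"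

lemma child_left: "left_child = child Left" and child_right: "right_child = child Right"
  by (intro ext, simp add: child_def left_child_def right_child_def)+

context machine begin

text \<open>
  Here the tree \<open>\<tau> x\<close> may be a part of the tree that \<open>x\<close> represents, as selected by other
  computable quantities.
\<close>

definition node_fn :: "'x set \<Rightarrow> ('x \<Rightarrow> bintree) \<Rightarrow> ('x \<Rightarrow> node \<Rightarrow> nat) \<Rightarrow> ('x \<Rightarrow> node) \<Rightarrow> bool" where
  "node_fn D \<tau> \<nu> u \<longleftrightarrow> (\<forall>x\<in>D. u x \<in> nodes (\<tau> x)) \<and> ram D (\<lambda>x. \<nu> x (u x))"

text \<open>Nodes are arbitrary computable functions on arbitrary subdomains rather than arguments
  in registers, so an operation can be applied to results of others and inside branches.\<close>

definition ops :: "'x set \<Rightarrow> ('x \<Rightarrow> bintree) \<Rightarrow> ('x \<Rightarrow> node \<Rightarrow> nat) \<Rightarrow> bool" where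
  "ops E \<tau> \<nu> \<longleftrightarrow> (\<forall>D u. D \<subseteq> E \<longrightarrow> node_fn D \<tau> \<nu> u \<longrightarrow>
     (\<forall>d. ram D (\<lambda>x. handle (\<nu> x) (child d (\<tau> x) (u x)))) \<and>
     ram D (\<lambda>x. handle (\<nu> x) (parent (\<tau> x) (u x))) \<and>
     ram D (\<lambda>x. subtree_size (\<tau> x) (u x)) \<and>
     ram D (\<lambda>x. inorder_rank (\<tau> x) (u x)) \<and>
     ram D (\<lambda>x. preorder_rank (\<tau> x) (u x)) \<and>
     (\<forall>v. node_fn D \<tau> \<nu> v \<longrightarrow> ram D (\<lambda>x. \<nu> x (lca (\<tau> x) (u x) (v x)))))"

lemma opsD:
  assumes "ops E \<tau> \<nu>" "D \<subseteq> E" "node_fn D \<tau> \<nu> u"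
  shows "ram D (\<lambda>x. handle (\<nu> x) (child d (\<tau> x) (u x)))"
    "ram D (\<lambda>x. handle (\<nu> x) (parent (\<tau> x) (u x)))"
    "ram D (\<lambda>x. subtree_size (\<tau> x) (u x))"
    "ram D (\<lambda>x. inorder_rank (\<tau> x) (u x))"
    "ram D (\<lambda>x. preorder_rank (\<tau> x) (u x))"
    "node_fn D \<tau> \<nu> v \<Longrightarrow> ram D (\<lambda>x. \<nu> x (lca (\<tau> x) (u x) (v x)))"
  using assms unfolding ops_def by blast+

lemma node_fn_mono: "node_fn D \<tau> \<nu> u \<Longrightarrow> D' \<subseteq> D \<Longrightarrow> node_fn D' \<tau> \<nu> u"
  unfolding node_fn_def using ram_mono by blast

lemma ops_cong:
  assumes "ops E \<tau> \<nu>" "\<And>x. x \<in> E \<Longrightarrow> \<nu> x = \<nu>' x"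
  shows "ops E \<tau> \<nu>'"
proof -
  have iff: "ram D (\<lambda>x. f (\<nu> x) x) \<longleftrightarrow> ram D (\<lambda>x. f (\<nu>' x) x)" if "D \<subseteq> E" for D f
    using ram_cong[of D "\<lambda>x. f (\<nu> x) x" "\<lambda>x. f (\<nu>' x) x"]
      ram_cong[of D "\<lambda>x. f (\<nu>' x) x" "\<lambda>x. f (\<nu> x) x"] assms(2) that by (metis subsetD)
  have fn: "node_fn D \<tau> \<nu> u \<longleftrightarrow> node_fn D \<tau> \<nu>' u" if "D \<subseteq> E" for D u
    using iff[OF that, of "\<lambda>n x. n (u x)"] by (simp add: node_fn_def)
  show ?thesis
    unfolding ops_def
  proof (intro allI impI conjI)
    fix D u d assume D: "D \<subseteq> E" and u: "node_fn D \<tau> \<nu>' u"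
    note ops = opsD[OF assms(1) D u[folded fn[OF D]]]
    show "ram D (\<lambda>x. handle (\<nu>' x) (child d (\<tau> x) (u x)))"
      using ops(1) iff[OF D, of "\<lambda>n x. handle n (child d (\<tau> x) (u x))"] by blast
    show "ram D (\<lambda>x. handle (\<nu>' x) (parent (\<tau> x) (u x)))"
      using ops(2) iff[OF D, of "\<lambda>n x. handle n (parent (\<tau> x) (u x))"] by blast
    show "ram D (\<lambda>x. subtree_size (\<tau> x) (u x))" "ram D (\<lambda>x. inorder_rank (\<tau> x) (u x))"
      "ram D (\<lambda>x. preorder_rank (\<tau> x) (u x))" by (fact ops)+
    fix v assume "node_fn D \<tau> \<nu>' v"
    then show "ram D (\<lambda>x. \<nu>' x (lca (\<tau> x) (u x) (v x)))"
      using ops(6)[of v] fn[OF D] iff[OF D, of "\<lambda>n x. n (lca (\<tau> x) (u x) (v x))"] by blast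
  qed
qed

end

section \<open>From the clusters to the whole tree\<close>

lemma handle_child:
  assumes "numbering \<nu>"
  shows "handle (\<nu> t) (child d t u) \<noteq> 0 \<longleftrightarrow> u @ [d] \<in> nodes t"
  using numbering_range[OF assms, of "u @ [d]" t] by (auto simp: child_def)

lemma sum_list_2:
  fixes f :: "'a \<Rightarrow> nat"
  assumes "length xs \<le> 2"
  shows "(\<Sum>e\<leftarrow>xs. f e) = (if 0 < length xs then f (xs ! 0) else 0) + (if 1 < length xs then f (xs ! 1) else 0)"
proof -
  consider "xs = []" | a where "xs = [a]" | a b where "xs = [a, b]"
    using assms by (cases xs; cases "tl xs"; cases "tl (tl xs)") auto
  then show ?thesis by cases auto
qed

context decomp begin

text \<open>A child outside of the cluster is the root of a hole. At most one hole has the given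
  parent and direction, and null is 0, so the sum over the holes is a lookup with default.\<close>

lemma child_cluster:
  assumes "numbering \<nu>" "c < N" "l \<in> nodes (ctree K t c)"
  shows "l @ [d] \<in> nodes (ctree K t c) \<Longrightarrow> child d t (crt c @ l) = Some (crt c @ (l @ [d]))"
    "l @ [d] \<notin> nodes (ctree K t c) \<Longrightarrow> handle f (child d t (crt c @ l)) =
      (\<Sum>e\<leftarrow>hl K t c. if \<nu> (ctree K t c) (loc K t (hole_parent e)) = \<nu> (ctree K t c) l \<and> last (crt e) = d
        then f (crt e) else 0)"
proof -
  show "child d t (crt c @ l) = Some (crt c @ (l @ [d]))" if "l @ [d] \<in> nodes (ctree K t c)"
    using glob(2)[OF assms(2) that] by (simp add: child_def)
next
  assume nl: "l @ [d] \<notin> nodes (ctree K t c)"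
  let ?w = "crt c @ l @ [d]"
  have iff: "\<nu> (ctree K t c) (loc K t (hole_parent e)) = \<nu> (ctree K t c) l \<and> last (crt e) = d \<longleftrightarrow> crt e = ?w"
    if "e \<in> set (hl K t c)" for e
  proof -
    note hp = hole_parent[OF assms(2) that]
    have "\<nu> (ctree K t c) (loc K t (hole_parent e)) = \<nu> (ctree K t c) l \<longleftrightarrow> hole_parent e = crt c @ l"
      using numbering_eq[OF assms(1) hp(4) assms(3)] hp(3) by (metis same_append_eq)
    moreover have "crt e = hole_parent e @ [last (crt e)]"
      unfolding hole_parent_def using hole(1)[OF assms(2) that] by simp
    ultimately show ?thesis by (metis append.assoc butlast_snoc last_snoc)
  qed
  have sum: "(\<Sum>e\<leftarrow>hl K t c. if \<nu> (ctree K t c) (loc K t (hole_parent e)) = \<nu> (ctree K t c) l \<and> last (crt e) = d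
        then f (crt e) else 0) = (\<Sum>e\<in>set (hl K t c). if crt e = ?w then f (crt e) else 0)"
    by (subst sum_list_distinct_conv_sum_set) (auto simp: iff hl_def[symmetric] simp del: set_upt intro!: sum.cong,
        simp add: hl_def)
  show "handle f (child d t (crt c @ l)) =
      (\<Sum>e\<leftarrow>hl K t c. if \<nu> (ctree K t c) (loc K t (hole_parent e)) = \<nu> (ctree K t c) l \<and> last (crt e) = d
        then f (crt e) else 0)"
  proof (cases "?w \<in> V")
    case True
    have "(crt c @ l) @ [d] \<notin> cl K t c" using nl by (simp add: nodes_ctree)
    then obtain e0 where e0: "e0 \<in> set (hl K t c)" "crt e0 = ?w"
      using child_hole[OF assms(2) glob(1)[OF assms(2,3)], of d] True by auto
    have "crt e = ?w \<longleftrightarrow> e = e0" if "e \<in> set (hl K t c)" for e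
      using e0 that root_inj by (auto simp: set_hl)
    then have "(\<Sum>e\<in>set (hl K t c). if crt e = ?w then f (crt e) else 0) =
      (\<Sum>e\<in>set (hl K t c). if e = e0 then f ?w else 0)"
      using e0(2) by (intro sum.cong) auto
    also have "\<dots> = f ?w" using e0(1) by (simp add: sum.delta)
    finally show ?thesis using sum True by (simp add: child_def)
  next
    case False
    have "crt e \<noteq> ?w" if "e \<in> set (hl K t c)" for e
    proof -
      have "crt e \<in> V" using that root_R R_sub by (auto simp: set_hl)
      then show ?thesis using False by metis
    qed
    then show ?thesis using sum False by (simp add: child_def)
  qed
qed

end

text \<open>The assumption \<open>acc\<close> hides how numbers are stored, since the two levels
  pack them differently. Operations on the clusters are assumed only in \<open>lift\<close>, because
  proving that assumption takes \<open>ram_lc\<close>, which must be available before.\<close>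

locale level_data = machine wd mm ar
  for wd :: "'x \<Rightarrow> nat" and mm :: "'x \<Rightarrow> nat \<Rightarrow> nat" and ar :: "'x \<Rightarrow> nat \<Rightarrow> nat" +
  fixes E :: "'x set" and \<tau> :: "'x \<Rightarrow> bintree" and K g L :: "'x \<Rightarrow> nat"
    and \<nu> :: "'x \<Rightarrow> bintree \<Rightarrow> node \<Rightarrow> nat" and lc :: "'x \<Rightarrow> nat \<Rightarrow> nat"
  assumes nonempty: "x \<in> E \<Longrightarrow> \<tau> x \<noteq> Leaf" and K: "x \<in> E \<Longrightarrow> K x \<ge> 1"
    and numb: "x \<in> E \<Longrightarrow> numbering (\<nu> x)"
    and g: "x \<in> E \<Longrightarrow> g x \<ge> 1" and ram_g: "ram E g" and ram_F: "ram E (\<lambda>x. 19 + L x)"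
    and bound: "x \<in> E \<Longrightarrow> length (level_nums (K x) (g x) (L x) (\<nu> x) (lc x) (\<tau> x)) < 2 ^ wd x"
    and size_bound: "x \<in> E \<Longrightarrow> size (\<tau> x) < 2 ^ wd x"
    and L: "x \<in> E \<Longrightarrow> ncl (K x) (\<tau> x) \<le> 2 ^ L x"
    and acc: "D \<subseteq> E \<Longrightarrow> ram D i \<Longrightarrow>
      (\<And>x. x \<in> D \<Longrightarrow> i x < length (level_nums (K x) (g x) (L x) (\<nu> x) (lc x) (\<tau> x))) \<Longrightarrow>
      ram D (\<lambda>x. level_nums (K x) (g x) (L x) (\<nu> x) (lc x) (\<tau> x) ! i x)"
begin

abbreviation "NC x \<equiv> ncl (K x) (\<tau> x)"
abbreviation "CT x \<equiv> ctree (K x) (\<tau> x)"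
abbreviation "LN x \<equiv> (\<lambda>c. \<nu> x (CT x c))"
abbreviation "CN x \<equiv> cnum (K x) (g x) (\<nu> x) (\<tau> x)"
abbreviation "RT x \<equiv> rt (K x) (\<tau> x)"
abbreviation "CI x \<equiv> cid (K x) (\<tau> x)"
abbreviation "LO x \<equiv> loc (K x) (\<tau> x)"
abbreviation "HL x \<equiv> hl (K x) (\<tau> x)"
abbreviation "HP x \<equiv> decomp.hole_parent (K x) (\<tau> x)"
abbreviation "FS x \<equiv> fields (K x) (g x) (L x) (\<nu> x) (lc x) (\<tau> x)"
abbreviation "CS x \<equiv> csize (K x) (\<tau> x)"

lemma dec: "x \<in> E \<Longrightarrow> decomp (K x) (\<tau> x)"
  by standard (use K nonempty in auto)

lemma size_pos: "x \<in> E \<Longrightarrow> size (\<tau> x) > 0"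
  using nonempty by (cases "\<tau> x") auto

lemma wd_pos: "x \<in> E \<Longrightarrow> (1::nat) < 2 ^ wd x"
  using size_bound[of x] size_pos[of x] by linarith

lemma ram_1: "D \<subseteq> E \<Longrightarrow> ram D (\<lambda>x. 1)"
  by (rule ram_const) (use wd_pos in blast)

lemma NC_less: "x \<in> E \<Longrightarrow> NC x < 2 ^ wd x"
  using decomp.N_le(2)[OF dec] size_bound le_less_trans by blast

lemma ram_fields:
  assumes "D \<subseteq> E" "ram D c" "ram D j" "\<And>x. x \<in> D \<Longrightarrow> c x < NC x" "\<And>x. x \<in> D \<Longrightarrow> j x < 19 + L x"
  shows "ram D (\<lambda>x. FS x (c x) ! j x)"
proof -
  let ?i = "\<lambda>x. 2 + (c x * (19 + L x) + j x)"
  have less: "?i x < 2 ^ wd x" if "x \<in> D" for x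
    using level_nums_field(1)[OF assms(4,5)[OF that]] bound assms(1) that less_trans by blast
  have "ram D ?i"
    by (intro ram_add ram_mult assms ram_const ram_mono[OF ram_F assms(1)])
      (use less in \<open>force+\<close>)
  then have "ram D (\<lambda>x. level_nums (K x) (g x) (L x) (\<nu> x) (lc x) (\<tau> x) ! ?i x)"
    by (rule acc[OF assms(1)]) (intro level_nums_field(1) assms(4,5))
  then show ?thesis by (rule ram_cong) (intro level_nums_field(2) assms(4,5))
qed

lemma ram_fields_const:
  assumes "D \<subseteq> E" "ram D c" "\<And>x. x \<in> D \<Longrightarrow> c x < NC x" "j < 19"
  shows "ram D (\<lambda>x. FS x (c x) ! j)"
proof (rule ram_fields[OF assms(1,2)])
  have "j < 2 ^ wd x" if "x \<in> D" for x
  proof -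
    have "j < length (level_nums (K x) (g x) (L x) (\<nu> x) (lc x) (\<tau> x))"
      using level_nums_field(1)[OF assms(3)[OF that], of j "L x" "g x" "\<nu> x" "lc x"] assms(4) by simp
    then show ?thesis using bound[of x] that assms(1) by force
  qed
  then show "ram D (\<lambda>x. j)" by (rule ram_const)
qed (use assms in auto)

lemma FS_simps:
  "FS x c ! 0 = handle (CN x) (parent (\<tau> x) (RT x c))"
  "FS x c ! 1 = decomp.inbase (K x) (\<tau> x) c"
  "FS x c ! 2 = decomp.prebase (K x) (\<tau> x) c"
  "FS x c ! 3 = thr (g x) (CS x) c"
  "FS x c ! 4 = base_full (g x) (CS x) c"
  "FS x c ! 5 = base_rest (g x) (CS x) (NC x) c"
  "k < L x \<Longrightarrow> FS x c ! (19 + k) = decomp.lcid (K x) (\<tau> x) c (min (c + 2 ^ k) (NC x - 1))"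
  by (simp_all add: fields_def nth_append)

lemma ram_lc:
  assumes "D \<subseteq> E" "ram D c" "\<And>x. x \<in> D \<Longrightarrow> c x < NC x"
  shows "ram D (\<lambda>x. lc x (c x))"
  by (rule ram_cong[OF ram_fields_const[OF assms, of 6]]) (simp_all add: fields_def)

end

locale lift = level_data wd mm ar E \<tau> K g L \<nu> lc
  for wd :: "'x \<Rightarrow> nat" and mm :: "'x \<Rightarrow> nat \<Rightarrow> nat" and ar :: "'x \<Rightarrow> nat \<Rightarrow> nat"
    and E \<tau> K g L \<nu> lc +
  assumes flog: "D \<subseteq> E \<Longrightarrow> ram D i \<Longrightarrow> (\<And>x. x \<in> D \<Longrightarrow> 0 < i x \<and> i x < ncl (K x) (\<tau> x)) \<Longrightarrow>
      ram D (\<lambda>x. floor_log (i x))"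
    and sub: "D \<subseteq> E \<Longrightarrow> ram D c \<Longrightarrow> (\<And>x. x \<in> D \<Longrightarrow> c x < ncl (K x) (\<tau> x)) \<Longrightarrow>
      ops D (\<lambda>x. ctree (K x) (\<tau> x) (c x)) (\<lambda>x. \<nu> x (ctree (K x) (\<tau> x) (c x)))"
begin

section \<open>Access to the holes of a cluster\<close>

lemma FS_hole:
  assumes "j < 2" "i < 6"
  shows "FS x c ! (7 + 6 * j + i) = hole_fields (K x) (g x) (\<nu> x) (\<tau> x) c j ! i"
proof -
  have *: "(as @ bs0 @ bs1 @ cs) ! (7 + 6 * j + i) = (if j = 0 then bs0 else bs1) ! i"
    if "length as = 7" "length bs0 = 6" "length bs1 = 6" for as bs0 bs1 cs :: "nat list"
    using that assms by (auto simp: nth_append less_2_cases_iff)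
  show ?thesis unfolding fields_def using assms(1) by (subst *) (auto simp: less_2_cases_iff)
qed

lemma hole_simps:
  assumes "j < 2" "j < length (HL x c)"
  shows "FS x c ! (7 + 6 * j) = LN x c (LO x (HP x (HL x c ! j)))"
    "FS x c ! (8 + 6 * j) = (if last (RT x (HL x c ! j)) = Left then 0 else 1)"
    "FS x c ! (9 + 6 * j) = HL x c ! j"
    "FS x c ! (10 + 6 * j) = CN x (RT x (HL x c ! j))"
    "FS x c ! (11 + 6 * j) = subtree_size (\<tau> x) (RT x (HL x c ! j))"
    "FS x c ! (12 + 6 * j) = decomp.null_rank (K x) (\<tau> x) c (HL x c ! j)"
proof -
  have eq: "7 + 6 * j = 7 + 6 * j + 0" "8 + 6 * j = 7 + 6 * j + 1" "9 + 6 * j = 7 + 6 * j + 2"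
    "10 + 6 * j = 7 + 6 * j + 3" "11 + 6 * j = 7 + 6 * j + 4" "12 + 6 * j = 7 + 6 * j + 5" by simp_all
  note [simp] = hole_fields_def Let_def assms(2)
  show "FS x c ! (7 + 6 * j) = LN x c (LO x (HP x (HL x c ! j)))"
    by (subst eq, subst FS_hole[OF assms(1)]) simp_all
  show "FS x c ! (8 + 6 * j) = (if last (RT x (HL x c ! j)) = Left then 0 else 1)"
    by (subst eq, subst FS_hole[OF assms(1)]) simp_all
  show "FS x c ! (9 + 6 * j) = HL x c ! j"
    by (subst eq, subst FS_hole[OF assms(1)]) simp_all
  show "FS x c ! (10 + 6 * j) = CN x (RT x (HL x c ! j))"
    by (subst eq, subst FS_hole[OF assms(1)]) simp_all
  show "FS x c ! (11 + 6 * j) = subtree_size (\<tau> x) (RT x (HL x c ! j))"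
    by (subst eq, subst FS_hole[OF assms(1)]) simp_all
  show "FS x c ! (12 + 6 * j) = decomp.null_rank (K x) (\<tau> x) c (HL x c ! j)"
    by (subst eq, subst FS_hole[OF assms(1)]) simp_all
qed

lemma hole_absent:
  assumes "j < 2" "\<not> j < length (HL x c)"
  shows "FS x c ! (9 + 6 * j) = NC x" "FS x c ! (11 + 6 * j) = 0"
proof -
  have "FS x c ! (7 + 6 * j + 2) = NC x" "FS x c ! (7 + 6 * j + 4) = 0"
    using assms by (simp_all only: FS_hole) (simp_all add: hole_fields_def)
  then show "FS x c ! (9 + 6 * j) = NC x" "FS x c ! (11 + 6 * j) = 0" by simp_all
qed

lemma hole_present:
  assumes "x \<in> E" "c < NC x" "j < 2"
  shows "0 < FS x c ! (11 + 6 * j) \<longleftrightarrow> j < length (HL x c)"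
proof (cases "j < length (HL x c)")
  case True
  interpret decomp "K x" "\<tau> x" using dec[OF assms(1)] .
  have "HL x c ! j < N" using True set_hl nth_mem by blast
  then have r: "RT x (HL x c ! j) \<in> V" using root_R R_sub by blast
  have "subtree_size (\<tau> x) (RT x (HL x c ! j)) > 0"
    unfolding subtree_size_card[OF r] card_gt_0_iff using r by auto
  then show ?thesis using True hole_simps(5)[OF assms(3) True] by simp
next
  case False
  then show ?thesis using hole_absent(2)[OF assms(3)] by simp
qed

lemma ram_hole_if:
  assumes "D \<subseteq> E" "ram D c" "\<And>x. x \<in> D \<Longrightarrow> c x < NC x" "j < 2"
    "ram {x\<in>D. j < length (HL x (c x))} f" "ram {x\<in>D. \<not> j < length (HL x (c x))} f'"
  shows "ram D (\<lambda>x. if j < length (HL x (c x)) then f x else f' x)"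
proof -
  have *: "0 < FS x (c x) ! (11 + 6 * j) \<longleftrightarrow> j < length (HL x (c x))" if "x \<in> D" for x
    using hole_present assms that by blast
  have "{x\<in>D. 0 < FS x (c x) ! (11 + 6 * j)} = {x\<in>D. j < length (HL x (c x))}"
    "{x\<in>D. \<not> 0 < FS x (c x) ! (11 + 6 * j)} = {x\<in>D. \<not> j < length (HL x (c x))}"
    by (intro Collect_cong conj_cong refl, simp only: *)+
  then have "ram D (\<lambda>x. if 0 < FS x (c x) ! (11 + 6 * j) then f x else f' x)"
    using assms(4-6) by (intro ram_if_less ram_0 ram_fields_const[OF assms(1-3)]) simp_all
  then show ?thesis by (rule ram_cong) (simp only: *)
qed

text \<open>There are at most two holes, so two conditional summands replace a loop.\<close>

lemma ram_hole_sum: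
  assumes "D \<subseteq> E" "ram D c" "\<And>x. x \<in> D \<Longrightarrow> c x < NC x"
    "\<And>j. j < 2 \<Longrightarrow> ram {x\<in>D. j < length (HL x (c x))} (\<lambda>x. f x (HL x (c x) ! j))"
    "\<And>x. x \<in> D \<Longrightarrow> (\<Sum>e\<leftarrow>HL x (c x). f x e) < 2 ^ wd x"
  shows "ram D (\<lambda>x. \<Sum>e\<leftarrow>HL x (c x). f x e)"
proof -
  define T where "T j x = (if j < length (HL x (c x)) then f x (HL x (c x) ! j) else 0)" for j x
  have eq: "(\<Sum>e\<leftarrow>HL x (c x). f x e) = T 0 x + T 1 x" if "x \<in> D" for x
    unfolding T_def using decomp.length_hl[OF dec assms(3)[OF that]] that assms(1)
    by (intro sum_list_2) blast
  have "ram D (T j)" if "j < 2" for j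
    unfolding T_def using assms that by (intro ram_hole_if ram_0) auto
  then have "ram D (\<lambda>x. T 0 x + T 1 x)"
    using assms(5) eq by (intro ram_add) auto
  then show ?thesis by (rule ram_cong) (simp add: eq)
qed

lemma hole_parent_fn:
  assumes "D \<subseteq> E" "ram D c" "\<And>x. x \<in> D \<Longrightarrow> c x < NC x" "j < 2" "\<And>x. x \<in> D \<Longrightarrow> j < length (HL x (c x))"
  shows "node_fn D (\<lambda>x. CT x (c x)) (\<lambda>x. LN x (c x)) (\<lambda>x. LO x (HP x (HL x (c x) ! j)))"
  unfolding node_fn_def
proof
  show "\<forall>x\<in>D. LO x (HP x (HL x (c x) ! j)) \<in> nodes (CT x (c x))"
    using decomp.hole_parent(4)[OF dec assms(3) nth_mem[OF assms(5)]] assms(1) by blast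
  have "ram D (\<lambda>x. FS x (c x) ! (7 + 6 * j))"
    using assms(4) by (intro ram_fields_const[OF assms(1-3)]) auto
  then show "ram D (\<lambda>x. LN x (c x) (LO x (HP x (HL x (c x) ! j))))"
    by (rule ram_cong) (use hole_simps(1)[OF assms(4)] assms(5) in blast)
qed

lemma ram_hole_fields:
  assumes "D \<subseteq> E" "ram D c" "\<And>x. x \<in> D \<Longrightarrow> c x < NC x" "j < 2" "\<And>x. x \<in> D \<Longrightarrow> j < length (HL x (c x))"
  shows "ram D (\<lambda>x. if last (RT x (HL x (c x) ! j)) = Left then 0 else 1)"
    "ram D (\<lambda>x. CN x (RT x (HL x (c x) ! j)))"
    "ram D (\<lambda>x. subtree_size (\<tau> x) (RT x (HL x (c x) ! j)))"
    "ram D (\<lambda>x. decomp.null_rank (K x) (\<tau> x) (c x) (HL x (c x) ! j))"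
proof -
  have r: "ram D (\<lambda>x. FS x (c x) ! (i + 6 * j))" if "i < 13" for i
    using assms(4) that by (intro ram_fields_const[OF assms(1-3)]) auto
  note hs = hole_simps[OF assms(4,5)]
  show "ram D (\<lambda>x. if last (RT x (HL x (c x) ! j)) = Left then 0 else 1)"
    by (rule ram_cong[OF r[of 8]]) (simp_all add: hs)
  show "ram D (\<lambda>x. CN x (RT x (HL x (c x) ! j)))"
    by (rule ram_cong[OF r[of 10]]) (simp_all add: hs)
  show "ram D (\<lambda>x. subtree_size (\<tau> x) (RT x (HL x (c x) ! j)))"
    by (rule ram_cong[OF r[of 11]]) (simp_all add: hs)
  show "ram D (\<lambda>x. decomp.null_rank (K x) (\<tau> x) (c x) (HL x (c x) ! j))"
    by (rule ram_cong[OF r[of 12]]) (simp_all add: hs)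
qed

text \<open>The slot table yields the cluster of a handle; subtracting the offset stored with the
  cluster yields the local handle. Most of the proof ensures that no intermediate result overflows
  or becomes negative.\<close>

lemma decode:
  assumes "D \<subseteq> E" "node_fn D \<tau> CN u"
  shows "ram D (\<lambda>x. CI x (u x))"
    "node_fn D (\<lambda>x. CT x (CI x (u x))) (\<lambda>x. LN x (CI x (u x))) (\<lambda>x. LO x (u x))"
proof -
  have u: "u x \<in> nodes (\<tau> x)" if "x \<in> D" for x using assms(2) that by (simp add: node_fn_def)
  let ?nums = "\<lambda>x. level_nums (K x) (g x) (L x) (\<nu> x) (lc x) (\<tau> x)"
  let ?l = "\<lambda>x. LN x (CI x (u x)) (LO x (u x))"
  let ?y = "\<lambda>x. fwd (g x) (CS x) (NC x) (CI x (u x)) (?l x - 1)"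
  let ?Q = "\<lambda>x. full (g x) (CS x) (NC x)"
  have inE: "x \<in> E" if "x \<in> D" for x using assms(1) that by blast
  have cN: "CI x (u x) < NC x" if "x \<in> D" for x
    using decomp.cid_less[OF dec] u inE that by blast
  have ln: "?l x \<ge> 1" "?l x - 1 < CS x (CI x (u x))" if "x \<in> D" for x
    using decomp.local_num[OF dec numb] u inE that by blast+
  have sf: "slot (g x) (CS x) (NC x) (?y x) < slots (g x) (CS x) (NC x)"
    "slot_owner (g x) (CS x) (NC x) (slot (g x) (CS x) (NC x) (?y x)) = CI x (u x)"
    "?l x - 1 = ?y x - (if ?y x < full (g x) (CS x) (NC x) * g x
      then base_full (g x) (CS x) (CI x (u x)) else base_rest (g x) (CS x) (NC x) (CI x (u x)))"
    if "x \<in> D" for x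
    using slot_fwd[where s = "CS x" and N = "NC x" and g = "g x" and c = "CI x (u x)" and l = "?l x - 1"]
      cN[OF that] ln(2)[OF that] by blast+
  have yless: "?y x < psum (CS x) (NC x)" if "x \<in> D" for x
    using that by (intro fwd_less cN ln(2))
  have len: "length (?nums x) < 2 ^ wd x" if "x \<in> D" for x using bound inE that by blast
  have y: "ram D ?y"
    by (rule ram_cong[of _ "\<lambda>x. CN x (u x) - 1"], rule ram_diff)
      (use assms ram_1 in \<open>auto simp: node_fn_def cnum_def\<close>)
  have es: "ram D (\<lambda>x. ?nums x ! 0)"
    by (rule acc[OF assms(1) ram_0]) (simp add: length_level_nums)
  have Q: "ram D (\<lambda>x. ?nums x ! 1)"
    by (rule acc[OF assms(1) ram_1[OF assms(1)]]) (simp add: length_level_nums)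
  have less: "2 + NC x * (19 + L x) + slot (g x) (CS x) (NC x) (?y x) < length (?nums x)" if "x \<in> D" for x
    using level_nums_slot(1)[OF sf(1)[OF that]] .
  \<comment> \<open>Only the product with \<open>g x\<close> is stored; the number of full chunks is
    recovered by division.\<close>
  have Qg: "?nums x ! 1 div g x = ?Q x" if "x \<in> D" for x
    using g[OF inE[OF that]] by (simp only: level_nums_head) simp
  let ?s = "\<lambda>x. if ?y x < ?nums x ! 1 then ?y x div g x else ?nums x ! 1 div g x + (?y x - ?nums x ! 1)"
  have gD: "ram D' g" if "D' \<subseteq> D" for D' using ram_g ram_mono assms(1) that by blast
  have b1: "ram {x \<in> D. ?y x < ?nums x ! 1} (\<lambda>x. ?y x div g x)"
    by (intro ram_div gD ram_mono[OF y]) auto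
  have le: "?nums x ! 1 div g x + (?y x - ?nums x ! 1) < 2 ^ wd x" if "x \<in> D" "\<not> ?y x < ?nums x ! 1" for x
    using less[OF that(1)] len[OF that(1)] that(2) Qg[OF that(1)]
    by (simp add: slot_def level_nums_head)
  have b2: "ram {x \<in> D. \<not> ?y x < ?nums x ! 1} (\<lambda>x. ?nums x ! 1 div g x + (?y x - ?nums x ! 1))"
    by (intro ram_add ram_div gD ram_diff ram_mono[OF y] ram_mono[OF Q]) (use le in auto)
  have s: "ram D ?s" by (rule ram_if_less[OF y Q b1 b2])
  have "ram D (\<lambda>x. ?nums x ! 0 + ?s x)"
  proof (rule ram_add[OF es s])
    fix x assume x: "x \<in> D"
    show "?nums x ! 0 + ?s x < 2 ^ wd x"
      using less[OF x] len[OF x] Qg[OF x] by (auto simp: slot_def level_nums_head split: if_splits)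
  qed
  then have idx: "ram D (\<lambda>x. 2 + NC x * (19 + L x) + slot (g x) (CS x) (NC x) (?y x))"
    by (rule ram_cong) (use Qg in \<open>simp add: slot_def level_nums_head\<close>)
  show c: "ram D (\<lambda>x. CI x (u x))"
    by (rule ram_cong[OF acc[OF assms(1) idx less]])
      (use level_nums_slot(2)[OF sf(1)] sf(2) in simp)+
  let ?b = "\<lambda>x. if ?y x < ?nums x ! 1 then FS x (CI x (u x)) ! 4 else FS x (CI x (u x)) ! 5"
  have sf3: "?l x - 1 = ?y x - ?b x" if "x \<in> D" for x
    using sf(3)[OF that] by (simp only: level_nums_head(2) FS_simps)
  have b: "ram D ?b"
    by (intro ram_if_less y Q) (auto intro!: ram_mono[OF ram_fields_const[OF assms(1) c cN]])
  have ble: "?b x \<le> ?y x" if "x \<in> D" for x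
  proof (cases "?l x - 1 < thr (g x) (CS x) (CI x (u x))")
    case True
    then show ?thesis using fwd_full(1)[OF cN[OF that] True] by (simp add: level_nums_head FS_simps fwd_def)
  next
    case False
    note f = fwd_rest[OF cN[OF that] ln(2)[OF that] False]
    have "\<not> ?y x < ?Q x * g x" unfolding f(1) by simp
    moreover have "base_rest (g x) (CS x) (NC x) (CI x (u x)) \<le> ?y x"
      using False by (simp add: fwd_def)
    ultimately show ?thesis by (simp only: level_nums_head FS_simps if_False)
  qed
  have "ram D (\<lambda>x. ?y x - ?b x + 1)"
  proof (intro ram_add ram_diff y b ble ram_1[OF assms(1)])
    fix x assume x: "x \<in> D"
    have "?y x < size (\<tau> x)"
      using yless[OF x] decomp.psum_csize[OF dec[OF inE[OF x]]] by simp
    then show "?y x - ?b x + 1 < 2 ^ wd x" using size_bound[OF inE[OF x]] by linarith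
  qed
  then have "ram D ?l" by (rule ram_cong) (use sf3 ln(1) in force)
  then show "node_fn D (\<lambda>x. CT x (CI x (u x))) (\<lambda>x. LN x (CI x (u x))) (\<lambda>x. LO x (u x))"
    using decomp.loc_nodes[OF dec] u inE by (simp add: node_fn_def)
qed

lemma encode:
  assumes "D \<subseteq> E" "ram D c" "\<And>x. x \<in> D \<Longrightarrow> c x < NC x"
    "node_fn D (\<lambda>x. CT x (c x)) (\<lambda>x. LN x (c x)) l"
  shows "node_fn D \<tau> CN (\<lambda>x. RT x (c x) @ l x)"
proof -
  have l: "l x \<in> nodes (CT x (c x))" if "x \<in> D" for x using assms(4) that by (simp add: node_fn_def)
  have inE: "x \<in> E" if "x \<in> D" for x using assms(1) that by blast
  note gl = decomp.glob[OF dec[OF inE] assms(3) l]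
  let ?l = "\<lambda>x. LN x (c x) (l x)"
  have ln: "1 \<le> ?l x" "?l x - 1 < CS x (c x)" if "x \<in> D" for x
    using numbering_range[OF numb[OF inE[OF that]] l[OF that]] by (auto simp: csize_def)
  have eq: "CN x (RT x (c x) @ l x) = Suc (fwd (g x) (CS x) (NC x) (c x) (?l x - 1))" if "x \<in> D" for x
    using gl(3,4)[OF that that that] by (simp add: cnum_def)
  have less: "Suc (fwd (g x) (CS x) (NC x) (c x) (?l x - 1)) < 2 ^ wd x" if "x \<in> D" for x
  proof -
    have "fwd (g x) (CS x) (NC x) (c x) (?l x - 1) < psum (CS x) (NC x)"
      using that by (intro fwd_less assms(3) ln(2))
    then show ?thesis using decomp.psum_csize[OF dec[OF inE[OF that]]] size_bound[OF inE[OF that]]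
      by linarith
  qed
  have l1: "ram D (\<lambda>x. ?l x - 1)"
    by (rule ram_diff) (use assms ln ram_1 in \<open>auto simp: node_fn_def\<close>)
  let ?t = "\<lambda>x. if ?l x - 1 < FS x (c x) ! 3 then FS x (c x) ! 4 else FS x (c x) ! 5"
  have t: "ram D ?t"
    by (intro ram_if_less l1 ram_fields_const[OF assms(1-3)])
      (auto intro!: ram_mono[OF ram_fields_const[OF assms(1-3)]])
  have bnd: "?l x - 1 + ?t x + 1 < 2 ^ wd x" if "x \<in> D" for x
    using less[OF that] unfolding fwd_def FS_simps by linarith
  have "ram D (\<lambda>x. ?l x - 1 + ?t x + 1)"
    by (intro ram_add l1 t ram_1[OF assms(1)]) (drule bnd, linarith)+
  then have "ram D (\<lambda>x. CN x (RT x (c x) @ l x))"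
    by (rule ram_cong) (simp only: eq fwd_def FS_simps add_Suc_right add_0_right One_nat_def)
  then show ?thesis using gl(2) by (simp add: node_fn_def)
qed

section \<open>Operations on a single node\<close>

context
  fixes D :: "'x set" and u :: "'x \<Rightarrow> node"
  assumes D: "D \<subseteq> E" and u: "node_fn D \<tau> CN u"
begin

abbreviation (input) "cu x \<equiv> CI x (u x)"
abbreviation (input) "lu x \<equiv> LO x (u x)"

lemma u_nodes: "x \<in> D \<Longrightarrow> u x \<in> nodes (\<tau> x)" and in_E: "x \<in> D \<Longrightarrow> x \<in> E"
  using u D by (auto simp: node_fn_def)

lemma dec_D: "x \<in> D \<Longrightarrow> decomp (K x) (\<tau> x)"
  using dec in_E by blast

lemma cu: "ram D cu" and cu_less: "x \<in> D \<Longrightarrow> cu x < NC x"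
  using decode(1)[OF D u] decomp.cid_less[OF dec_D] u_nodes by blast+

lemma lu: "node_fn D (\<lambda>x. CT x (cu x)) (\<lambda>x. LN x (cu x)) lu"
  by (rule decode(2)[OF D u])

lemma lu_nodes: "x \<in> D \<Longrightarrow> lu x \<in> nodes (CT x (cu x))"
  using lu by (simp add: node_fn_def)

lemma u_eq: "x \<in> D \<Longrightarrow> u x = RT x (cu x) @ lu x"
  using decomp.loc_append[OF dec_D] u_nodes by simp

lemma local_ops: "ops D (\<lambda>x. CT x (cu x)) (\<lambda>x. LN x (cu x))"
  using sub[OF D cu cu_less] .

lemma handle_less:
  assumes "x \<in> D" "v \<in> nodes (\<tau> x)"
  shows "CN x v < 2 ^ wd x"
  using numbering_range[OF numbering_cnum[OF K[OF in_E[OF assms(1)]] numb[OF in_E[OF assms(1)]]] assms(2)]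
    size_bound[OF in_E[OF assms(1)]] by (meson le_less_trans)

lemma size_less:
  assumes "x \<in> D"
  shows "subtree_size (\<tau> x) (u x) < 2 ^ wd x" "inorder_rank (\<tau> x) (u x) < 2 ^ wd x"
    "preorder_rank (\<tau> x) (u x) < 2 ^ wd x"
proof -
  have *: "card {v \<in> nodes (\<tau> x). P v} \<le> size (\<tau> x)" for P
    unfolding card_nodes[symmetric] by (rule card_mono) auto
  have "card {v \<in> nodes (\<tau> x). P v} < size (\<tau> x)" if "\<not> P (u x)" for P
    unfolding card_nodes[symmetric] using u_nodes[OF assms] that by (intro psubset_card_mono) auto
  from this[of "\<lambda>v. in_less v (u x)"] this[of "\<lambda>v. pre_less v (u x)"] *[of "prefix (u x)"]
  show "subtree_size (\<tau> x) (u x) < 2 ^ wd x" "inorder_rank (\<tau> x) (u x) < 2 ^ wd x"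
    "preorder_rank (\<tau> x) (u x) < 2 ^ wd x"
    using size_bound[OF in_E[OF assms]]
    unfolding subtree_size_card[OF u_nodes[OF assms]] inorder_rank_card[OF u_nodes[OF assms]]
      preorder_rank_card[OF u_nodes[OF assms]] by simp_all
qed

lemma ram_child: "ram D (\<lambda>x. handle (CN x) (child d (\<tau> x) (u x)))"
proof -
  let ?h = "\<lambda>x. handle (LN x (cu x)) (child d (CT x (cu x)) (lu x))"
  have h: "ram D ?h" using opsD(1)[OF local_ops order_refl lu] .
  have iff: "?h x \<noteq> 0 \<longleftrightarrow> lu x @ [d] \<in> nodes (CT x (cu x))" if "x \<in> D" for x
    using handle_child[OF numb[OF in_E[OF that]]] .
  \<comment> \<open>The local answer is 0 exactly if the child is not in the cluster; then the
    fields of the holes have to be consulted.\<close>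
  show ?thesis
  proof (rule ram_split_eq[OF h ram_0])
    let ?D = "{x \<in> D. ?h x \<noteq> 0}"
    have "node_fn ?D (\<lambda>x. CT x (cu x)) (\<lambda>x. LN x (cu x)) (\<lambda>x. lu x @ [d])"
      unfolding node_fn_def
    proof
      show "ram ?D (\<lambda>x. LN x (cu x) (lu x @ [d]))"
        by (rule ram_cong[OF ram_mono[OF h]]) (use iff in \<open>auto simp: child_def\<close>)
    qed (use iff in auto)
    from encode[OF _ ram_mono[OF cu] _ this]
    have "ram ?D (\<lambda>x. CN x (RT x (cu x) @ (lu x @ [d])))"
      using D cu_less by (auto simp: node_fn_def)
    then show "ram ?D (\<lambda>x. handle (CN x) (child d (\<tau> x) (u x)))"
    proof (rule ram_cong)
      fix x assume x: "x \<in> ?D"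
      then have "child d (\<tau> x) (RT x (cu x) @ lu x) = Some (RT x (cu x) @ (lu x @ [d]))"
        using decomp.child_cluster(1)[OF dec_D numb[OF in_E] cu_less lu_nodes] iff by blast
      then show "CN x (RT x (cu x) @ (lu x @ [d])) = handle (CN x) (child d (\<tau> x) (u x))"
        using u_eq x by simp
    qed
  next
    let ?D = "{x \<in> D. ?h x = 0}"
    let ?f = "\<lambda>x e. if LN x (cu x) (LO x (HP x e)) = LN x (cu x) (lu x) \<and> last (RT x e) = d
        then CN x (RT x e) else 0"
    have DE: "?D \<subseteq> E" using D by auto
    have cuD: "ram ?D cu" by (rule ram_mono[OF cu]) auto
    have eq: "handle (CN x) (child d (\<tau> x) (u x)) = (\<Sum>e\<leftarrow>HL x (cu x). ?f x e)" if "x \<in> ?D" for x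
    proof -
      have x: "x \<in> D" "lu x @ [d] \<notin> nodes (CT x (cu x))" using that iff[of x] by blast+
      show ?thesis
        using decomp.child_cluster(2)[OF dec_D numb[OF in_E] cu_less lu_nodes x(2), OF x(1) x(1) x(1) x(1)]
          u_eq[OF x(1)] by metis
    qed
    have "ram ?D (\<lambda>x. \<Sum>e\<leftarrow>HL x (cu x). ?f x e)"
    proof (rule ram_hole_sum[OF DE cuD])
      fix j :: nat assume j: "j < 2"
      let ?D' = "{x \<in> ?D. j < length (HL x (cu x))}"
      have D': "?D' \<subseteq> E" "ram ?D' cu" "\<And>x. x \<in> ?D' \<Longrightarrow> cu x < NC x"
        "\<And>x. x \<in> ?D' \<Longrightarrow> j < length (HL x (cu x))"
        using DE cu_less by (auto intro: ram_mono[OF cuD])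
      note hf = ram_hole_fields[OF D'(1,2,3) j D'(4)]
      have hp: "ram ?D' (\<lambda>x. LN x (cu x) (LO x (HP x (HL x (cu x) ! j))))"
        using hole_parent_fn[OF D'(1,2,3) j D'(4)] by (simp add: node_fn_def)
      have lu': "ram ?D' (\<lambda>x. LN x (cu x) (lu x))"
        using lu by (auto simp: node_fn_def intro: ram_mono)
      have one: "ram D'' (\<lambda>x. 1)" if "D'' \<subseteq> ?D'" for D''
        by (rule ram_1[OF subset_trans[OF that D'(1)]])
      let ?sd = "\<lambda>x. if last (RT x (HL x (cu x) ! j)) = Left then 0 else (1::nat)"
      have "ram ?D' (\<lambda>x. if LN x (cu x) (LO x (HP x (HL x (cu x) ! j))) = LN x (cu x) (lu x)
        then if ?sd x = (if d = Left then 0 else 1) then CN x (RT x (HL x (cu x) ! j)) else 0 else 0)"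
      proof (intro ram_if_eq hp lu' ram_0)
        let ?D2 = "{x \<in> ?D'. LN x (cu x) (LO x (HP x (HL x (cu x) ! j))) = LN x (cu x) (lu x)}"
        show "ram ?D2 ?sd" by (rule ram_mono[OF hf(1)]) auto
        show "ram ?D2 (\<lambda>x. if d = Left then 0 else 1)"
        proof (cases "d = Left")
          case False
          have "ram ?D2 (\<lambda>x. 1)" by (rule one) auto
          then show ?thesis using False by simp
        qed (simp add: ram_0)
        show "ram {x \<in> ?D2. ?sd x = (if d = Left then 0 else 1)} (\<lambda>x. CN x (RT x (HL x (cu x) ! j)))"
          by (rule ram_mono[OF hf(2)]) auto
      qed
      then show "ram ?D' (\<lambda>x. ?f x (HL x (cu x) ! j))"
      proof (rule ram_cong)
        fix x
        have "?sd x = (if d = Left then 0 else 1) \<longleftrightarrow> last (RT x (HL x (cu x) ! j)) = d"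
          by (cases "last (RT x (HL x (cu x) ! j))"; cases d) simp_all
        then show "(if LN x (cu x) (LO x (HP x (HL x (cu x) ! j))) = LN x (cu x) (lu x)
            then if ?sd x = (if d = Left then 0 else 1) then CN x (RT x (HL x (cu x) ! j)) else 0 else 0) =
          ?f x (HL x (cu x) ! j)"
          by (simp only:) simp
      qed
    next
      fix x assume x: "x \<in> ?D"
      have "handle (CN x) (child d (\<tau> x) (u x)) < 2 ^ wd x"
        using handle_less[of x] x by (auto simp: child_def)
      then show "(\<Sum>e\<leftarrow>HL x (cu x). ?f x e) < 2 ^ wd x" using eq[OF x] by simp
    qed (use cu_less in auto)
    then show "ram ?D (\<lambda>x. handle (CN x) (child d (\<tau> x) (u x)))"
      by (rule ram_cong) (simp add: eq)
  qed
qed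

lemma ram_parent: "ram D (\<lambda>x. handle (CN x) (parent (\<tau> x) (u x)))"
proof -
  let ?h = "\<lambda>x. handle (LN x (cu x)) (parent (CT x (cu x)) (lu x))"
  have h: "ram D ?h" using opsD(2)[OF local_ops order_refl lu] .
  have bl: "butlast (lu x) \<in> nodes (CT x (cu x))" if "x \<in> D" for x
    using nodes_prefix[OF lu_nodes[OF that]] by (metis append_butlast_last_id butlast.simps(1) prefixI prefix_order.order_refl)
  have iff: "?h x \<noteq> 0 \<longleftrightarrow> lu x \<noteq> []" if "x \<in> D" for x
    using numbering_range[OF numb[OF in_E[OF that]] bl[OF that]] by (auto simp: parent_def)
  show ?thesis
  proof (rule ram_split_eq[OF h ram_0])
    let ?D = "{x \<in> D. ?h x \<noteq> 0}"
    have "node_fn ?D (\<lambda>x. CT x (cu x)) (\<lambda>x. LN x (cu x)) (\<lambda>x. butlast (lu x))"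
      unfolding node_fn_def
    proof
      show "ram ?D (\<lambda>x. LN x (cu x) (butlast (lu x)))"
        by (rule ram_cong[OF ram_mono[OF h]]) (use iff in \<open>auto simp: parent_def\<close>)
    qed (use bl in auto)
    from encode[OF _ ram_mono[OF cu] _ this]
    have "ram ?D (\<lambda>x. CN x (RT x (cu x) @ butlast (lu x)))"
      using D cu_less by (auto simp: node_fn_def)
    then show "ram ?D (\<lambda>x. handle (CN x) (parent (\<tau> x) (u x)))"
    proof (rule ram_cong)
      fix x assume x: "x \<in> ?D"
      then have "lu x \<noteq> []" using iff by blast
      then have "parent (\<tau> x) (RT x (cu x) @ lu x) = Some (RT x (cu x) @ butlast (lu x))"
        by (simp add: parent_def butlast_append)
      then show "CN x (RT x (cu x) @ butlast (lu x)) = handle (CN x) (parent (\<tau> x) (u x))"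
        using u_eq x by simp
    qed
  next
    \<comment> \<open>A node without a parent in its cluster is the root of the cluster, and the
      first field is the handle of its parent in the whole tree, or 0.\<close>
    let ?D = "{x \<in> D. ?h x = 0}"
    have "ram ?D (\<lambda>x. FS x (cu x) ! 0)"
      using D cu_less by (intro ram_fields_const ram_mono[OF cu]) auto
    then show "ram ?D (\<lambda>x. handle (CN x) (parent (\<tau> x) (u x)))"
    proof (rule ram_cong)
      fix x assume x: "x \<in> ?D"
      then have "lu x = []" using iff by blast
      then have "u x = RT x (cu x)" using u_eq[of x] x by simp
      then show "FS x (cu x) ! 0 = handle (CN x) (parent (\<tau> x) (u x))" by (simp add: FS_simps)
    qed
  qed
qed

lemma ram_hole_sizes:
  assumes "\<And>j. j < 2 \<Longrightarrow> ram {x\<in>D. j < length (HL x (cu x))} (\<lambda>x. of_bool (Q x (HL x (cu x) ! j)))"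
    "\<And>x. x \<in> D \<Longrightarrow> (\<Sum>e\<leftarrow>HL x (cu x). if Q x e then subtree_size (\<tau> x) (RT x e) else 0) < 2 ^ wd x"
  shows "ram D (\<lambda>x. \<Sum>e\<leftarrow>HL x (cu x). if Q x e then subtree_size (\<tau> x) (RT x e) else 0)"
proof (rule ram_hole_sum[OF D cu cu_less _ assms(2)])
  fix j :: nat assume j: "j < 2"
  let ?D' = "{x \<in> D. j < length (HL x (cu x))}"
  have D': "?D' \<subseteq> E" "ram ?D' cu" "\<And>x. x \<in> ?D' \<Longrightarrow> cu x < NC x"
    "\<And>x. x \<in> ?D' \<Longrightarrow> j < length (HL x (cu x))"
    using D cu_less by (auto intro: ram_mono[OF cu])
  have "ram ?D' (\<lambda>x. if of_bool (Q x (HL x (cu x) ! j)) = (0::nat) then 0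
      else subtree_size (\<tau> x) (RT x (HL x (cu x) ! j)))"
    by (intro ram_if_eq assms(1)[OF j] ram_0 ram_mono[OF ram_hole_fields(3)[OF D'(1,2,3) j D'(4)]]) auto
  then show "ram ?D' (\<lambda>x. if Q x (HL x (cu x) ! j) then subtree_size (\<tau> x) (RT x (HL x (cu x) ! j)) else 0)"
    by (rule ram_cong) auto
qed

text \<open>Both relations between a node and a hole become local queries: descent by the local
  \<open>lca\<close> with the parent of the hole, order by the local inorder rank against
  \<open>null_rank\<close>.\<close>

lemma hole_tests:
  assumes j: "j < 2"
  shows "ram {x\<in>D. j < length (HL x (cu x))} (\<lambda>x. of_bool (prefix (u x) (RT x (HL x (cu x) ! j))))"
    "ram {x\<in>D. j < length (HL x (cu x))} (\<lambda>x. of_bool (in_less (RT x (HL x (cu x) ! j)) (u x)))"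
proof -
  let ?D' = "{x \<in> D. j < length (HL x (cu x))}"
  have D': "?D' \<subseteq> E" "ram ?D' cu" "\<And>x. x \<in> ?D' \<Longrightarrow> cu x < NC x"
    "\<And>x. x \<in> ?D' \<Longrightarrow> j < length (HL x (cu x))" "?D' \<subseteq> D"
    using D cu_less by (auto intro: ram_mono[OF cu])
  note lu' = node_fn_mono[OF lu D'(5)]
  note hp = hole_parent_fn[OF D'(1,2,3) j D'(4)]
  let ?q = "\<lambda>x. LO x (HP x (HL x (cu x) ! j))"
  have one: "ram D'' (\<lambda>x. 1)" if "D'' \<subseteq> ?D'" for D''
    by (rule ram_1[OF subset_trans[OF that D'(1)]])
  have hlj: "HL x (cu x) ! j \<in> set (HL x (cu x))" if "x \<in> ?D'" for x
    using that by simp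
  have "ram ?D' (\<lambda>x. LN x (cu x) (lca (CT x (cu x)) (lu x) (?q x)))"
    using opsD(6)[OF local_ops D'(5) lu' hp] .
  then have "ram ?D' (\<lambda>x. if LN x (cu x) (lca (CT x (cu x)) (lu x) (?q x)) = LN x (cu x) (lu x) then 1 else 0)"
    using lu' by (intro ram_if_eq one ram_0) (auto simp: node_fn_def)
  then show "ram ?D' (\<lambda>x. of_bool (prefix (u x) (RT x (HL x (cu x) ! j))))"
  proof (rule ram_cong)
    fix x assume x: "x \<in> ?D'"
    interpret decomp "K x" "\<tau> x" using dec_D x by blast
    have xD: "x \<in> D" using x by blast
    have "?q x \<in> nodes (CT x (cu x))" using hp x by (simp add: node_fn_def)
    then have lcaV: "lca (CT x (cu x)) (lu x) (?q x) \<in> nodes (CT x (cu x))"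
      using lca_eq[OF lu_nodes[OF xD]] nodes_prefix[OF lu_nodes[OF xD]] longest_common_prefix_prefix1
      by metis
    have "prefix (u x) (RT x (HL x (cu x) ! j)) \<longleftrightarrow>
      LN x (cu x) (lca (CT x (cu x)) (lu x) (?q x)) = LN x (cu x) (lu x)"
      using prefix_hole[OF cu_less[OF xD] hlj[OF x] lu_nodes[OF xD]] u_eq[OF xD]
        numbering_eq[OF numb[OF in_E[OF xD]] lcaV lu_nodes[OF xD]] by metis
    then show "(if LN x (cu x) (lca (CT x (cu x)) (lu x) (?q x)) = LN x (cu x) (lu x) then 1 else 0) =
      of_bool (prefix (u x) (RT x (HL x (cu x) ! j)))" by simp
  qed
  have "ram ?D' (\<lambda>x. inorder_rank (CT x (cu x)) (lu x))"
    using opsD(4)[OF local_ops D'(5) lu'] .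
  then have "ram ?D' (\<lambda>x. if decomp.null_rank (K x) (\<tau> x) (cu x) (HL x (cu x) ! j) <
      inorder_rank (CT x (cu x)) (lu x) then 1 else 0)"
    by (intro ram_if_less one ram_0 ram_hole_fields(4)[OF D'(1,2,3) j D'(4)]) auto
  then show "ram ?D' (\<lambda>x. of_bool (in_less (RT x (HL x (cu x) ! j)) (u x)))"
  proof (rule ram_cong)
    fix x assume x: "x \<in> ?D'"
    interpret decomp "K x" "\<tau> x" using dec_D x by blast
    have xD: "x \<in> D" using x by blast
    show "(if null_rank (cu x) (HL x (cu x) ! j) < inorder_rank (CT x (cu x)) (lu x) then 1 else 0) =
      of_bool (in_less (RT x (HL x (cu x) ! j)) (u x))"
      using in_less_hole[OF cu_less[OF xD] hlj[OF x] lu_nodes[OF xD]] u_eq[OF xD] by simp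
  qed
qed

lemma ram_subtree_size: "ram D (\<lambda>x. subtree_size (\<tau> x) (u x))"
proof -
  let ?S = "\<lambda>x. \<Sum>e\<leftarrow>HL x (cu x). if prefix (u x) (RT x e) then subtree_size (\<tau> x) (RT x e) else 0"
  have eq: "subtree_size (\<tau> x) (u x) = subtree_size (CT x (cu x)) (lu x) + ?S x" if "x \<in> D" for x
    using decomp.subtree_size_cluster[OF dec_D[OF that] cu_less[OF that] lu_nodes[OF that]]
      u_eq[OF that] by simp
  have less: "subtree_size (CT x (cu x)) (lu x) + ?S x < 2 ^ wd x" if "x \<in> D" for x
    using eq[OF that] size_less(1)[OF that] by simp
  have S: "ram D ?S"
    by (rule ram_hole_sizes[OF hole_tests(1)], assumption) (drule less, linarith)
  have "ram D (\<lambda>x. subtree_size (CT x (cu x)) (lu x) + ?S x)"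
    by (intro ram_add S opsD(3)[OF local_ops order_refl lu]) (drule less, linarith)
  then show ?thesis by (rule ram_cong) (simp add: eq)
qed

lemma ram_inorder_rank: "ram D (\<lambda>x. inorder_rank (\<tau> x) (u x))"
proof -
  let ?S = "\<lambda>x. \<Sum>e\<leftarrow>HL x (cu x). if in_less (RT x e) (u x) then subtree_size (\<tau> x) (RT x e) else 0"
  let ?a = "\<lambda>x. FS x (cu x) ! 1" and ?b = "\<lambda>x. inorder_rank (CT x (cu x)) (lu x)"
  have eq: "inorder_rank (\<tau> x) (u x) = ?a x + ?b x + ?S x" if "x \<in> D" for x
    using decomp.inorder_rank_cluster[OF dec_D[OF that] cu_less[OF that] lu_nodes[OF that]]
      u_eq[OF that] by (simp only: FS_simps)
  have less: "?a x + ?b x + ?S x < 2 ^ wd x" if "x \<in> D" for x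
    using eq[OF that] size_less(2)[OF that] by simp
  have S: "ram D ?S"
    by (rule ram_hole_sizes[OF hole_tests(2)], assumption) (drule less, linarith)
  have "ram D (\<lambda>x. ?a x + ?b x + ?S x)"
    by (intro ram_add S ram_fields_const[OF D cu cu_less] opsD(4)[OF local_ops order_refl lu])
      ((simp; fail) | (drule less, linarith))+
  then show ?thesis by (rule ram_cong) (simp only: eq)
qed

lemma ram_preorder_rank: "ram D (\<lambda>x. preorder_rank (\<tau> x) (u x))"
proof -
  let ?Q = "\<lambda>x e. in_less (RT x e) (u x) \<and> \<not> prefix (u x) (RT x e)"
  let ?S = "\<lambda>x. \<Sum>e\<leftarrow>HL x (cu x). if ?Q x e then subtree_size (\<tau> x) (RT x e) else 0"
  let ?a = "\<lambda>x. FS x (cu x) ! 2" and ?b = "\<lambda>x. preorder_rank (CT x (cu x)) (lu x)"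
  have eq: "preorder_rank (\<tau> x) (u x) = ?a x + ?b x + ?S x" if "x \<in> D" for x
    using decomp.preorder_rank_cluster[OF dec_D[OF that] cu_less[OF that] lu_nodes[OF that]]
      u_eq[OF that] by (simp only: FS_simps)
  have less: "?a x + ?b x + ?S x < 2 ^ wd x" if "x \<in> D" for x
    using eq[OF that] size_less(3)[OF that] by simp
  have S: "ram D ?S"
  proof (rule ram_hole_sizes)
    fix j :: nat assume j: "j < 2"
    let ?D' = "{x \<in> D. j < length (HL x (cu x))}"
    have "ram ?D' (\<lambda>x. if of_bool (prefix (u x) (RT x (HL x (cu x) ! j))) = (0::nat)
      then of_bool (in_less (RT x (HL x (cu x) ! j)) (u x)) else 0)"
      by (intro ram_if_eq hole_tests[OF j] ram_mono[OF hole_tests(2)[OF j]] ram_0) auto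
    then show "ram ?D' (\<lambda>x. of_bool (?Q x (HL x (cu x) ! j)))"
      by (rule ram_cong) auto
  qed (drule less, linarith)
  have "ram D (\<lambda>x. ?a x + ?b x + ?S x)"
    by (intro ram_add S ram_fields_const[OF D cu cu_less] opsD(5)[OF local_ops order_refl lu])
      ((simp; fail) | (drule less, linarith))+
  then show ?thesis by (rule ram_cong) (simp only: eq)
qed

end

section \<open>Lowest common ancestors by the sparse table\<close>

lemma ram_sparse:
  assumes "D \<subseteq> E" "ram D c" "ram D k" "\<And>x. x \<in> D \<Longrightarrow> c x + 2 ^ k x < NC x"
  shows "ram D (\<lambda>x. decomp.lcid (K x) (\<tau> x) (c x) (c x + 2 ^ k x))"
proof (rule ram_cong)
  have kL: "k x < L x" if "x \<in> D" for x
  proof -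
    have "2 ^ k x < NC x" using assms(4)[OF that] by linarith
    also have "\<dots> \<le> 2 ^ L x" using L assms(1) that by blast
    finally show ?thesis by simp
  qed
  have nineteen: "ram D (\<lambda>x. 19)"
  proof (rule ram_const)
    fix x assume x: "x \<in> D"
    show "(19::nat) < 2 ^ wd x"
      using kL[OF x] ram_less[OF ram_F, of x] assms(1) x by auto
  qed
  have "ram D (\<lambda>x. 19 + k x)"
    by (rule ram_add[OF nineteen assms(3)])
      (use kL ram_less[OF ram_F] assms(1) in \<open>meson add_less_mono1 less_trans nat_add_left_cancel_less subsetD\<close>)
  then show "ram D (\<lambda>x. FS x (c x) ! (19 + k x))"
    by (rule ram_fields[OF assms(1,2)]) (use assms(4) kL in \<open>auto dest: add_lessD1\<close>)
  fix x assume x: "x \<in> D"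
  show "FS x (c x) ! (19 + k x) = decomp.lcid (K x) (\<tau> x) (c x) (c x + 2 ^ k x)"
  proof -
    have "min (c x + 2 ^ k x) (NC x - 1) = c x + 2 ^ k x" using assms(4)[OF x] by linarith
    then show ?thesis using FS_simps(7)[OF kL[OF x]] by metis
  qed
qed

text \<open>With \<open>k\<close> the logarithm of the distance, rounded down, two intervals of
  length \<open>2 ^ k\<close> starting at one end and ending at the other meet as
  \<open>lcid_interval\<close> requires. The logarithm is no instruction, hence the assumption
  \<open>flog\<close>.\<close>

lemma ram_lcid:
  assumes "D \<subseteq> E" "ram D c" "ram D c'" "\<And>x. x \<in> D \<Longrightarrow> c x < c' x" "\<And>x. x \<in> D \<Longrightarrow> c' x < NC x"
  shows "ram D (\<lambda>x. decomp.lcid (K x) (\<tau> x) (c x) (c' x))"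
proof -
  let ?k = "\<lambda>x. floor_log (c' x - c x)"
  let ?p = "\<lambda>x. 2 ^ ?k x :: nat"
  have dif: "ram D (\<lambda>x. c' x - c x)"
    by (rule ram_diff[OF assms(3,2)]) (use assms(4) less_imp_le in blast)
  have k: "ram D ?k"
    by (rule flog[OF assms(1) dif]) (use assms(4,5) in \<open>auto simp: less_imp_diff_less\<close>)
  have le: "?p x \<le> c' x - c x" if "x \<in> D" for x
    by (rule floor_log_exp2_le) (use assms(4)[OF that] in simp)
  have gt: "c' x - c x < 2 * ?p x" for x by (rule floor_log_exp2_gt)
  have p: "ram D ?p"
  proof (rule ram_cong[OF ram_binop[OF ram_1[OF assms(1)] k, of Shl]])
    fix x assume x: "x \<in> D"
    have "?p x < 2 ^ wd x"
      using le[OF x] assms(5)[OF x] NC_less[of x] assms(1) x by (meson diff_le_self le_trans less_trans le_less_trans subsetD)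
    then show "binop_val (wd x) Shl 1 (?k x) = ?p x" by (simp add: push_bit_eq_mult take_bit_nat_eq_self)
  qed
  have le': "?p x \<le> c' x" "c x + ?p x \<le> c' x" "c x + ?p x < NC x" "c x \<le> c' x - ?p x" "c' x - ?p x \<le> c x + ?p x"
    "c' x - ?p x + ?p x = c' x" if "x \<in> D" for x
    using le[OF that] gt[of x] assms(4,5)[OF that] by linarith+
  have "ram D (\<lambda>x. min (decomp.lcid (K x) (\<tau> x) (c x) (c x + ?p x))
      (decomp.lcid (K x) (\<tau> x) (c' x - ?p x) (c' x - ?p x + ?p x)))"
    using le'(1,3,6) assms(5) by (intro ram_min ram_sparse assms(1,2,3) k ram_diff p) simp_all
  then show ?thesis
  proof (rule ram_cong)
    fix x assume x: "x \<in> D"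
    then interpret decomp "K x" "\<tau> x" using dec assms(1) by blast
    show "min (lcid (c x) (c x + ?p x)) (lcid (c' x - ?p x) (c' x - ?p x + ?p x)) = lcid (c x) (c' x)"
      using lcid_interval[of "c x" "c' x - ?p x" "c x + ?p x" "c' x"] le'[OF x] assms(5)[OF x] by simp
  qed
qed

lemma ram_project:
  assumes D: "D \<subseteq> E" and u: "node_fn D \<tau> CN u" and C: "ram D C" "\<And>x. x \<in> D \<Longrightarrow> C x < NC x"
    "\<And>x. x \<in> D \<Longrightarrow> prefix (RT x (C x)) (RT x (CI x (u x)))"
  shows "node_fn D (\<lambda>x. CT x (C x)) (\<lambda>x. LN x (C x)) (\<lambda>x. LO x (decomp.project (K x) (\<tau> x) (C x) (u x)))"
proof -
  let ?c = "\<lambda>x. CI x (u x)"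
  let ?pr = "\<lambda>x. decomp.project (K x) (\<tau> x) (C x) (u x)"
  have inE: "x \<in> E" if "x \<in> D" for x using D that by blast
  have V: "u x \<in> nodes (\<tau> x)" if "x \<in> D" for x using u that by (simp add: node_fn_def)
  note pr = decomp.project[OF dec[OF inE] V refl C(2,3)]
  note c = decode(1)[OF D u] and l = decode(2)[OF D u]
  have num: "ram D (\<lambda>x. LN x (C x) (LO x (?pr x)))"
  proof (rule ram_split_eq[OF c C(1)])
    have "ram {x \<in> D. ?c x = C x} (\<lambda>x. LN x (?c x) (LO x (u x)))"
      using l by (auto simp: node_fn_def intro: ram_mono)
    then show "ram {x \<in> D. ?c x = C x} (\<lambda>x. LN x (C x) (LO x (?pr x)))"
      by (rule ram_cong) (auto simp: decomp.project_def[OF dec[OF inE]])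
  next
    let ?D = "{x \<in> D. ?c x \<noteq> C x}"
    have D': "?D \<subseteq> E" "ram ?D C" "ram ?D ?c" "\<And>x. x \<in> ?D \<Longrightarrow> C x < NC x"
      using D C(2) by (auto intro: ram_mono[OF C(1)] ram_mono[OF c])
    \<comment> \<open>Field 15 is the cluster number of the second hole; fields 7 and 13 are the
      local handles of the parents of the two holes. For a missing second hole field 15 is the
      number of clusters, so the first hole is chosen.\<close>
    have "ram ?D (\<lambda>x. if ?c x < FS x (C x) ! 15 then FS x (C x) ! 7 else FS x (C x) ! 13)"
      by (intro ram_if_less D'(3) ram_fields_const[OF D'(1,2,4)])
        (auto intro!: ram_mono[OF ram_fields_const[OF D'(1,2,4)]])
    then show "ram ?D (\<lambda>x. LN x (C x) (LO x (?pr x)))"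
    proof (rule ram_cong)
      fix x assume x: "x \<in> ?D"
      then have xD: "x \<in> D" by blast
      interpret decomp "K x" "\<tau> x" using dec inE xD by blast
      have cN: "?c x < N" using cid_less V xD by blast
      have CN: "C x < N" using C(2) xD by blast
      have "strict_prefix (crt (C x)) (crt (?c x))"
        using C(3)[OF xD] root_inj[OF CN cN] x by (auto simp: strict_prefix_def)
      note tw = toward(1)[OF CN cN this]
      have pr: "?pr x = hole_parent (toward (C x) (?c x))" using x by (simp add: project_def)
      show "(if ?c x < FS x (C x) ! 15 then FS x (C x) ! 7 else FS x (C x) ! 13) = LN x (C x) (LO x (?pr x))"
      proof (cases "1 < length (HL x (C x))")
        case True
        then have len: "length (HL x (C x)) = 2" using length_hl[OF CN] by linarith
        then show ?thesis
          using hole_simps(1,3)[of 1 x "C x"] hole_simps(1)[of 0 x "C x"] pr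
          by (auto simp: toward_def)
      next
        case False
        then have "length (HL x (C x)) \<noteq> 2" "0 < length (HL x (C x))" using tw by auto
        then show ?thesis
          using hole_absent(1)[of 1 x "C x"] hole_simps(1)[of 0 x "C x"] pr cN False
          by (auto simp: toward_def)
      qed
    qed
  qed
  moreover have "LO x (?pr x) \<in> nodes (CT x (C x))" if "x \<in> D" for x
    using decomp.loc_nodes[OF dec[OF inE[OF that]] pr(1)[OF that that that that]] pr(2)[OF that that that that]
    by simp
  ultimately show ?thesis by (simp add: node_fn_def)
qed

lemma ram_lca_in_cluster:
  assumes D: "D \<subseteq> E" and C: "ram D C" "\<And>x. x \<in> D \<Longrightarrow> C x < NC x"
    and a: "node_fn D (\<lambda>x. CT x (C x)) (\<lambda>x. LN x (C x)) (\<lambda>x. LO x (a x))"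
    and b: "node_fn D (\<lambda>x. CT x (C x)) (\<lambda>x. LN x (C x)) (\<lambda>x. LO x (b x))"
    and ab: "\<And>x. x \<in> D \<Longrightarrow> a x \<in> nodes (\<tau> x) \<and> b x \<in> nodes (\<tau> x) \<and> CI x (a x) = C x \<and> CI x (b x) = C x"
  shows "ram D (\<lambda>x. CN x (longest_common_prefix (a x) (b x)))"
proof -
  let ?m = "\<lambda>x. lca (CT x (C x)) (LO x (a x)) (LO x (b x))"
  note sc = decomp.lca_same_cluster[OF dec]
  have inE: "x \<in> E" if "x \<in> D" for x using D that by blast
  have "ram D (\<lambda>x. LN x (C x) (?m x))"
    using opsD(6)[OF sub[OF D C] order_refl a b] .
  then have "node_fn D (\<lambda>x. CT x (C x)) (\<lambda>x. LN x (C x)) ?m"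
    unfolding node_fn_def using sc(2) inE ab by blast
  from encode[OF D C this] have "ram D (\<lambda>x. CN x (RT x (C x) @ ?m x))" by (simp add: node_fn_def)
  then show ?thesis by (rule ram_cong) (use sc(1) inE ab in metis)
qed

lemma ram_lca_less:
  assumes D: "D \<subseteq> E" and u: "node_fn D \<tau> CN u" and v: "node_fn D \<tau> CN v"
    and less: "\<And>x. x \<in> D \<Longrightarrow> CI x (u x) < CI x (v x)"
  shows "ram D (\<lambda>x. CN x (longest_common_prefix (u x) (v x)))"
proof -
  let ?C = "\<lambda>x. decomp.lcid (K x) (\<tau> x) (CI x (u x)) (CI x (v x))"
  let ?pr = "\<lambda>x. decomp.project (K x) (\<tau> x) (?C x)"
  have inE: "x \<in> E" if "x \<in> D" for x using D that by blast
  have V: "u x \<in> nodes (\<tau> x)" "v x \<in> nodes (\<tau> x)" if "x \<in> D" for x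
    using u v that by (auto simp: node_fn_def)
  have cv: "CI x (v x) < NC x" if "x \<in> D" for x
    using decomp.cid_less[OF dec] V inE that by blast
  have C: "ram D ?C"
    by (rule ram_lcid[OF D decode(1)[OF D u] decode(1)[OF D v] less cv])
  have lc: "longest_common_prefix (u x) (v x) = longest_common_prefix (?pr x (u x)) (?pr x (v x))"
    "?C x < NC x" "prefix (RT x (?C x)) (RT x (CI x (u x)))" "prefix (RT x (?C x)) (RT x (CI x (v x)))"
    if "x \<in> D" for x
    using decomp.lca_cluster[OF dec[OF inE[OF that]] V[OF that] _ refl] less[OF that] lca_eq[OF V[OF that]]
    by auto
  have "ram D (\<lambda>x. CN x (longest_common_prefix (?pr x (u x)) (?pr x (v x))))"
  proof (rule ram_lca_in_cluster[OF D C lc(2)])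
    show "node_fn D (\<lambda>x. CT x (?C x)) (\<lambda>x. LN x (?C x)) (\<lambda>x. LO x (?pr x (u x)))"
      by (rule ram_project[OF D u C lc(2,3)])
    show "node_fn D (\<lambda>x. CT x (?C x)) (\<lambda>x. LN x (?C x)) (\<lambda>x. LO x (?pr x (v x)))"
      by (rule ram_project[OF D v C lc(2,4)])
    fix x assume x: "x \<in> D"
    show "?pr x (u x) \<in> nodes (\<tau> x) \<and> ?pr x (v x) \<in> nodes (\<tau> x) \<and>
      CI x (?pr x (u x)) = ?C x \<and> CI x (?pr x (v x)) = ?C x"
      using decomp.project[OF dec[OF inE[OF x]] V(1)[OF x] refl lc(2,3)[OF x]]
        decomp.project[OF dec[OF inE[OF x]] V(2)[OF x] refl lc(2,4)[OF x]] by blast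
  qed
  then show ?thesis by (rule ram_cong) (simp add: lc(1))
qed

lemma ram_lca:
  assumes D: "D \<subseteq> E" and u: "node_fn D \<tau> CN u" and v: "node_fn D \<tau> CN v"
  shows "ram D (\<lambda>x. CN x (lca (\<tau> x) (u x) (v x)))"
proof -
  let ?f = "\<lambda>x. CN x (longest_common_prefix (u x) (v x))"
  let ?cu = "\<lambda>x. CI x (u x)" and ?cv = "\<lambda>x. CI x (v x)"
  note cu = decode(1)[OF D u] and cv = decode(1)[OF D v]
  have inE: "x \<in> E" if "x \<in> D" for x using D that by blast
  have V: "u x \<in> nodes (\<tau> x)" "v x \<in> nodes (\<tau> x)" if "x \<in> D" for x
    using u v that by (auto simp: node_fn_def)
  have lt: "ram {x \<in> D. ?cu x < ?cv x} ?f"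
    by (rule ram_lca_less) (use D in \<open>auto intro: node_fn_mono[OF u] node_fn_mono[OF v]\<close>)
  have "ram {x \<in> D. ?cv x < ?cu x} (\<lambda>x. CN x (longest_common_prefix (v x) (u x)))"
    by (rule ram_lca_less) (use D in \<open>auto intro: node_fn_mono[OF u] node_fn_mono[OF v]\<close>)
  then have gt: "ram {x \<in> D. ?cv x < ?cu x} ?f"
    by (rule ram_cong) (simp only: lcp_commute)
  let ?D = "{x \<in> D. ?cu x = ?cv x}"
  have sub': "?D \<subseteq> D" "?D \<subseteq> E" using D by auto
  have lu: "node_fn ?D (\<lambda>x. CT x (?cu x)) (\<lambda>x. LN x (?cu x)) (\<lambda>x. LO x (u x))"
    using node_fn_mono[OF decode(2)[OF D u] sub'(1)] .
  have lv: "node_fn ?D (\<lambda>x. CT x (?cu x)) (\<lambda>x. LN x (?cu x)) (\<lambda>x. LO x (v x))"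
    using node_fn_mono[OF decode(2)[OF D v] sub'(1)] unfolding node_fn_def
    by (auto elim!: ram_cong)
  have eq: "ram ?D ?f"
    by (rule ram_lca_in_cluster[OF sub'(2) ram_mono[OF cu sub'(1)] _ lu lv])
      (use V inE decomp.cid_less[OF dec] in auto)
  have "ram {x \<in> D. \<not> ?cu x < ?cv x} ?f"
  proof (rule ram_split_less)
    show "ram {x \<in> D. \<not> ?cu x < ?cv x} ?cv" "ram {x \<in> D. \<not> ?cu x < ?cv x} ?cu"
      by (auto intro: ram_mono[OF cv] ram_mono[OF cu])
    show "ram {x \<in> {x \<in> D. \<not> ?cu x < ?cv x}. ?cv x < ?cu x} ?f"
      by (rule ram_mono[OF gt]) auto
    show "ram {x \<in> {x \<in> D. \<not> ?cu x < ?cv x}. \<not> ?cv x < ?cu x} ?f"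
      by (rule ram_mono[OF eq]) auto
  qed
  with lt have "ram D ?f" using ram_split_less[OF cu cv] by blast
  then show ?thesis by (rule ram_cong) (use lca_eq V in metis)
qed

text \<open>Used twice, once for each level of clusters: the numbering \<open>CN\<close> of the
  inner use is the numbering \<open>\<nu>\<close> of the outer one.\<close>

theorem ops_lift: "ops E \<tau> CN"
  unfolding ops_def
  by (intro allI impI conjI; rule ram_child ram_parent ram_subtree_size ram_inorder_rank
      ram_preorder_rank ram_lca; assumption)

end

section \<open>Layout of the data\<close>

lemma owner_less:
  assumes "i < psum f N"
  shows "owner f i < N"
proof -
  obtain M where "N = Suc M" using assms by (cases N) auto
  then show ?thesis using assms Least_le[of "\<lambda>c. i < psum f (Suc c)" M]
    unfolding owner_def by (simp del: psum_Suc)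
qed

text \<open>Every entry is a handle, a number of nodes, a cluster number, a direction, a position or
  a location, so one bound on tree size, list length and locations covers them all. It decides the
  width of the fields.\<close>

lemma level_nums_le:
  assumes K: "K \<ge> 1" and t: "t \<noteq> Leaf" and num: "numbering \<nu>"
    and len: "length (level_nums K g L \<nu> lc t) \<le> B" and size: "size t \<le> B"
    and lc: "\<And>c. c < ncl K t \<Longrightarrow> lc c \<le> B" and y: "y \<in> set (level_nums K g L \<nu> lc t)"
  shows "y \<le> B"
proof -
  interpret decomp K t by standard (use K t in auto)
  have cn: "cnum K g \<nu> t v \<le> B" if "v \<in> V" for v
    using cnum_range[OF num that, of g] size by simp
  have card: "card {v \<in> V. P v} \<le> B" for P
  proof -
    have "card {v \<in> V. P v} \<le> card V" by (rule card_mono) auto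
    then show ?thesis using size by (simp add: card_nodes)
  qed
  have cardcl: "card {v \<in> cl K t c. P v} \<le> B" for c P
  proof -
    have "card {v \<in> cl K t c. P v} \<le> card V" by (rule card_mono) (auto dest: cl_nodes)
    then show ?thesis using size by (simp add: card_nodes)
  qed
  have NB: "N \<le> B" using N_le(2) size by linarith
  have B1: "B > 0" using N_le(3) NB by linarith
  have ln: "\<nu> (ctree K t c) u \<le> B" if "c < N" "u \<in> nodes (ctree K t c)" for c u
  proof -
    have "size (ctree K t c) \<le> B"
      unfolding size_ctree using cardcl[of c "\<lambda>_. True"] by simp
    then show ?thesis using numbering_range[OF num that(2)] by linarith
  qed
  have full_le: "full g (csize K t) N * g \<le> B"
    using full_rest[of g "csize K t" N] psum_csize size by linarith
  have holes: "y \<le> B" if "c < N" "j < 2" "y \<in> set (hole_fields K g \<nu> t c j)" for c j y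
  proof (cases "j < length (hl K t c)")
    case True
    let ?e = "hl K t c ! j"
    have e: "?e \<in> set (hl K t c)" using True by simp
    then have eN: "?e < N" and eV: "crt ?e \<in> V" using root_R R_sub by (auto simp: set_hl)
    have "subtree_size t (crt ?e) \<le> B" unfolding subtree_size_card[OF eV] by (rule card)
    then show ?thesis
      using that(3) True ln[OF that(1) hole_parent(4)[OF that(1) e]] eN NB cn[OF eV] B1
        cardcl[of c "\<lambda>v. in_less v (crt ?e)"]
      by (auto simp: hole_fields_def Let_def null_rank_def)
  next
    case False
    have "[] \<in> nodes (ctree K t c)" using ctree_not_Leaf[OF that(1)] by (simp add: Nil_in_nodes)
    then show ?thesis using that(3) False ln[OF that(1)] NB by (auto simp: hole_fields_def)
  qed
  have fields: "y \<le> B" if c: "c < N" and y: "y \<in> set (fields K g L \<nu> lc t c)" for c y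
  proof -
    have "crt c \<in> V" using root_R[OF c] R_sub by blast
    then have "butlast (crt c) \<in> V" by (rule nodes_prefix) (rule prefixeq_butlast)
    then have p: "handle (cnum K g \<nu> t) (parent t (crt c)) \<le> B"
      using cn by (simp add: parent_def)
    have "thr g (csize K t) c \<le> B" using thr_le[OF c, of g "csize K t"] full_le by linarith
    moreover have "base_full g (csize K t) c \<le> B"
    proof -
      have "full g (csize K t) c \<le> full g (csize K t) N"
        unfolding full_def using c by (intro psum_mono) simp
      then have "base_full g (csize K t) c \<le> full g (csize K t) N * g"
        unfolding base_full_def by (rule mult_le_mono1)
      then show ?thesis using full_le by linarith
    qed
    moreover have "base_rest g (csize K t) N c \<le> B"
      using full_rest[of g "csize K t" N] psum_csize size psum_mono[of c N "\<lambda>c. csize K t c mod g"] c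
      unfolding base_rest_def by linarith
    moreover have "lcid c (min (c + 2 ^ k) (N - 1)) \<le> B" for k
      unfolding lcid_def using cid_less[OF lcp_root_V[OF c]] NB by (meson less_imp_le le_trans)
    moreover have "inbase c \<le> B" "prebase c \<le> B" unfolding inbase_def prebase_def by (rule card)+
    ultimately show ?thesis
      using y holes[OF c, of 0] holes[OF c, of 1] lc[OF c] p
      unfolding fields_def by auto
  qed
  have slots: "slot_owner g (csize K t) N i \<le> B" if "i < slots g (csize K t) N" for i
  proof -
    have "slot_owner g (csize K t) N i < N"
      using that unfolding slot_owner_def slots_def full_def
      by (auto intro!: owner_less)
    then show ?thesis using NB by linarith
  qed
  show ?thesis using y fields slots full_le len
    unfolding length_level_nums by (auto simp: level_nums_def)
qed

lemma seg_words:
  assumes "seg w m A (concat (map (bits_of_nat w) ws) @ rest)" "i < length ws" "ws ! i < 2 ^ w"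
    "m (A + i) < 2 ^ w" "w > 0"
  shows "m (A + i) = ws ! i"
proof (rule seg_word[where w = w and m = m and A = "A + i"])
  let ?f = "bits_of_nat w"
  have len: "length (concat (map ?f xs)) = length xs * w" for xs
    by (induction xs) auto
  have "ws = take i ws @ ws ! i # drop (Suc i) ws" using assms(2) by (rule id_take_nth_drop)
  then have "concat (map ?f ws) = concat (map ?f (take i ws)) @ ?f (ws ! i) @ concat (map ?f (drop (Suc i) ws))"
    by (metis concat.simps(2) concat_append list.simps(9) map_append)
  then have *: "seg w m A (concat (map ?f (take i ws)) @ (?f (ws ! i) @ (concat (map ?f (drop (Suc i) ws)) @ rest)))"
    using assms(1) by simp
  show "seg w m (A + i) (?f (ws ! i) @ (concat (map ?f (drop (Suc i) ws)) @ rest))"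
    by (rule seg_append2[OF *]) (use assms(2,5) len in auto)
qed (use assms in auto)

lemma seg_numbers:
  assumes "seg w m A (concat (map (bits_of_nat b) ns) @ rest)" "i < length ns" "ns ! i < 2 ^ b"
  shows "window w m A (i * b) b = ns ! i"
proof -
  let ?f = "bits_of_nat b"
  have len: "length (concat (map ?f xs)) = length xs * b" for xs
    by (induction xs) auto
  have "ns = take i ns @ ns ! i # drop (Suc i) ns" using assms(2) by (rule id_take_nth_drop)
  then have eq: "concat (map ?f ns) = concat (map ?f (take i ns)) @ ?f (ns ! i) @ concat (map ?f (drop (Suc i) ns))"
    by (metis concat.simps(2) concat_append list.simps(9) map_append)
  have "length (concat (map ?f (take i ns))) = i * b" using assms(2) by (simp add: len)
  then have "take b (drop (i * b) (concat (map ?f ns) @ rest)) = ?f (ns ! i)"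
    unfolding eq by simp
  moreover have "i * b + b \<le> length (concat (map ?f ns) @ rest)"
    using mult_le_mono1[of "Suc i" "length ns" b] assms(2) by (simp add: len)
  ultimately show ?thesis using seg_window[OF assms(1)] nat_of_bits_of_nat[OF assms(3)] by simp
qed

lemma seg_concat:
  assumes "seg w m A (concat (map f [0..<N]))" "\<And>c. c < N \<Longrightarrow> length (f c) = h c * w" "w > 0" "c < N"
  shows "seg w m (A + psum h c) (f c)"
  using assms
proof (induction N)
  case (Suc N)
  show ?case
  proof (cases "c = N")
    case True
    have "length (concat (map f [0..<N])) = psum h N * w"
      using Suc.prems(2) by (induction N) (auto simp: add_mult_distrib)
    then show ?thesis using seg_append2[of w m A "concat (map f [0..<N])" "f N"] Suc.prems True by simp
  next
    case False
    then show ?thesis using Suc.IH Suc.prems seg_append1[of w m A "concat (map f [0..<N])" "f N"] by simp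
  qed
qed simp

lemma drop_concat:
  assumes "c < N"
  shows "\<exists>ys. drop (psum (\<lambda>c. length (f c)) c) (concat (map f [0..<N])) = f c @ ys"
  using assms
proof (induction N)
  case (Suc N)
  have len: "length (concat (map f [0..<N])) = psum (\<lambda>c. length (f c)) N" for N
    by (induction N) auto
  show ?case
  proof (cases "c = N")
    case True
    then show ?thesis using len[of N] by simp
  next
    case False
    then obtain ys where "drop (psum (\<lambda>c. length (f c)) c) (concat (map f [0..<N])) = f c @ ys"
      using Suc by auto
    moreover have "psum (\<lambda>c. length (f c)) c \<le> length (concat (map f [0..<N]))"
      unfolding len using Suc.prems False by (intro psum_mono) simp
    ultimately show ?thesis using Suc.prems by simp
  qed
qed simp

text \<open>A code is read without knowing its length: a window of fixed length starts with it, and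
  the bits after it may belong to other data or to none.\<close>

lemma window_prefix:
  assumes "seg w m A bs" "drop p bs = cs @ ys" "length cs \<le> b"
  shows "\<exists>zs. bits_of_nat b (window w m A p b) = cs @ zs"
proof -
  have "take (length cs) (bits_of_nat b (window w m A p b)) = cs"
  proof (rule nth_equalityI)
    fix j assume "j < length (take (length cs) (bits_of_nat b (window w m A p b)))"
    then have j: "j < length cs" by simp
    have "length (drop p bs) = length cs + length ys" using assms(2) by simp
    then have "p + j < length bs" using j by simp
    moreover have "bs ! (p + j) = cs ! j"
      using assms(2) j calculation by (metis nth_append nth_drop less_imp_le add_leD1)
    ultimately show "take (length cs) (bits_of_nat b (window w m A p b)) ! j = cs ! j"
      using j assms(1,3) by (simp add: bits_of_nat_def bit_window seg_def)
  qed (use assms(3) in simp)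
  then show ?thesis by (metis append_take_drop_id)
qed

text \<open>
  All sizes are powers of a parameter \<open>r\<close>, which will be about the eighth root of \<open>log n\<close>. Trees
  of fewer than \<open>2 * r ^ 7\<close> nodes are looked up in tables, by a window of bits starting with their
  code. They are the clusters of trees of fewer than \<open>2 * r ^ 32\<close> nodes, whose data consists of
  \<open>r\<close>-bit numbers and of the codes of their clusters. These trees are in turn the clusters of the
  whole tree, whose data consists of words.
\<close>

definition decode_tree :: "nat \<Rightarrow> nat \<Rightarrow> bintree" where
  "decode_tree b i = (SOME t. \<exists>zs. bits_of_nat b i = tree_code t @ zs)"

lemma decode_tree:
  assumes "bits_of_nat b i = tree_code t @ zs"
  shows "decode_tree b i = t"
  unfolding decode_tree_def
  by (rule some_equality) (use assms tree_code_prefix_free in metis)+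

definition node_of :: "(bintree \<Rightarrow> node \<Rightarrow> nat) \<Rightarrow> bintree \<Rightarrow> nat \<Rightarrow> node" where
  "node_of \<nu> t i = (SOME u. u \<in> nodes t \<and> \<nu> t u = i)"

lemma node_of: "numbering \<nu> \<Longrightarrow> u \<in> nodes t \<Longrightarrow> node_of \<nu> t (\<nu> t u) = u"
  unfolding node_of_def by (rule some_equality) (auto simp: numbering_eq)

definition table_val :: "(bintree \<Rightarrow> node \<Rightarrow> nat) \<Rightarrow> nat \<Rightarrow> bintree \<Rightarrow> node \<Rightarrow> node \<Rightarrow> nat" where
  "table_val \<nu> q t u v =
     [handle (\<nu> t) (child Left t u), handle (\<nu> t) (child Right t u), handle (\<nu> t) (parent t u),
      subtree_size t u, inorder_rank t u, preorder_rank t u, \<nu> t (lca t u v)] ! q"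

text \<open>All bit strings of length \<open>b\<close> have entries, also those that do not begin
  with a code. Such entries are arbitrary and may even exceed a word, but only entries for actual
  trees and nodes are looked up.\<close>

definition table :: "(bintree \<Rightarrow> node \<Rightarrow> nat) \<Rightarrow> nat \<Rightarrow> nat \<Rightarrow> nat list" where
  "table \<nu> b k = concat (map (\<lambda>q. concat (map (\<lambda>i. concat (map (\<lambda>u. map (\<lambda>v.
     let t = decode_tree b i in table_val \<nu> q t (node_of \<nu> t u) (node_of \<nu> t v))
     [0..<k]) [0..<k])) [0..<2 ^ b])) [0..<7])"

lemma length_table: "length (table \<nu> b k) = 7 * (2 ^ b * (k * k))"
  unfolding table_def by (subst length_concat_map length_map)+ (auto simp: length_concat_map)

lemma nth_table:
  assumes "q < 7" "i < 2 ^ b" "u < k" "v < k"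
  shows "q * (2 ^ b * (k * k)) + (i * (k * k) + (u * k + v)) < length (table \<nu> b k)"
    "table \<nu> b k ! (q * (2 ^ b * (k * k)) + (i * (k * k) + (u * k + v))) =
      (let t = decode_tree b i in table_val \<nu> q t (node_of \<nu> t u) (node_of \<nu> t v))"
proof -
  have step: "a * B + c < A * B" if "a < A" "c < B" for a A c B :: nat
  proof -
    have "a * B + c < Suc a * B" using that(2) by simp
    also have "\<dots> \<le> A * B" using that(1) by (intro mult_le_mono1) simp
    finally show ?thesis .
  qed
  have 1: "u * k + v < k * k" using step assms by blast
  have 2: "i * (k * k) + (u * k + v) < 2 ^ b * (k * k)" using step[OF assms(2) 1] .
  show "q * (2 ^ b * (k * k)) + (i * (k * k) + (u * k + v)) < length (table \<nu> b k)"
    unfolding length_table using step[OF assms(1) 2] .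
  show "table \<nu> b k ! (q * (2 ^ b * (k * k)) + (i * (k * k) + (u * k + v))) =
      (let t = decode_tree b i in table_val \<nu> q t (node_of \<nu> t u) (node_of \<nu> t v))"
    unfolding table_def
    apply (subst nth_concat_map[OF _ assms(1) 2])
     apply (simp add: length_concat_map)
    apply (subst nth_concat_map[OF _ assms(2) 1])
     apply (simp add: length_concat_map)
    apply (subst nth_concat_map[OF _ assms(3,4)])
     apply simp
    using assms(4) by simp
qed

definition micro_num :: "bintree \<Rightarrow> node \<Rightarrow> nat" where
  "micro_num = (SOME \<nu>. numbering \<nu>)"

lemma numbering_micro_num: "numbering micro_num"
  unfolding micro_num_def using ex_numbering by (rule someI_ex)

definition mini_num :: "nat \<Rightarrow> bintree \<Rightarrow> node \<Rightarrow> nat" where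
  "mini_num r = cnum (r ^ 7) (r ^ 3) micro_num"

definition mini_len :: "nat \<Rightarrow> bintree \<Rightarrow> nat" where
  "mini_len r t = 2 + ncl (r ^ 7) t * (19 + r) + slots (r ^ 3) (csize (r ^ 7) t) (ncl (r ^ 7) t)"

definition micro_code :: "nat \<Rightarrow> bintree \<Rightarrow> nat \<Rightarrow> bool list" where
  "micro_code r t d = tree_code (ctree (r ^ 7) t d)"

definition micro_off :: "nat \<Rightarrow> bintree \<Rightarrow> nat \<Rightarrow> nat" where
  "micro_off r t d = mini_len r t * r + psum (\<lambda>d. length (micro_code r t d)) d"

definition mini_nums :: "nat \<Rightarrow> bintree \<Rightarrow> nat list" where
  "mini_nums r t = level_nums (r ^ 7) (r ^ 3) r micro_num (micro_off r t) t"

definition mini_bits :: "nat \<Rightarrow> bintree \<Rightarrow> bool list" where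
  "mini_bits r t = concat (map (bits_of_nat r) (mini_nums r t)) @
     concat (map (micro_code r t) [0..<ncl (r ^ 7) t])"

text \<open>The added cell is present even if the bits fill whole words, because reading a window
  also touches the cell after its first one.\<close>

definition mini_words :: "nat \<Rightarrow> nat \<Rightarrow> bintree \<Rightarrow> nat" where
  "mini_words w r t = length (mini_bits r t) div w + 1"

definition mini_block :: "nat \<Rightarrow> nat \<Rightarrow> bintree \<Rightarrow> bool list" where
  "mini_block w r t = mini_bits r t @ replicate (mini_words w r t * w - length (mini_bits r t)) False"

text \<open>The code length of a tree with \<open>2 * r ^ 7 - 1\<close> nodes, the most that a
  cluster of the lower level can have.\<close>

definition window_len :: "nat \<Rightarrow> nat" where
  "window_len r = 4 * r ^ 7 - 1"

definition table_base :: nat where "table_base = 11"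

definition flog_base :: "nat \<Rightarrow> nat" where
  "flog_base r = table_base + 7 * (2 ^ window_len r * (2 * r ^ 7 * (2 * r ^ 7)))"

text \<open>\<open>size t div r ^ 16\<close> is the number of tabulated logarithms. In a large tree
  it exceeds every difference of cluster numbers on both levels and is still negligible.\<close>

definition top_base :: "nat \<Rightarrow> bintree \<Rightarrow> nat" where
  "top_base r t = flog_base r + size t div r ^ 16"

definition mini_base :: "nat \<Rightarrow> nat \<Rightarrow> bintree \<Rightarrow> nat" where
  "mini_base w r t = top_base r t +
     (2 + ncl (r ^ 32) t * (19 + w) + slots (r ^ 16) (csize (r ^ 32) t) (ncl (r ^ 32) t))"

definition mini_addr :: "nat \<Rightarrow> nat \<Rightarrow> bintree \<Rightarrow> nat \<Rightarrow> nat" where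
  "mini_addr w r t c = mini_base w r t + psum (\<lambda>c. mini_words w r (ctree (r ^ 32) t c)) c"

definition top_nums :: "nat \<Rightarrow> nat \<Rightarrow> bintree \<Rightarrow> nat list" where
  "top_nums w r t = level_nums (r ^ 32) (r ^ 16) w (mini_num r) (mini_addr w r t) t"

text \<open>These parameters sit in the first eleven cells, at constant addresses, as a fixed
  program cannot contain quantities that grow with the tree.\<close>

definition header :: "nat \<Rightarrow> nat \<Rightarrow> bintree \<Rightarrow> nat list" where
  "header w r t = [w, r, window_len r, 2 * r ^ 7, 2 ^ window_len r, r ^ 16, 19 + w, r ^ 3, 19 + r,
     flog_base r, top_base r t]"

definition words :: "nat \<Rightarrow> nat \<Rightarrow> bintree \<Rightarrow> nat list" where
  "words w r t = header w r t @ table micro_num (window_len r) (2 * r ^ 7) @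
     map floor_log [0..<size t div r ^ 16] @ top_nums w r t"

definition big_enc :: "nat \<Rightarrow> nat \<Rightarrow> bintree \<Rightarrow> bool list" where
  "big_enc w r t = concat (map (bits_of_nat w) (words w r t)) @
     concat (map (\<lambda>c. mini_block w r (ctree (r ^ 32) t c)) [0..<ncl (r ^ 32) t])"

definition big_num :: "nat \<Rightarrow> bintree \<Rightarrow> node \<Rightarrow> nat" where
  "big_num r = cnum (r ^ 32) (r ^ 16) (mini_num r)"

section \<open>Lengths and positions in the layout\<close>

lemma length_mini_nums: "length (mini_nums r t) = mini_len r t"
  by (simp add: mini_nums_def mini_len_def length_level_nums)

lemma length_concat_bits: "length (concat (map (bits_of_nat b) ns)) = length ns * b"
  by (induction ns) auto

lemma length_concat_psum: "length (concat (map f [0..<N])) = psum (\<lambda>c. length (f c)) N"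
  by (induction N) auto

lemma length_mini_bits:
  "length (mini_bits r t) = mini_len r t * r + psum (\<lambda>d. length (micro_code r t d)) (ncl (r ^ 7) t)"
  by (simp add: mini_bits_def length_concat_bits length_mini_nums length_concat_psum)

lemma length_mini_block:
  assumes "w > 0"
  shows "length (mini_block w r t) = mini_words w r t * w"
proof -
  have "length (mini_bits r t) < mini_words w r t * w"
    using assms dividend_less_div_times[of w "length (mini_bits r t)"] by (simp add: mini_words_def)
  then show ?thesis by (simp add: mini_block_def)
qed

lemma length_top_nums:
  "length (top_nums w r t) =
     2 + ncl (r ^ 32) t * (19 + w) + slots (r ^ 16) (csize (r ^ 32) t) (ncl (r ^ 32) t)"
  by (simp add: top_nums_def length_level_nums)

lemma length_words: "length (words w r t) = mini_base w r t"
  by (simp add: words_def header_def length_table flog_base_def top_base_def mini_base_def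
      table_base_def length_top_nums)

lemma nth_words:
  "i < 11 \<Longrightarrow> words w r t ! i = header w r t ! i"
  "i < length (table micro_num (window_len r) (2 * r ^ 7)) \<Longrightarrow>
    words w r t ! (table_base + i) = table micro_num (window_len r) (2 * r ^ 7) ! i"
  "i < size t div r ^ 16 \<Longrightarrow> words w r t ! (flog_base r + i) = floor_log i"
  "i < length (top_nums w r t) \<Longrightarrow> words w r t ! (top_base r t + i) = top_nums w r t ! i"
proof -
  have h: "length (header w r t) = table_base" by (simp add: header_def table_base_def)
  show "i < 11 \<Longrightarrow> words w r t ! i = header w r t ! i"
    using h by (simp add: words_def nth_append table_base_def)
  show "i < length (table micro_num (window_len r) (2 * r ^ 7)) \<Longrightarrow>
    words w r t ! (table_base + i) = table micro_num (window_len r) (2 * r ^ 7) ! i"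
    using h by (simp add: words_def nth_append)
  show "i < size t div r ^ 16 \<Longrightarrow> words w r t ! (flog_base r + i) = floor_log i"
    using h by (simp add: words_def nth_append flog_base_def length_table)
  show "i < length (top_nums w r t) \<Longrightarrow> words w r t ! (top_base r t + i) = top_nums w r t ! i"
    using h by (simp add: words_def nth_append flog_base_def top_base_def length_table)
qed

lemma length_big_enc:
  assumes "w > 0"
  shows "length (big_enc w r t) = mini_addr w r t (ncl (r ^ 32) t) * w"
proof -
  have "psum (\<lambda>c. length (mini_block w r (ctree (r ^ 32) t c))) N =
    psum (\<lambda>c. mini_words w r (ctree (r ^ 32) t c)) N * w" for N
    by (induction N) (auto simp: length_mini_block[OF assms] add_mult_distrib)
  then show ?thesis
    by (simp add: big_enc_def length_concat_bits length_words length_concat_psum mini_addr_def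
        add_mult_distrib)
qed

section \<open>Operations on the stored data of a large tree\<close>

locale big = machine wd mm ar
  for wd :: "'x \<Rightarrow> nat" and mm :: "'x \<Rightarrow> nat \<Rightarrow> nat" and ar :: "'x \<Rightarrow> nat \<Rightarrow> nat" +
  fixes E :: "'x set" and T :: "'x \<Rightarrow> bintree" and r :: "'x \<Rightarrow> nat"
  assumes T: "x \<in> E \<Longrightarrow> T x \<noteq> Leaf" and r: "x \<in> E \<Longrightarrow> r x \<ge> 1"
    and w: "x \<in> E \<Longrightarrow> 4 * r x ^ 7 < wd x" "x \<in> E \<Longrightarrow> r x < wd x"
    and data: "x \<in> E \<Longrightarrow> seg (wd x) (mm x) 0 (big_enc (wd x) (r x) (T x))"
    and addr: "x \<in> E \<Longrightarrow> mini_addr (wd x) (r x) (T x) (ncl (r x ^ 32) (T x)) + 1 < 2 ^ wd x"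
    and size: "x \<in> E \<Longrightarrow> size (T x) < 2 ^ wd x"
    and mini: "x \<in> E \<Longrightarrow> t \<noteq> Leaf \<Longrightarrow> size t < 2 * r x ^ 32 \<Longrightarrow> length (mini_bits (r x) t) < 2 ^ r x"
    and flog: "x \<in> E \<Longrightarrow> ncl (r x ^ 32) (T x) \<le> size (T x) div r x ^ 16"
      "x \<in> E \<Longrightarrow> 2 * r x ^ 32 \<le> size (T x) div r x ^ 16"
begin

abbreviation "WS x \<equiv> words (wd x) (r x) (T x)"
abbreviation "WL x \<equiv> window_len (r x)"
abbreviation "TB x \<equiv> table micro_num (WL x) (2 * r x ^ 7)"

lemma dec: "x \<in> E \<Longrightarrow> decomp (r x ^ 32) (T x)"
  by standard (use r T in \<open>auto simp: Suc_le_eq\<close>)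

lemma r_pow: "x \<in> E \<Longrightarrow> r x ^ k \<ge> 1"
  using r[of x] by (simp add: Suc_le_eq)

lemma length_WS: "x \<in> E \<Longrightarrow> length (WS x) + 1 < 2 ^ wd x"
  using addr[of x] unfolding length_words mini_addr_def by linarith

lemma ram_word:
  assumes "D \<subseteq> E" "ram D i" "\<And>x. x \<in> D \<Longrightarrow> i x < length (WS x)" "\<And>x. x \<in> D \<Longrightarrow> WS x ! i x < 2 ^ wd x"
  shows "ram D (\<lambda>x. WS x ! i x)"
proof (rule ram_cong[OF ram_load[OF assms(2)]])
  fix x assume x: "x \<in> D"
  have "seg (wd x) (mm x) 0 (concat (map (bits_of_nat (wd x)) (WS x)) @
     concat (map (\<lambda>c. mini_block (wd x) (r x) (ctree (r x ^ 32) (T x) c)) [0..<ncl (r x ^ 32) (T x)]))"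
    using data[of x] x assms(1) by (auto simp: big_enc_def)
  from seg_words[OF this assms(3,4)[OF x]] show "mm x (i x) = WS x ! i x"
    using mm_less w(2)[of x] x assms(1) by auto
qed

lemma base_le:
  "length (WS x) = mini_base (wd x) (r x) (T x)" "table_base = 11"
  "flog_base (r x) = 11 + length (TB x)" "top_base (r x) (T x) = flog_base (r x) + size (T x) div r x ^ 16"
  "length (WS x) = top_base (r x) (T x) + length (top_nums (wd x) (r x) (T x))"
  by (simp_all add: length_words mini_base_def top_base_def flog_base_def length_table length_top_nums
      table_base_def)

lemma header_less:
  assumes "x \<in> E" "y \<in> set (header (wd x) (r x) (T x))"
  shows "y < 2 ^ wd x"
proof -
  have N: "ncl (r x ^ 32) (T x) \<ge> 1" using decomp.N_le(3)[OF dec[OF assms(1)]] by simp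
  have "19 + wd x \<le> ncl (r x ^ 32) (T x) * (19 + wd x)"
    using mult_le_mono1[OF N, of "19 + wd x"] by simp
  then have 1: "19 + wd x \<le> length (WS x)" unfolding base_le(5) length_top_nums by linarith
  have "r x ^ 16 \<le> r x ^ 32" "r x ^ 7 \<le> r x ^ 32" "r x ^ 3 \<le> r x ^ 32"
    using r[OF assms(1)] by (auto intro!: power_increasing)
  then have 2: "r x ^ 16 \<le> length (WS x)" "2 * r x ^ 7 \<le> length (WS x)" "r x ^ 3 \<le> length (WS x)"
    using flog(2)[OF assms(1)] by (auto simp: base_le(4,5))
  have "1 * 1 \<le> r x ^ 7 * r x ^ 7" by (intro mult_le_mono r_pow assms(1))
  then have "2 ^ WL x \<le> length (TB x)" by (simp add: length_table)
  then have 3: "2 ^ WL x \<le> length (WS x)" by (simp add: base_le(3-5))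
  have "WL x < wd x" using w(1)[OF assms(1)] by (simp add: window_len_def)
  then show ?thesis using assms(2) 1 2 3 w(2)[OF assms(1)] length_WS[OF assms(1)]
    by (auto simp: header_def base_le(4,5))
qed

lemma ram_header:
  assumes "D \<subseteq> E" "i < 11"
  shows "ram D (\<lambda>x. header (wd x) (r x) (T x) ! i)"
proof (rule ram_cong)
  have h: "WS x ! i = header (wd x) (r x) (T x) ! i" for x using nth_words(1)[OF assms(2)] .
  have i: "i < length (WS x)" for x using assms(2) by (simp add: base_le(3-5))
  show "ram D (\<lambda>x. WS x ! i)"
  proof (rule ram_word[OF assms(1)])
    show "ram D (\<lambda>_. i)" using i length_WS assms(1) by (intro ram_const) (meson add_lessD1 less_trans subsetD)
    show "WS x ! i < 2 ^ wd x" if "x \<in> D" for x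
      unfolding h by (rule header_less, use that assms in blast, rule nth_mem)
        (use assms in \<open>simp add: header_def\<close>)
  qed (rule i)
qed (rule nth_words(1)[OF assms(2)])

lemma ram_params:
  assumes "D \<subseteq> E"
  shows "ram D wd" "ram D r" "ram D WL" "ram D (\<lambda>x. 2 * r x ^ 7)" "ram D (\<lambda>x. 2 ^ WL x)"
    "ram D (\<lambda>x. r x ^ 16)" "ram D (\<lambda>x. 19 + wd x)" "ram D (\<lambda>x. r x ^ 3)" "ram D (\<lambda>x. 19 + r x)"
    "ram D (\<lambda>x. flog_base (r x))" "ram D (\<lambda>x. top_base (r x) (T x))"
  using ram_header[OF assms, of 0] ram_header[OF assms, of 1] ram_header[OF assms, of 2]
    ram_header[OF assms, of 3] ram_header[OF assms, of 4] ram_header[OF assms, of 5]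
    ram_header[OF assms, of 6] ram_header[OF assms, of 7] ram_header[OF assms, of 8]
    ram_header[OF assms, of 9] ram_header[OF assms, of 10]
  by (simp_all add: header_def)

lemma ram_small_const: "D \<subseteq> E \<Longrightarrow> k \<le> 11 \<Longrightarrow> ram D (\<lambda>x. k)"
  using length_WS base_le(3-5) by (intro ram_const) (metis add_lessD1 le_add1 le_trans less_le_trans not_less subsetD le_less_trans)

lemma ram_flog:
  assumes "D \<subseteq> E" "ram D i" "\<And>x. x \<in> D \<Longrightarrow> i x < size (T x) div r x ^ 16"
  shows "ram D (\<lambda>x. floor_log (i x))"
proof -
  have less: "flog_base (r x) + i x < length (WS x)" if "x \<in> D" for x
    using assms(3)[OF that] by (simp add: base_le(4,5))
  have "ram D (\<lambda>x. WS x ! (flog_base (r x) + i x))"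
  proof (rule ram_word[OF assms(1) _ less])
    show "ram D (\<lambda>x. flog_base (r x) + i x)"
      using less length_WS assms(1)
      by (intro ram_add ram_params(10) assms(1,2)) (meson add_lessD1 less_trans subsetD)
    fix x assume x: "x \<in> D"
    have "floor_log (i x) \<le> i x"
    proof (cases "i x = 0")
      case False
      then show ?thesis using floor_log_exp2_le[of "i x"] less_exp[of "floor_log (i x)"] by linarith
    qed simp
    then show "WS x ! (flog_base (r x) + i x) < 2 ^ wd x"
      using nth_words(3)[OF assms(3)[OF x]] ram_less[OF assms(2) x] by simp
  qed
  then show ?thesis by (rule ram_cong) (use nth_words(3) assms(3) in metis)
qed

lemma ram_table:
  assumes "D \<subseteq> E" "ram D i" "\<And>x. x \<in> D \<Longrightarrow> i x < 2 ^ WL x" "ram D u" "\<And>x. x \<in> D \<Longrightarrow> u x < 2 * r x ^ 7"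
    "ram D v" "\<And>x. x \<in> D \<Longrightarrow> v x < 2 * r x ^ 7" "q < 7"
    "\<And>x. x \<in> D \<Longrightarrow> f x < 2 ^ wd x"
    "\<And>x. x \<in> D \<Longrightarrow> f x = (let t = decode_tree (WL x) (i x) in
      table_val micro_num q t (node_of micro_num t (u x)) (node_of micro_num t (v x)))"
  shows "ram D f"
proof -
  let ?k = "\<lambda>x. 2 * r x ^ 7"
  let ?j = "\<lambda>x. q * (2 ^ WL x * (?k x * ?k x)) + (i x * (?k x * ?k x) + (u x * ?k x + v x))"
  note nt = nth_table[where \<nu> = micro_num, OF assms(8,3,5,7)]
  have less: "11 + ?j x < length (WS x)" if "x \<in> D" for x
    using nt(1)[OF that that that] by (simp add: base_le(3-5))
  have less': "11 + ?j x < 2 ^ wd x" if "x \<in> D" for x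
    using less[OF that] length_WS[of x] assms(1) that by force
  have kk: "?k x * ?k x < 2 ^ wd x" "2 ^ WL x * (?k x * ?k x) < 2 ^ wd x" if "x \<in> D" for x
  proof -
    have "7 * (2 ^ WL x * (?k x * ?k x)) < 2 ^ wd x"
      using length_WS[of x] assms(1) that by (force simp: base_le(3-5) length_table)
    moreover have "1 * (?k x * ?k x) \<le> 2 ^ WL x * (?k x * ?k x)" by (rule mult_le_mono1) simp
    ultimately show "?k x * ?k x < 2 ^ wd x" "2 ^ WL x * (?k x * ?k x) < 2 ^ wd x" by linarith+
  qed
  have gen: "ram D (\<lambda>x. 11 + (q * (B x * (k x * k x)) + (i x * (k x * k x) + (u x * k x + v x))))"
    if "ram D B" "ram D k" "\<And>x. x \<in> D \<Longrightarrow> k x * k x < 2 ^ wd x" "\<And>x. x \<in> D \<Longrightarrow> B x * (k x * k x) < 2 ^ wd x"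
      "\<And>x. x \<in> D \<Longrightarrow> 11 + (q * (B x * (k x * k x)) + (i x * (k x * k x) + (u x * k x + v x))) < 2 ^ wd x"
    for B k
    using assms(8)
    by (intro ram_add ram_mult that(1,2) ram_small_const assms(1,2,4,6))
      ((simp; fail) | (drule that(3), linarith) | (drule that(4), linarith) | (drule that(5), linarith))+
  have "ram D (\<lambda>x. 11 + ?j x)"
    using gen[OF ram_params(5)[OF assms(1)] ram_params(4)[OF assms(1)] kk less'] .
  moreover have eq: "WS x ! (11 + ?j x) = f x" if "x \<in> D" for x
    using nth_words(2)[OF nt(1)[OF that that that], where w = "wd x" and t = "T x"]
    unfolding table_base_def nt(2)[OF that that that] assms(10)[OF that] .
  ultimately have "ram D (\<lambda>x. WS x ! (11 + ?j x))"
    using ram_word[OF assms(1) _ less] assms(9) by simp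
  then show ?thesis by (rule ram_cong) (rule eq)
qed

text \<open>The window \<open>i x\<close> starts with the code of the tree and so serves as the
  index of the tree in the table; handles are at most the size of the tree and serve as indices of
  its nodes.\<close>

lemma ops_micro:
  assumes D: "D \<subseteq> E" and i: "ram D i" "\<And>x. x \<in> D \<Longrightarrow> i x < 2 ^ WL x"
    and \<sigma>: "\<And>x. x \<in> D \<Longrightarrow> size (\<sigma> x) < 2 * r x ^ 7"
      "\<And>x. x \<in> D \<Longrightarrow> \<exists>zs. bits_of_nat (WL x) (i x) = tree_code (\<sigma> x) @ zs"
  shows "ops D \<sigma> (\<lambda>x. micro_num (\<sigma> x))"
proof -
  let ?\<nu> = "\<lambda>x. micro_num (\<sigma> x)"
  have main: "ram D' (\<lambda>x. table_val micro_num q (\<sigma> x) (u x) (v x))"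
    if D': "D' \<subseteq> D" and u: "node_fn D' \<sigma> ?\<nu> u" and v: "node_fn D' \<sigma> ?\<nu> v" and q: "q < 7" for D' u v q
  proof (rule ram_table[OF _ ram_mono[OF i(1) D'] _ _ _ _ _ q])
    show "D' \<subseteq> E" using D D' by blast
    show "ram D' (\<lambda>x. ?\<nu> x (u x))" "ram D' (\<lambda>x. ?\<nu> x (v x))" using u v by (auto simp: node_fn_def)
    fix x assume x: "x \<in> D'"
    then have xD: "x \<in> D" "x \<in> E" using D D' by auto
    have uv: "u x \<in> nodes (\<sigma> x)" "v x \<in> nodes (\<sigma> x)" using u v x by (auto simp: node_fn_def)
    have num: "n \<in> nodes (\<sigma> x) \<Longrightarrow> ?\<nu> x n < 2 * r x ^ 7" for n
      using numbering_range[OF numbering_micro_num, of n "\<sigma> x"] \<sigma>(1)[OF xD(1)] by linarith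
    show "i x < 2 ^ WL x" using i(2) xD by blast
    show "?\<nu> x (u x) < 2 * r x ^ 7" "?\<nu> x (v x) < 2 * r x ^ 7" using num uv by auto
    have "decode_tree (WL x) (i x) = \<sigma> x" using \<sigma>(2)[OF xD(1)] decode_tree by metis
    then show "table_val micro_num q (\<sigma> x) (u x) (v x) =
      (let t = decode_tree (WL x) (i x) in
        table_val micro_num q t (node_of micro_num t (?\<nu> x (u x))) (node_of micro_num t (?\<nu> x (v x))))"
      using uv by (simp add: node_of[OF numbering_micro_num])
    have k: "2 * r x ^ 7 < 2 ^ wd x" using ram_less[OF ram_params(4)[OF order_refl] xD(2)] .
    have card: "card {n \<in> nodes (\<sigma> x). P n} < 2 * r x ^ 7" for P
    proof -
      have "card {n \<in> nodes (\<sigma> x). P n} \<le> card (nodes (\<sigma> x))" by (rule card_mono) auto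
      then show ?thesis using \<sigma>(1)[OF xD(1)] by (simp add: card_nodes)
    qed
    have "butlast (u x) \<in> nodes (\<sigma> x)" using uv(1) by (rule nodes_prefix) (rule prefixeq_butlast)
    moreover have "lca (\<sigma> x) (u x) (v x) \<in> nodes (\<sigma> x)"
      unfolding lca_eq[OF uv] using uv(1) by (rule nodes_prefix) (rule longest_common_prefix_prefix1)
    ultimately have "\<forall>y \<in> set [handle (?\<nu> x) (child Left (\<sigma> x) (u x)), handle (?\<nu> x) (child Right (\<sigma> x) (u x)),
        handle (?\<nu> x) (parent (\<sigma> x) (u x)), subtree_size (\<sigma> x) (u x), inorder_rank (\<sigma> x) (u x),
        preorder_rank (\<sigma> x) (u x), ?\<nu> x (lca (\<sigma> x) (u x) (v x))]. y \<le> 2 * r x ^ 7"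
      using num card[of "prefix (u x)"] card[of "\<lambda>n. in_less n (u x)"] card[of "\<lambda>n. pre_less n (u x)"]
      by (auto simp: child_def parent_def subtree_size_card[OF uv(1)]
          inorder_rank_card[OF uv(1)] preorder_rank_card[OF uv(1)] less_imp_le Suc_leI)
    then have "table_val micro_num q (\<sigma> x) (u x) (v x) \<le> 2 * r x ^ 7"
      unfolding table_val_def by (rule bspec, intro nth_mem) (use q in simp)
    then show "table_val micro_num q (\<sigma> x) (u x) (v x) < 2 ^ wd x" using k by linarith
  qed
  show ?thesis
    unfolding ops_def
  proof (intro allI impI conjI)
    fix D' u d assume D': "D' \<subseteq> D" and u: "node_fn D' \<sigma> ?\<nu> u"
    note m = main[OF D' u u]
    show "ram D' (\<lambda>x. handle (?\<nu> x) (child d (\<sigma> x) (u x)))"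
      using m[of 0] m[of 1] by (cases d) (simp_all add: table_val_def)
    show "ram D' (\<lambda>x. handle (?\<nu> x) (parent (\<sigma> x) (u x)))"
      using m[of 2] by (simp add: table_val_def)
    show "ram D' (\<lambda>x. subtree_size (\<sigma> x) (u x))"
      using m[of 3] by (simp add: table_val_def)
    show "ram D' (\<lambda>x. inorder_rank (\<sigma> x) (u x))"
      using m[of 4] by (simp add: table_val_def)
    show "ram D' (\<lambda>x. preorder_rank (\<sigma> x) (u x))"
      using m[of 5] by (simp add: table_val_def)
    fix v assume "node_fn D' \<sigma> ?\<nu> v"
    from main[OF D' u this, of 6] show "ram D' (\<lambda>x. ?\<nu> x (lca (\<sigma> x) (u x) (v x)))"
      by (simp add: table_val_def)
  qed
qed

lemma mini_size_le:
  assumes "t \<noteq> Leaf" "r' \<ge> 1"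
  shows "size t \<le> length (mini_bits r' t)" "mini_len r' t \<le> length (mini_bits r' t)"
    "\<And>d. d \<le> ncl (r' ^ 7) t \<Longrightarrow> micro_off r' t d \<le> length (mini_bits r' t)"
proof -
  interpret decomp "r' ^ 7" t by standard (use assms in \<open>auto simp: Suc_le_eq\<close>)
  have "psum (csize (r' ^ 7) t) N \<le> psum (\<lambda>d. length (micro_code r' t d)) N"
    unfolding psum_def by (rule sum_mono) (simp add: micro_code_def csize_def)
  then show "size t \<le> length (mini_bits r' t)"
    unfolding length_mini_bits psum_csize by linarith
  show "mini_len r' t \<le> length (mini_bits r' t)"
    using mult_le_mono2[OF assms(2), of "mini_len r' t"] unfolding length_mini_bits by linarith
  show "micro_off r' t d \<le> length (mini_bits r' t)" if "d \<le> N" for d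
    unfolding length_mini_bits micro_off_def using psum_mono[OF that] by simp
qed

text \<open>The lower level: numbers are windows of \<open>r x\<close> bits in the data at address
  \<open>A x\<close>, and the codes of the clusters are found by bit offsets that are themselves
  fields of the rows.\<close>

lemma ops_mini:
  assumes D: "D \<subseteq> E" and A: "ram D A" and \<tau>: "\<And>x. x \<in> D \<Longrightarrow> \<tau> x \<noteq> Leaf"
      "\<And>x. x \<in> D \<Longrightarrow> size (\<tau> x) < 2 * r x ^ 32"
    and seg: "\<And>x. x \<in> D \<Longrightarrow> seg (wd x) (mm x) (A x) (mini_bits (r x) (\<tau> x))"
    and Aw: "\<And>x. x \<in> D \<Longrightarrow> A x + mini_words (wd x) (r x) (\<tau> x) < 2 ^ wd x"
  shows "ops D \<tau> (\<lambda>x. mini_num (r x) (\<tau> x))"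
proof -
  let ?bits = "\<lambda>x. mini_bits (r x) (\<tau> x)"
  have inE: "x \<in> E" if "x \<in> D" for x using D that by blast
  have B: "length (?bits x) < 2 ^ r x" if "x \<in> D" for x using mini inE \<tau> that by blast
  have rw: "(2::nat) ^ r x < 2 ^ wd x" if "x \<in> D" for x using w(2) inE that by simp
  note ms = mini_size_le[OF \<tau>(1) r[OF inE]]
  have dec': "decomp (r x ^ 7) (\<tau> x)" if "x \<in> D" for x
    by standard (use \<tau>(1) r_pow inE that in auto)
  have N: "ncl (r x ^ 7) (\<tau> x) \<le> size (\<tau> x)" if "x \<in> D" for x
    using decomp.N_le(2)[OF dec'[OF that]] .
  have in_range: "A x + p div wd x + 1 < 2 ^ wd x" if "x \<in> D" "p \<le> length (?bits x)" for x p
    using Aw[OF that(1)] div_le_mono[OF that(2), of "wd x"] by (simp add: mini_words_def)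
  have nums: "mini_nums (r x) (\<tau> x) ! i < 2 ^ r x" if x: "x \<in> D" and i: "i < length (mini_nums (r x) (\<tau> x))" for x i
  proof -
    have "mini_nums (r x) (\<tau> x) ! i \<le> length (?bits x)"
    proof (rule level_nums_le[OF r_pow[OF inE[OF x]] \<tau>(1)[OF x] numbering_micro_num _ ms(1)[OF x x]])
      show "mini_nums (r x) (\<tau> x) ! i \<in> set (level_nums (r x ^ 7) (r x ^ 3) (r x) micro_num (micro_off (r x) (\<tau> x)) (\<tau> x))"
        using i unfolding mini_nums_def by simp
      show "length (level_nums (r x ^ 7) (r x ^ 3) (r x) micro_num (micro_off (r x) (\<tau> x)) (\<tau> x)) \<le> length (?bits x)"
        using ms(2)[OF x x] by (simp add: mini_nums_def[symmetric] length_mini_nums)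
      show "\<And>c. c < ncl (r x ^ 7) (\<tau> x) \<Longrightarrow> micro_off (r x) (\<tau> x) c \<le> length (?bits x)"
        using ms(3)[OF x x] by simp
    qed
    then show ?thesis using B[OF x] by linarith
  qed
  have acc: "ram D' (\<lambda>x. mini_nums (r x) (\<tau> x) ! i x)"
    if D': "D' \<subseteq> D" and i: "ram D' i" "\<And>x. x \<in> D' \<Longrightarrow> i x < length (mini_nums (r x) (\<tau> x))" for D' i
  proof (rule ram_cong)
    have D'E: "D' \<subseteq> E" and xD: "x \<in> D' \<Longrightarrow> x \<in> D" for x using D D' by auto
    have le: "i x * r x \<le> length (?bits x)" if "x \<in> D'" for x
      using mult_le_mono1[OF less_imp_le[OF i(2)[OF that]], of "r x"]
      unfolding length_mini_bits length_mini_nums by linarith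
    show "ram D' (\<lambda>x. window (wd x) (mm x) (A x) (i x * r x) (r x))"
    proof (intro ram_window ram_mult ram_params[OF D'E] i(1) ram_mono[OF A D'])
      fix x assume x: "x \<in> D'"
      show "i x * r x < 2 ^ wd x" using le[OF x] B[OF xD[OF x]] rw[OF xD[OF x]] by linarith
      show "r x < wd x" using w(2) D'E x by blast
      show "A x + i x * r x div wd x + 1 < 2 ^ wd x" by (rule in_range[OF xD[OF x] le[OF x]])
    qed
    fix x assume x: "x \<in> D'"
    show "window (wd x) (mm x) (A x) (i x * r x) (r x) = mini_nums (r x) (\<tau> x) ! i x"
      by (rule seg_numbers[OF seg[OF xD[OF x], unfolded mini_bits_def] i(2)[OF x] nums[OF xD[OF x] i(2)[OF x]]])
  qed
  interpret L: level_data wd mm ar D \<tau> "\<lambda>x. r x ^ 7" "\<lambda>x. r x ^ 3" r "\<lambda>x. micro_num" "\<lambda>x. micro_off (r x) (\<tau> x)"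
  proof (unfold_locales, goal_cases)
    case (7 x)
    then show ?case using ms(2)[OF 7 7] B[OF 7] rw[OF 7]
      unfolding mini_nums_def[symmetric] length_mini_nums by linarith
  next
    case (8 x)
    then show ?case using ms(1)[OF 8 8] B[OF 8] rw[OF 8] by linarith
  next
    case (9 x)
    then show ?case using ms(1)[OF 9 9] B[OF 9] N[OF 9] by linarith
  qed (use \<tau> r_pow inE numbering_micro_num ram_params[OF D] acc in \<open>auto simp: mini_nums_def[symmetric] length_mini_nums\<close>)
  have sub: "ops D' (\<lambda>x. ctree (r x ^ 7) (\<tau> x) (c x)) (\<lambda>x. micro_num (ctree (r x ^ 7) (\<tau> x) (c x)))"
    if D': "D' \<subseteq> D" and c: "ram D' c" "\<And>x. x \<in> D' \<Longrightarrow> c x < ncl (r x ^ 7) (\<tau> x)" for D' c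
  proof (rule ops_micro)
    show D'E: "D' \<subseteq> E" using D D' by blast
    have xD: "x \<in> D" "x \<in> E" if "x \<in> D'" for x using D' D that by auto
    let ?off = "\<lambda>x. micro_off (r x) (\<tau> x) (c x)"
    let ?i = "\<lambda>x. window (wd x) (mm x) (A x) (?off x) (WL x)"
    have off: "?off x \<le> length (?bits x)" if "x \<in> D'" for x
      using ms(3)[OF xD(1)[OF that] xD(1)[OF that]] c(2)[OF that] by simp
    show "ram D' ?i"
    proof (intro ram_window ram_params[OF D'E] L.ram_lc[OF D' c] ram_mono[OF A D'])
      fix x assume x: "x \<in> D'"
      show "WL x < wd x" using w(1)[OF xD(2)[OF x]] by (simp add: window_len_def)
      show "A x + ?off x div wd x + 1 < 2 ^ wd x" by (rule in_range[OF xD(1)[OF x] off[OF x]])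
    qed
    fix x assume x: "x \<in> D'"
    show "?i x < 2 ^ WL x" by (rule window_less)
    show small: "size (ctree (r x ^ 7) (\<tau> x) (c x)) < 2 * r x ^ 7"
      using decomp.size_ctree_less[OF dec'[OF xD(1)[OF x]] c(2)[OF x]] .
    let ?nums = "concat (map (bits_of_nat (r x)) (mini_nums (r x) (\<tau> x)))"
    have "length ?nums = mini_len (r x) (\<tau> x) * r x"
      by (simp add: length_concat_bits length_mini_nums)
    then have "drop (?off x) (?bits x) = drop (psum (\<lambda>d. length (micro_code (r x) (\<tau> x) d)) (c x))
      (concat (map (micro_code (r x) (\<tau> x)) [0..<ncl (r x ^ 7) (\<tau> x)]))"
      by (simp add: mini_bits_def micro_off_def)
    then obtain ys where "drop (?off x) (?bits x) = tree_code (ctree (r x ^ 7) (\<tau> x) (c x)) @ ys"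
      using drop_concat[OF c(2)[OF x], of "micro_code (r x) (\<tau> x)"] by (auto simp: micro_code_def)
    moreover have "length (tree_code (ctree (r x ^ 7) (\<tau> x) (c x))) \<le> WL x"
      using small by (simp add: window_len_def)
    ultimately show "\<exists>zs. bits_of_nat (WL x) (?i x) = tree_code (ctree (r x ^ 7) (\<tau> x) (c x)) @ zs"
      by (rule window_prefix[OF seg[OF xD(1)[OF x]]])
  qed
  interpret L: lift wd mm ar D \<tau> "\<lambda>x. r x ^ 7" "\<lambda>x. r x ^ 3" r "\<lambda>x. micro_num" "\<lambda>x. micro_off (r x) (\<tau> x)"
  proof (unfold_locales, goal_cases)
    case (1 D' i)
    show ?case
    proof (rule ram_flog[OF _ 1(2)])
      show "D' \<subseteq> E" using D 1(1) by blast
      fix x assume x: "x \<in> D'"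
      then have xD: "x \<in> D" using 1(1) by blast
      show "i x < size (T x) div r x ^ 16"
        using 1(3)[OF x] N[OF xD] \<tau>(2)[OF xD] flog(2)[OF inE[OF xD]] by linarith
    qed
  next
    case (2 D' c)
    then show ?case by (rule sub)
  qed
  show ?thesis using L.ops_lift unfolding mini_num_def .
qed

text \<open>The upper level differs in storage only: numbers are whole cells, and the data of each
  cluster starts at a cell boundary, so that \<open>lc\<close> can be an address.\<close>

lemma ops_big: "ops E T (\<lambda>x. big_num (r x) (T x))"
proof -
  let ?K = "\<lambda>x. r x ^ 32"
  let ?N = "\<lambda>x. ncl (?K x) (T x)"
  let ?addr = "\<lambda>x. mini_addr (wd x) (r x) (T x)"
  have numb: "numbering (mini_num (r x))" if "x \<in> E" for x
    unfolding mini_num_def by (rule numbering_cnum[OF r_pow[OF that] numbering_micro_num])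
  have addr_mono: "?addr x c \<le> ?addr x d" if "c \<le> d" for x c d
    unfolding mini_addr_def using psum_mono[OF that] by simp
  have len: "length (top_nums (wd x) (r x) (T x)) \<le> length (WS x)" for x by (simp add: base_le(5))
  have top: "top_base (r x) (T x) + i < length (WS x)" if "i < length (top_nums (wd x) (r x) (T x))" for x i
    using that by (simp add: base_le(5))
  have nums: "top_nums (wd x) (r x) (T x) ! i < 2 ^ wd x"
    if x: "x \<in> E" and i: "i < length (top_nums (wd x) (r x) (T x))" for x i
  proof -
    have "top_nums (wd x) (r x) (T x) ! i \<le> 2 ^ wd x - 1"
    proof (rule level_nums_le[OF r_pow[OF x] T[OF x] numb[OF x]])
      show "top_nums (wd x) (r x) (T x) ! i \<in> set (level_nums (?K x) (r x ^ 16) (wd x) (mini_num (r x)) (?addr x) (T x))"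
        using i unfolding top_nums_def by simp
      show "length (level_nums (?K x) (r x ^ 16) (wd x) (mini_num (r x)) (?addr x) (T x)) \<le> 2 ^ wd x - 1"
        using len[of x] length_WS[OF x] unfolding top_nums_def by linarith
      show "size (T x) \<le> 2 ^ wd x - 1" using size[OF x] by linarith
      show "?addr x c \<le> 2 ^ wd x - 1" if "c < ?N x" for c
        using addr_mono[of c "?N x" x] addr[OF x] that by simp
    qed
    then show ?thesis by (rule le_less_trans) simp
  qed
  have acc: "ram D (\<lambda>x. top_nums (wd x) (r x) (T x) ! i x)"
    if D: "D \<subseteq> E" and i: "ram D i" "\<And>x. x \<in> D \<Longrightarrow> i x < length (top_nums (wd x) (r x) (T x))" for D i
  proof (rule ram_cong)
    have "ram D (\<lambda>x. top_base (r x) (T x) + i x)"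
    proof (intro ram_add ram_params(11)[OF D] i(1))
      fix x assume x: "x \<in> D"
      show "top_base (r x) (T x) + i x < 2 ^ wd x"
        using top[OF i(2)[OF x]] length_WS[of x] x D by force
    qed
    then show "ram D (\<lambda>x. WS x ! (top_base (r x) (T x) + i x))"
      by (rule ram_word[OF D]) (use top i(2) nums D nth_words(4)[OF i(2)] in auto)
    show "WS x ! (top_base (r x) (T x) + i x) = top_nums (wd x) (r x) (T x) ! i x" if "x \<in> D" for x
      by (rule nth_words(4)[OF i(2)[OF that]])
  qed
  have N: "?N x \<le> 2 ^ wd x" if "x \<in> E" for x
    using decomp.N_le(2)[OF dec[OF that]] size[OF that] by linarith
  have bound: "length (top_nums (wd x) (r x) (T x)) < 2 ^ wd x" if "x \<in> E" for x
    using len[of x] length_WS[OF that] by linarith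
  interpret L: level_data wd mm ar E T ?K "\<lambda>x. r x ^ 16" wd "\<lambda>x. mini_num (r x)" ?addr
    by unfold_locales
      (use T r_pow numb ram_params[OF order_refl] bound size N acc in \<open>auto simp: top_nums_def[symmetric]\<close>)
  interpret L: lift wd mm ar E T ?K "\<lambda>x. r x ^ 16" wd "\<lambda>x. mini_num (r x)" ?addr
  proof (unfold_locales, goal_cases)
    case (1 D i)
    show ?case by (rule ram_flog[OF 1(1,2)]) (use 1(1,3) flog(1) less_le_trans in blast)
  next
    case (2 D c)
    have inE: "x \<in> E" if "x \<in> D" for x using 2(1) that by blast
    show ?case
    proof (rule ops_mini[OF 2(1) L.ram_lc[OF 2]])
      fix x assume x: "x \<in> D"
      let ?t = "ctree (?K x) (T x) (c x)"
      show "?t \<noteq> Leaf" using decomp.ctree_not_Leaf[OF dec[OF inE[OF x]] 2(3)[OF x]] .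
      show "size ?t < 2 * r x ^ 32" using decomp.size_ctree_less[OF dec[OF inE[OF x]] 2(3)[OF x]] .
      have w0: "wd x > 0" using w(2)[OF inE[OF x]] by linarith
      have "seg (wd x) (mm x) (0 + length (WS x))
        (concat (map (\<lambda>c. mini_block (wd x) (r x) (ctree (?K x) (T x) c)) [0..<?N x]))"
        by (rule seg_append2[OF data[OF inE[OF x], unfolded big_enc_def] _ w0]) (rule length_concat_bits)
      from seg_concat[OF this length_mini_block[OF w0] w0 2(3)[OF x]]
      have "seg (wd x) (mm x) (?addr x (c x)) (mini_block (wd x) (r x) ?t)"
        by (simp add: mini_addr_def length_words)
      then show "seg (wd x) (mm x) (?addr x (c x)) (mini_bits (r x) ?t)"
        unfolding mini_block_def by (rule seg_append1)
      have "?addr x (c x) + mini_words (wd x) (r x) ?t = ?addr x (Suc (c x))" by (simp add: mini_addr_def)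
      also have "\<dots> \<le> ?addr x (?N x)" using 2(3)[OF x] by (intro addr_mono) simp
      also have "\<dots> < 2 ^ wd x" using addr[OF inE[OF x]] by linarith
      finally show "?addr x (c x) + mini_words (wd x) (r x) ?t < 2 ^ wd x" .
    qed
  qed
  show ?thesis using L.ops_lift unfolding big_num_def .
qed

end

section \<open>Size of the data\<close>

lemma mini_len_facts:
  assumes "r \<ge> 1" "t \<noteq> Leaf"
  shows "r ^ 7 * ncl (r ^ 7) t \<le> 2 * size t + r ^ 7" "ncl (r ^ 7) t \<le> size t"
    "length (mini_bits r t) = mini_len r t * r + (2 * size t + ncl (r ^ 7) t)"
    "slots (r ^ 3) (csize (r ^ 7) t) (ncl (r ^ 7) t) \<le> size t"
    "r ^ 3 * slots (r ^ 3) (csize (r ^ 7) t) (ncl (r ^ 7) t) \<le> size t + ncl (r ^ 7) t * r ^ 3 * r ^ 3"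
proof -
  interpret decomp "r ^ 7" t by standard (use assms in \<open>auto simp: Suc_le_eq\<close>)
  show "r ^ 7 * N \<le> 2 * size t + r ^ 7" "N \<le> size t" by (fact N_le)+
  have "psum (\<lambda>d. length (micro_code r t d)) M = 2 * psum (csize (r ^ 7) t) M + M" for M
    by (induction M) (auto simp: micro_code_def csize_def)
  then show "length (mini_bits r t) = mini_len r t * r + (2 * size t + N)"
    by (simp add: length_mini_bits psum_csize)
  have "1 \<le> r ^ 3" using assms(1) by (simp add: Suc_le_eq)
  from mult_le_mono2[OF this, of "full (r ^ 3) (csize (r ^ 7) t) N"]
  show "slots (r ^ 3) (csize (r ^ 7) t) N \<le> size t"
    using full_rest[of "r ^ 3" "csize (r ^ 7) t" N] psum_csize unfolding slots_def by linarith
  show "r ^ 3 * slots (r ^ 3) (csize (r ^ 7) t) N \<le> size t + N * r ^ 3 * r ^ 3"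
    using slots_le[OF \<open>1 \<le> r ^ 3\<close>, of "csize (r ^ 7) t" N] psum_csize by simp
qed

text \<open>Offsets into the data are themselves numbers of \<open>r\<close> bits, so its total
  length has to be below \<open>2 ^ r\<close>. The bound of \<open>r ^ 32\<close> for the nodes
  times \<open>r ^ 8\<close> for the remaining factors is the origin of
  \<open>r ^ 40\<close>.\<close>

lemma length_mini_bits_less:
  assumes r: "r \<ge> 20" "r ^ 40 \<le> 2 ^ r" and t: "t \<noteq> Leaf" "size t < 2 * r ^ 32"
  shows "length (mini_bits r t) < 2 ^ r"
proof -
  let ?s = "size t" and ?N = "ncl (r ^ 7) t"
  have "r \<ge> 1" using r by simp
  note f = mini_len_facts[OF this t(1)]
  have s1: "1 \<le> ?s" using t(1) by (cases t) auto
  have "mini_len r t \<le> 2 + ?s * (19 + r) + ?s"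
    unfolding mini_len_def using f(4) mult_le_mono1[OF f(2), of "19 + r"] by linarith
  also have "\<dots> \<le> ?s * (2 + (19 + r) + 1)"
    using s1 by (simp add: algebra_simps)
  also have "\<dots> \<le> ?s * (3 * r)" using r by (intro mult_le_mono2) simp
  finally have "mini_len r t * r \<le> ?s * (3 * r) * r" by (rule mult_le_mono1)
  then have "length (mini_bits r t) \<le> ?s * (3 * r) * r + 3 * ?s"
    unfolding f(3) using f(2) by linarith
  also have "\<dots> = ?s * (3 * r * r + 3)" by (simp add: algebra_simps)
  also have "\<dots> < 2 * r ^ 32 * (3 * r * r + 3)" using t(2) by (intro mult_strict_right_mono) auto
  also have "\<dots> \<le> r ^ 32 * r ^ 8"
  proof -
    have "2 * (3 * r * r + 3) \<le> r * r * (r * r)"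
    proof -
      have "20 * 20 \<le> r * r" using r by (intro mult_le_mono) auto
      then have "400 * (r * r) \<le> r * r * (r * r)" by (intro mult_le_mono1) simp
      moreover have "2 * (3 * r * r + 3) = 6 * (r * r) + 6" by simp
      ultimately show ?thesis using \<open>20 * 20 \<le> r * r\<close> by linarith
    qed
    also have "\<dots> = r ^ 4" by (simp add: power_numeral_reduce)
    also have "\<dots> \<le> r ^ 8" using r by (intro power_increasing) auto
    finally have "r ^ 32 * (2 * (3 * r * r + 3)) \<le> r ^ 32 * r ^ 8" by (rule mult_le_mono2)
    then show ?thesis by (simp only: ac_simps)
  qed
  also have "\<dots> = r ^ 40" by (simp add: power_add[symmetric])
  finally show ?thesis using r(2) by linarith
qed

text \<open>Rows cost about \<open>r ^ 2\<close> bits for each of about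
  \<open>2 * size t / r ^ 7\<close> clusters, slots \<open>r\<close> bits for each of about
  \<open>size t / r ^ 3\<close> chunks. The summand \<open>3 * real r ^ 4\<close> covers what does
  not scale with the size: one more cluster and the two leading numbers.\<close>

lemma length_mini_bits_le:
  assumes r: "r \<ge> 20" and t: "t \<noteq> Leaf"
  shows "real (length (mini_bits r t)) \<le> 2 * real (size t) + 2 * real (size t) / real r + 3 * real r ^ 4"
proof -
  let ?s = "real (size t)" and ?N = "real (ncl (r ^ 7) t)"
  let ?S = "real (slots (r ^ 3) (csize (r ^ 7) t) (ncl (r ^ 7) t))"
  define x where "x = real r"
  have x: "x \<ge> 20" using r by (simp add: x_def)
  have "r \<ge> 1" using r by simp
  note f = mini_len_facts[OF this t]
  have s: "?s \<ge> 0" and N0: "?N \<ge> 0" by simp_all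
  have "real (r ^ 7 * ncl (r ^ 7) t) \<le> real (2 * size t + r ^ 7)" using f(1) of_nat_mono by blast
  then have N: "?N \<le> 2 * ?s / x ^ 7 + 1" using x by (simp add: x_def field_simps)
  have "real (r ^ 3 * slots (r ^ 3) (csize (r ^ 7) t) (ncl (r ^ 7) t)) \<le>
    real (size t + ncl (r ^ 7) t * r ^ 3 * r ^ 3)" using f(5) of_nat_mono by blast
  then have S: "?S \<le> ?s / x ^ 3 + ?N * x ^ 3" using x by (simp add: x_def field_simps)
  have x4: "(19 + x) * x + 1 \<le> x ^ 4"
  proof -
    have "(19 + x) * x + 1 \<le> (2 * x) * x + x * x" using x by (intro add_mono mult_right_mono) (auto intro: mult_ge1_I)
    also have "\<dots> = 3 * x ^ 2" by (simp add: power2_eq_square)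
    also have "\<dots> \<le> x ^ 2 * x ^ 2" using x power_mono[of 20 x 2] by (intro mult_right_mono) auto
    finally show ?thesis by (simp add: power_add[symmetric])
  qed
  have "real (length (mini_bits r t)) = 2 * x + ?N * ((19 + x) * x + 1) + ?S * x + 2 * ?s"
    unfolding f(3) mini_len_def by (simp add: x_def algebra_simps)
  also have "\<dots> \<le> 2 * x + ?N * x ^ 4 + (?s / x ^ 3 + ?N * x ^ 3) * x + 2 * ?s"
    using x4 S x N0 by (intro add_mono mult_left_mono mult_right_mono) auto
  also have "\<dots> = 2 * x + 2 * (?N * x ^ 4) + ?s / x ^ 2 + 2 * ?s"
    using x by (simp add: field_simps power_numeral_reduce)
  also have "?N * x ^ 4 \<le> (2 * ?s / x ^ 7 + 1) * x ^ 4" using N x by (intro mult_right_mono) auto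
  also have "\<dots> = 2 * ?s / x ^ 3 + x ^ 4"
    using x by (simp add: field_simps power_numeral_reduce)
  finally have le: "real (length (mini_bits r t)) \<le> 2 * x + 4 * ?s / x ^ 3 + 2 * x ^ 4 + ?s / x ^ 2 + 2 * ?s"
    by (simp add: algebra_simps)
  have "?s / x ^ 2 \<le> ?s / x" using x s by (intro divide_left_mono) (auto simp: power2_eq_square)
  moreover have "4 * ?s / x ^ 3 \<le> ?s / x"
  proof -
    have "4 * x \<le> x ^ 3"
      using x mult_mono[of 4 "x ^ 2" x x] power_mono[of 20 x 2] by (simp add: power3_eq_cube power2_eq_square)
    then have "4 * ?s * x \<le> ?s * x ^ 3" using s by (metis mult.assoc mult.commute mult_left_mono)
    then show ?thesis using x by (simp add: field_simps)
  qed
  moreover have "2 * x \<le> x ^ 4" using x4 x mult_right_mono[of 2 "19 + x" x] by linarith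
  ultimately show ?thesis using le unfolding x_def[symmetric] by (simp add: x_def)
qed

text \<open>These conditions hold for all large trees if \<open>r\<close> is \<open>root8\<close> of
  the size: \<open>r ^ 8\<close> is then at most the logarithm of the size, and \<open>w\<close>,
  bounded by a constant times that logarithm, stays below \<open>r ^ 9\<close>. The number 20 gives
  room for crude estimates.\<close>

locale sizes =
  fixes r w :: nat and t :: bintree
  assumes r: "r \<ge> 20" "r ^ 40 \<le> 2 ^ r" and n: "2 ^ (r ^ 8) \<le> size t" "size t < 2 ^ w" and w: "w \<le> r ^ 9"
begin

abbreviation "N1 \<equiv> ncl (r ^ 32) t"

lemma t: "t \<noteq> Leaf"
proof
  assume "t = Leaf"
  then show False using n(1) by simp
qed

lemma dec: "decomp (r ^ 32) t"
  by standard (use t r in \<open>auto simp: Suc_le_eq\<close>)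

lemma w_gt: "r ^ 8 < w"
proof -
  have "(2::nat) ^ (r ^ 8) < 2 ^ w" using n by linarith
  then show ?thesis by simp
qed

lemma w_facts: "4 * r ^ 7 < w" "r < w" "12 \<le> w"
proof -
  have "4 * r ^ 7 \<le> r * r ^ 7" using r by (intro mult_le_mono1) simp
  also have "\<dots> = r ^ 8" by (simp add: power_numeral_reduce)
  finally show "4 * r ^ 7 < w" using w_gt by linarith
  have "r ^ 1 \<le> r ^ 8" using r by (intro power_increasing) auto
  then show "r < w" "12 \<le> w" using w_gt r by auto
qed

lemma size_ge: "r ^ 80 \<le> size t"
proof -
  have "r ^ 80 = (r ^ 40) ^ 2" by (simp add: power_mult[symmetric])
  also have "\<dots> \<le> (2 ^ r) ^ 2" using r(2) by (rule power_mono) simp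
  also have "\<dots> = 2 ^ (r * 2)" by (simp add: power_mult)
  also have "\<dots> \<le> 2 ^ (r ^ 8)"
  proof (rule power_increasing)
    have "r * 2 \<le> r * r" using r by simp
    also have "\<dots> = r ^ 2" by (simp add: power2_eq_square)
    also have "\<dots> \<le> r ^ 8" using r by (intro power_increasing) auto
    finally show "r * 2 \<le> r ^ 8" .
  qed simp
  finally show ?thesis using n(1) by linarith
qed

lemma N1_le: "r ^ 32 * N1 \<le> 3 * size t"
proof -
  have "r ^ 32 \<le> r ^ 80" using r by (intro power_increasing) auto
  then show ?thesis using decomp.N_le(1)[OF dec] size_ge by linarith
qed

lemma flog_facts: "N1 \<le> size t div r ^ 16" "2 * r ^ 32 \<le> size t div r ^ 16"
proof -
  have r16: "3 \<le> r ^ 16" using r power_increasing[of 1 16 r] by simp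
  have "3 * (N1 * r ^ 16) \<le> r ^ 16 * (N1 * r ^ 16)" using r16 by (rule mult_le_mono1)
  also have "\<dots> = r ^ 32 * N1" by (simp add: power_add[symmetric] ac_simps)
  finally have "N1 * r ^ 16 \<le> size t" using N1_le by linarith
  then show "N1 \<le> size t div r ^ 16" using r by (simp add: less_eq_div_iff_mult_less_eq)
  have "2 * r ^ 32 * r ^ 16 = 2 * r ^ 48" by (simp add: power_add[symmetric])
  also have "\<dots> \<le> r * r ^ 48" using r by (intro mult_le_mono1) simp
  also have "\<dots> \<le> r ^ 80" using r power_increasing[of 49 80 r] by (simp add: power_Suc[symmetric] del: power_Suc)
  finally show "2 * r ^ 32 \<le> size t div r ^ 16"
    using r size_ge by (simp add: less_eq_div_iff_mult_less_eq)
qed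

text \<open>The table is exponential in \<open>4 * r ^ 7\<close>, the size of the tree in
  \<open>r ^ 8\<close>; this gap absorbs all powers of \<open>r\<close>.\<close>

lemma table_le: "r ^ 16 * (7 * (2 ^ window_len r * (2 * r ^ 7 * (2 * r ^ 7)))) \<le> size t"
proof -
  have "r ^ 16 * (7 * (2 ^ window_len r * (2 * r ^ 7 * (2 * r ^ 7)))) = 28 * r ^ 30 * 2 ^ window_len r"
    by (simp add: power_add[symmetric])
  also have "\<dots> \<le> r ^ 40 * 2 ^ (4 * r ^ 7)"
  proof (intro mult_le_mono)
    have "28 * r ^ 30 \<le> r ^ 2 * r ^ 30" using r power_mono[of 20 r 2] by (intro mult_le_mono1) simp
    also have "\<dots> \<le> r ^ 40" using r by (simp add: power_add[symmetric] power_increasing)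
    finally show "28 * r ^ 30 \<le> r ^ 40" .
  qed (simp add: window_len_def power_increasing)
  also have "\<dots> \<le> 2 ^ r * 2 ^ (4 * r ^ 7)" using r(2) by (rule mult_le_mono1)
  also have "\<dots> = 2 ^ (r + 4 * r ^ 7)" by (simp add: power_add)
  also have "\<dots> \<le> 2 ^ (r ^ 8)"
  proof (rule power_increasing)
    have "r ^ 1 \<le> r ^ 7" using r by (intro power_increasing) auto
    then have "r + 4 * r ^ 7 \<le> 5 * r ^ 7" by simp
    also have "\<dots> \<le> r * r ^ 7" using r by (intro mult_le_mono1) simp
    finally show "r + 4 * r ^ 7 \<le> r ^ 8" by (simp add: power_numeral_reduce)
  qed simp
  finally show ?thesis using n(1) by linarith
qed

text \<open>The excess per node is \<open>2 / r\<close> bits for rows, slots and code ends of the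
  lower level, \<open>1 / r\<close> for padding and constant costs of its trees, and
  \<open>1 / r\<close> for everything stored as whole words.\<close>

lemma length_le: "real (length (big_enc w r t)) \<le> 2 * size t + 4 * size t / r"
proof -
  let ?n = "real (size t)" and ?N = "real N1"
  let ?t = "ctree (r ^ 32) t"
  define x where "x = real r"
  have x: "x \<ge> 20" using r by (simp add: x_def)
  have n0: "?n \<ge> 0" by simp
  have wx: "real w \<le> x ^ 9" using w of_nat_mono[of w "r ^ 9"] by (simp add: x_def)
  have xp: "x ^ k \<ge> 20" if "k \<ge> 1" for k using power_increasing[of 1 k x] that x by simp
  have div: "?n / x ^ k \<le> ?n / x ^ j" if "j \<le> k" for j k
    using x n0 that by (intro divide_left_mono power_increasing) auto
  interpret decomp "r ^ 32" t by (rule dec)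
  have "real (r ^ 32 * N1) \<le> real (3 * size t)" using N1_le of_nat_mono by blast
  then have N: "?N \<le> 3 * ?n / x ^ 32" using x by (simp add: x_def field_simps)
  have w0: "w > 0" using w_facts by simp
  have "real (mini_words w r (?t c) * w) \<le>
    2 * real (size (?t c)) + 2 * real (size (?t c)) / x + (3 * x ^ 4 + x ^ 9)"
    if "c < N1" for c
  proof -
    have "mini_words w r (?t c) * w \<le> length (mini_bits r (?t c)) + w"
      by (simp add: mini_words_def add_mult_distrib)
    then have "real (mini_words w r (?t c) * w) \<le> real (length (mini_bits r (?t c))) + real w"
      unfolding of_nat_add[symmetric] of_nat_le_iff .
    then show ?thesis
      using length_mini_bits_le[OF r(1) ctree_not_Leaf[OF that]] wx unfolding x_def[symmetric] by linarith
  qed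
  then have "(\<Sum>c<N1. real (mini_words w r (?t c) * w)) \<le>
    (\<Sum>c<N1. 2 * real (size (?t c)) + 2 * real (size (?t c)) / x + (3 * x ^ 4 + x ^ 9))" by (intro sum_mono) auto
  also have "\<dots> = 2 * (\<Sum>c<N1. real (size (?t c))) + 2 * (\<Sum>c<N1. real (size (?t c))) / x + ?N * (3 * x ^ 4 + x ^ 9)"
    by (simp add: sum.distrib sum_distrib_left sum_divide_distrib)
  also have "(\<Sum>c<N1. real (size (?t c))) = ?n" using sum_size_ctree by (metis of_nat_sum)
  also have "?N * (3 * x ^ 4 + x ^ 9) \<le> (3 * ?n / x ^ 32) * (x ^ 9 + x ^ 9)"
  proof (intro mult_mono N add_mono)
    have "3 * x ^ 4 \<le> x ^ 5 * x ^ 4" using xp[of 5] x by (intro mult_right_mono) auto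
    then show "3 * x ^ 4 \<le> x ^ 9" by (simp add: power_add[symmetric])
  qed (use x in auto)
  also have "\<dots> = 6 * (?n / x ^ 23)" using x by (simp add: field_simps power_numeral_reduce)
  also have "\<dots> \<le> ?n / x"
  proof -
    have "6 * ?n \<le> x * ?n" using x n0 by (intro mult_right_mono) auto
    then have "6 * (?n / x ^ 2) \<le> ?n / x" using x by (simp add: field_simps power2_eq_square)
    then show ?thesis using div[of 2 23] by linarith
  qed
  finally have minis: "(\<Sum>c<N1. real (mini_words w r (?t c) * w)) \<le> 2 * ?n + 3 * ?n / x" by simp
  let ?S = "slots (r ^ 16) (csize (r ^ 32) t) N1"
  have "r ^ 16 \<ge> 1" using r by (simp add: Suc_le_eq)
  from slots_le[OF this, of "csize (r ^ 32) t" N1]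
  have "r ^ 16 * ?S \<le> size t + r ^ 32 * N1" unfolding psum_csize by (simp add: power_add[symmetric] ac_simps)
  then have "r ^ 16 * ?S \<le> 4 * size t" using N1_le by linarith
  moreover have "r ^ 16 * (N1 * (19 + w)) \<le> size t"
  proof -
    have "r ^ 16 * (N1 * (19 + w)) \<le> r ^ 16 * (N1 * (r ^ 9 + r ^ 9))"
      using w power_increasing[of 1 9 r] r by (intro mult_le_mono) auto
    also have "\<dots> = 2 * (r ^ 16 * r ^ 9 * N1)" by (simp add: algebra_simps)
    also have "r ^ 16 * r ^ 9 = r ^ 25" by (simp add: power_add[symmetric])
    finally have "3 * (r ^ 16 * (N1 * (19 + w))) \<le> 6 * (r ^ 25 * N1)" by linarith
    also have "\<dots> \<le> r ^ 7 * (r ^ 25 * N1)" using power_increasing[of 1 7 r] r by (intro mult_le_mono1) simp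
    also have "\<dots> = r ^ 32 * N1" by (simp add: power_add[symmetric])
    finally show ?thesis using N1_le by linarith
  qed
  moreover have "r ^ 16 * 13 \<le> size t"
  proof -
    have "r ^ 16 * 13 \<le> r ^ 16 * r ^ 64" using power_increasing[of 1 64 r] r by (intro mult_le_mono2) simp
    then show ?thesis using size_ge by (simp add: power_add[symmetric])
  qed
  moreover have "r ^ 16 * (size t div r ^ 16) \<le> size t" by simp
  ultimately have "r ^ 16 * mini_base w r t \<le> 8 * size t"
    using table_le unfolding mini_base_def top_base_def flog_base_def table_base_def
    by (simp only: add_mult_distrib2)
  then have "real (r ^ 16 * mini_base w r t) \<le> real (8 * size t)" using of_nat_mono by blast
  then have "real (mini_base w r t) \<le> 8 * ?n / x ^ 16" using x by (simp add: x_def field_simps)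
  then have "real (mini_base w r t) * real w \<le> (8 * ?n / x ^ 16) * x ^ 9"
    using wx x by (intro mult_mono) auto
  also have "\<dots> = 8 * (?n / x ^ 7)" using x by (simp add: field_simps power_numeral_reduce)
  also have "\<dots> \<le> ?n / x"
  proof -
    have "8 * ?n \<le> x * ?n" using x n0 by (intro mult_right_mono) auto
    then have "8 * (?n / x ^ 2) \<le> ?n / x" using x by (simp add: field_simps power2_eq_square)
    then show ?thesis using div[of 2 7] by linarith
  qed
  finally have "real (mini_base w r t) * real w \<le> ?n / x" .
  then show ?thesis using minis
    unfolding length_big_enc[OF w0] mini_addr_def psum_def x_def
    by (simp add: add_mult_distrib sum_distrib_right)
qed

lemma addr: "mini_addr w r t N1 + 1 < 2 ^ w"
proof -
  have "4 * real (size t) \<le> real r * real (size t)" using r by (intro mult_right_mono) auto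
  then have "4 * real (size t) / r \<le> size t" using r by (simp add: field_simps)
  then have "real (length (big_enc w r t)) \<le> real (3 * size t)" using length_le by simp
  then have "mini_addr w r t N1 * w \<le> 3 * size t"
    using length_big_enc[of w r t] w_facts by (simp only: of_nat_le_iff)
  \<comment> \<open>At most \<open>3 * size t\<close> bits in words of at least 12 bits occupy at
    most a quarter of \<open>size t\<close> cells, which leaves room below
    \<open>2 ^ w\<close>.\<close>
  moreover have "mini_addr w r t N1 * 12 \<le> mini_addr w r t N1 * w" using w_facts(3) by (rule mult_le_mono2)
  moreover have "2 \<le> size t"
    using size_ge r power_increasing[of 1 80 r] by simp
  ultimately show ?thesis using n(2) by linarith
qed

end

section \<open>Arbitrary word sizes\<close>

definition root8 :: "nat \<Rightarrow> nat" where
  "root8 n = (GREATEST r. r ^ 8 \<le> floor_log n)"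

lemma root8_le: "root8 n ^ 8 \<le> floor_log n"
  and root8_max: "r ^ 8 \<le> floor_log n \<Longrightarrow> r \<le> root8 n"
proof -
  have le: "r \<le> floor_log n" if "r ^ 8 \<le> floor_log n" for r
  proof (cases "r = 0")
    case False
    then show ?thesis using power_increasing[of 1 8 r] that by simp
  qed simp
  show "root8 n ^ 8 \<le> floor_log n"
    unfolding root8_def by (rule GreatestI_nat[of _ 0 "floor_log n"]) (auto intro: le)
  show "r ^ 8 \<le> floor_log n \<Longrightarrow> r \<le> root8 n"
    unfolding root8_def by (rule Greatest_le_nat[of _ _ "floor_log n"]) (auto intro: le)
qed

lemma root8_gt: "floor_log n < (root8 n + 1) ^ 8"
  by (rule ccontr) (use root8_max[of "root8 n + 1" n] in simp)

lemma root8_ge: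
  assumes "2 ^ (r ^ 8) \<le> n"
  shows "r \<le> root8 n"
proof (rule root8_max)
  have "floor_log (2 ^ (r ^ 8)) \<le> floor_log n" using assms by (rule floor_log_le_iff)
  then show "r ^ 8 \<le> floor_log n" by simp
qed

lemma log_le_root8:
  assumes "n \<ge> 1"
  shows "log 2 n \<le> real (root8 n + 1) ^ 8"
proof -
  have "real n \<le> real (2 ^ (floor_log n + 1))" using floor_log_exp2_gt[of n] by (intro of_nat_mono) simp
  then have "real n \<le> 2 powr real (floor_log n + 1)" by (simp add: powr_realpow[symmetric] powr_add)
  then have "log 2 n \<le> real (floor_log n + 1)" using assms by (simp add: log_le_iff)
  also have "\<dots> \<le> real ((root8 n + 1) ^ 8)" using root8_gt[of n] by (intro of_nat_mono) simp
  finally show ?thesis by simp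
qed

lemma bounds_eventually:
  assumes "(\<lambda>n. real (w n)) \<in> \<Theta>(\<lambda>n. log 2 (real n))"
  shows "\<exists>n0. \<forall>n\<ge>n0. root8 n \<ge> 20 \<and> root8 n ^ 40 \<le> 2 ^ root8 n \<and> 2 ^ (root8 n ^ 8) \<le> n \<and> w n \<le> root8 n ^ 9"
proof -
  have "(\<lambda>n. real (w n)) \<in> O(\<lambda>n. log 2 (real n))" using assms by blast
  then obtain c where c: "c > 0" "eventually (\<lambda>n. norm (real (w n)) \<le> c * norm (log 2 (real n))) at_top"
    by (rule landau_o.bigE)
  then obtain n1 where n1: "\<And>n. n \<ge> n1 \<Longrightarrow> real (w n) \<le> c * \<bar>log 2 (real n)\<bar>"
    by (auto simp: eventually_at_top_linorder)
  have "eventually (\<lambda>r::nat. real r ^ 40 \<le> 2 ^ r) at_top" by real_asymp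
  then obtain r0 :: nat where r0: "\<And>r. r \<ge> r0 \<Longrightarrow> real r ^ 40 \<le> 2 ^ r"
    by (auto simp: eventually_at_top_linorder)
  \<comment> \<open>The factor 256 is \<open>2 ^ 8\<close>, from estimating
    \<open>(r + 1) ^ 8\<close> by \<open>(2 * r) ^ 8\<close>; one more factor \<open>r\<close> then
    absorbs the constants.\<close>
  obtain k :: nat where k: "256 * c \<le> real k" using real_arch_simple by blast
  define R where "R = max (max 20 r0) k"
  show ?thesis
  proof (intro exI[of _ "max n1 (2 ^ (R ^ 8))"] allI impI)
    fix n assume n: "max n1 (2 ^ (R ^ 8)) \<le> n"
    define r where "r = root8 n"
    have "R \<le> r" unfolding r_def using n by (intro root8_ge) simp
    then have r: "20 \<le> r" "r0 \<le> r" "k \<le> r" by (auto simp: R_def)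
    have n_pos: "n \<ge> 1" using n by (metis le_trans max.cobounded2 one_le_numeral one_le_power)
    have "real (r ^ 40) \<le> real (2 ^ r)" using r0[OF r(2)] by simp
    then have 2: "r ^ 40 \<le> 2 ^ r" by (simp only: of_nat_le_iff)
    have "(2::nat) ^ (r ^ 8) \<le> 2 ^ floor_log n" unfolding r_def using root8_le by (intro power_increasing) auto
    also have "\<dots> \<le> n" using n_pos by (intro floor_log_exp2_le) simp
    finally have 3: "2 ^ (r ^ 8) \<le> n" .
    have "log 2 n \<ge> 0" using n_pos by simp
    then have "real (w n) \<le> c * log 2 n" using n1[of n] n by simp
    also have "\<dots> \<le> c * real (r + 1) ^ 8"
      unfolding r_def using log_le_root8[OF n_pos] c(1) by (intro mult_left_mono) auto
    also have "\<dots> \<le> c * (2 * real r) ^ 8"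
      using c(1) r by (intro mult_left_mono power_mono) auto
    also have "\<dots> = (256 * c) * real r ^ 8" by (simp add: power_mult_distrib)
    also have "\<dots> \<le> real r * real r ^ 8" using k r(3) by (intro mult_right_mono) auto
    also have "\<dots> = real (r ^ 9)" by (simp add: power_numeral_reduce)
    finally have "w n \<le> r ^ 9" by (simp only: of_nat_le_iff)
    with r(1) 2 3 show "20 \<le> root8 n \<and> root8 n ^ 40 \<le> 2 ^ root8 n \<and> 2 ^ (root8 n ^ 8) \<le> n \<and> w n \<le> root8 n ^ 9"
      unfolding r_def by blast
  qed
qed

text \<open>For an operation with one argument, the two nodes of an input coincide.\<close>

type_synonym input = "bintree \<times> state \<times> node \<times> node"

locale word_sizes =
  fixes w :: "nat \<Rightarrow> nat"
  assumes theta: "(\<lambda>n. real (w n)) \<in> \<Theta>(\<lambda>n. log 2 (real n))"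
    and size_less: "n < 2 ^ w n"
begin

definition n0 :: nat where
  "n0 = (SOME n0. \<forall>n\<ge>n0. root8 n \<ge> 20 \<and> root8 n ^ 40 \<le> 2 ^ root8 n \<and> 2 ^ (root8 n ^ 8) \<le> n \<and> w n \<le> root8 n ^ 9)"

text \<open>Small trees are set apart by the word size and not by their own size, because a program
  can test the word size before it knows how the data is encoded. Words longer than
  \<open>w0\<close> imply that the size is at least \<open>n0\<close>.\<close>

definition w0 :: nat where
  "w0 = Max (w ` {..n0})"

lemma large:
  assumes "w0 < w n"
  shows "root8 n \<ge> 20" "root8 n ^ 40 \<le> 2 ^ root8 n" "2 ^ (root8 n ^ 8) \<le> n" "w n \<le> root8 n ^ 9"
proof -
  have "\<forall>n\<ge>n0. root8 n \<ge> 20 \<and> root8 n ^ 40 \<le> 2 ^ root8 n \<and> 2 ^ (root8 n ^ 8) \<le> n \<and> w n \<le> root8 n ^ 9"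
    unfolding n0_def using bounds_eventually[OF theta] by (rule someI_ex)
  moreover have "n0 \<le> n"
  proof (rule ccontr)
    assume "\<not> n0 \<le> n"
    then have "w n \<le> w0" unfolding w0_def by (intro Max_ge) auto
    then show False using assms by simp
  qed
  ultimately show "root8 n \<ge> 20" "root8 n ^ 40 \<le> 2 ^ root8 n" "2 ^ (root8 n ^ 8) \<le> n" "w n \<le> root8 n ^ 9"
    by blast+
qed

definition enc :: "bintree \<Rightarrow> bool list" where
  "enc t = (if w0 < w (size t) then big_enc (w (size t)) (root8 (size t)) t else tree_code t)"

definition num :: "bintree \<Rightarrow> node \<Rightarrow> nat" where
  "num t = (if w0 < w (size t) then big_num (root8 (size t)) t else micro_num t)"

definition redundancy :: "nat \<Rightarrow> real" where
  "redundancy n = (if w0 < w n then 4 * real n / real (root8 n) else 1)"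

lemma sizes: "w0 < w (size t) \<Longrightarrow> sizes (root8 (size t)) (w (size t)) t"
  by standard (use large[of "size t"] size_less[of "size t"] in auto)

lemma length_enc: "real (length (enc t)) \<le> 2 * real (size t) + redundancy (size t)"
  using sizes.length_le[OF sizes] by (simp add: enc_def redundancy_def)

lemma redundancy_bigo: "redundancy \<in> O(\<lambda>n. real n / (log 2 (real n)) powr (1 / 8))"
proof (rule landau_o.bigI[of 8])
  show "eventually (\<lambda>n. norm (redundancy n) \<le> 8 * norm (real n / (log 2 (real n)) powr (1 / 8))) at_top"
    unfolding eventually_at_top_linorder
  proof (intro exI[of _ "2 ^ (w0 + 1)"] allI impI)
    fix n :: nat assume n: "2 ^ (w0 + 1) \<le> n"
    have "(2::nat) ^ 1 \<le> 2 ^ (w0 + 1)" by (intro power_increasing) auto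
    also note n
    finally have "2 \<le> n" by simp
    \<comment> \<open>As a word can hold \<open>n\<close>, large \<open>n\<close> force long words;
      this turns the condition on the word size into one on \<open>n\<close>.\<close>
    have pow: "(2::nat) ^ (w0 + 1) < 2 ^ w n" using n size_less[of n] by (rule le_less_trans)
    have "w0 + 1 < w n" by (rule power_less_imp_less_exp[OF _ pow]) simp
    then have w0: "w0 < w n" by simp
    define r where "r = root8 n"
    have r: "r \<ge> 20" using large(1)[OF w0] by (simp add: r_def)
    have l0: "log 2 n > 0" using \<open>2 \<le> n\<close> by simp
    have "log 2 n powr (1 / 8) \<le> (real (r + 1) ^ 8) powr (1 / 8)"
      using log_le_root8[of n] \<open>2 \<le> n\<close> l0 unfolding r_def by (intro powr_mono2) auto
    also have "real (r + 1) ^ 8 = real (r + 1) powr 8" by (simp only: powr_numeral)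
    also have "(real (r + 1) powr 8) powr (1 / 8) = real (r + 1)" by (subst powr_powr) simp
    finally have "log 2 n powr (1 / 8) \<le> 2 * real r" using r by simp
    moreover have "log 2 n powr (1 / 8) > 0" using l0 by simp
    ultimately have "4 * real n / real r \<le> 8 * (real n / log 2 n powr (1 / 8))"
      using r by (simp add: field_simps mult_left_mono)
    then show "norm (redundancy n) \<le> 8 * norm (real n / log 2 n powr (1 / 8))"
      using w0 by (simp add: redundancy_def r_def)
  qed
qed simp

lemma numbering_num: "numbering num"
proof -
  have "bij_betw (num t) (nodes t) {1..size t}" for t
  proof (cases "w0 < w (size t)")
    case True
    let ?r = "root8 (size t)"
    have r: "?r ^ k \<ge> 1" for k using large(1)[OF True] by (simp add: Suc_le_eq)
    have "numbering (big_num ?r)"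
      unfolding big_num_def mini_num_def
      by (intro numbering_cnum r numbering_micro_num)
    then show ?thesis using True by (simp add: num_def numbering_def)
  qed (use numbering_micro_num in \<open>simp add: num_def numbering_def\<close>)
  then show ?thesis by (simp add: numbering_def)
qed

section \<open>Initial states as inputs of the machine\<close>

definition wd :: "input \<Rightarrow> nat" where
  "wd x = w (size (fst x))"

text \<open>Truncation makes these words also for states that are not valid.\<close>

definition mm :: "input \<Rightarrow> nat \<Rightarrow> nat" where
  "mm x i = take_bit (wd x) (mem (fst (snd x)) i)"

definition ar :: "input \<Rightarrow> nat \<Rightarrow> nat" where
  "ar x i = take_bit (wd x) (regs (fst (snd x)) i)"

sublocale machine wd mm ar
  by standard (simp_all add: mm_def ar_def)

text \<open>Memory outside of the data and the other registers are arbitrary, as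
  \<open>computes\<close> demands.\<close>

definition inputs :: "nat \<Rightarrow> input set" where
  "inputs k = {(t, s, u, v). words_ok (w (size t)) s \<and> holds_bits (w (size t)) (enc t) (mem s) \<and>
     u \<in> nodes t \<and> v \<in> nodes t \<and> regs s 0 = num t u \<and> (if k = 2 then regs s 1 = num t v else u = v)}"

lemma inputs_mm: "(t, s, u, v) \<in> inputs k \<Longrightarrow> mm (t, s, u, v) = mem s"
  and inputs_ar: "(t, s, u, v) \<in> inputs k \<Longrightarrow> ar (t, s, u, v) = regs s"
  by (auto simp: inputs_def mm_def ar_def wd_def words_ok_def take_bit_nat_eq_self)

lemma supports1I:
  assumes "ram (inputs 1) (\<lambda>(t, s, u, v). f t u)"
  shows "supports1 w enc num f"
proof -
  obtain e where e: "\<forall>x\<in>inputs 1. ev (wd x) (mm x) (ar x) e = (\<lambda>(t, s, u, v). f t u) x"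
    using assms unfolding ram_def by blast
  have "computes (w (size t)) (compile e (arity_bound e + 1) 0 @ [Arith Or 0 (arity_bound e + 1) (arity_bound e + 1)])
    (code_size e + 1) (enc t) [num t u] (f t u)" if u: "u \<in> nodes t" for t u
  proof (rule computes_expr)
    fix s :: state
    assume "pc s = 0" "words_ok (w (size t)) s" "holds_bits (w (size t)) (enc t) (mem s)"
      "\<forall>i<length [num t u]. regs s i = [num t u] ! i"
    then have x: "(t, s, u, u) \<in> inputs 1" using u by (simp add: inputs_def)
    show "ev (w (size t)) (mem s) (regs s) e = f t u"
      using bspec[OF e x] unfolding inputs_mm[OF x] inputs_ar[OF x] by (simp add: wd_def)
  qed
  then show ?thesis unfolding supports1_def by blast
qed

lemma supports2I:
  assumes "ram (inputs 2) (\<lambda>(t, s, u, v). f t u v)"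
  shows "supports2 w enc num f"
proof -
  obtain e where e: "\<forall>x\<in>inputs 2. ev (wd x) (mm x) (ar x) e = (\<lambda>(t, s, u, v). f t u v) x"
    using assms unfolding ram_def by blast
  have "computes (w (size t)) (compile e (arity_bound e + 1) 0 @ [Arith Or 0 (arity_bound e + 1) (arity_bound e + 1)])
    (code_size e + 1) (enc t) [num t u, num t v] (f t u v)" if uv: "u \<in> nodes t" "v \<in> nodes t" for t u v
  proof (rule computes_expr)
    fix s :: state
    assume s: "pc s = 0" "words_ok (w (size t)) s" "holds_bits (w (size t)) (enc t) (mem s)"
      "\<forall>i<length [num t u, num t v]. regs s i = [num t u, num t v] ! i"
    from spec[OF s(4), of 0] spec[OF s(4), of 1] have "regs s 0 = num t u" "regs s 1 = num t v" by simp_all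
    with s(2,3) have x: "(t, s, u, v) \<in> inputs 2" using uv by (simp add: inputs_def)
    show "ev (w (size t)) (mem s) (regs s) e = f t u v"
      using bspec[OF e x] unfolding inputs_mm[OF x] inputs_ar[OF x] by (simp add: wd_def)
  qed
  then show ?thesis unfolding supports2_def by blast
qed

text \<open>
  For bounded word sizes the memory has bounded size and determines the tree. If words have a
  single bit, then only two cells are accessible, but there is only one tree.
\<close>

lemma small_tree_eq:
  assumes "w (size t) = j" "w (size t') = j" "\<not> w0 < j" "t \<noteq> Leaf" "t' \<noteq> Leaf"
    "holds_bits j (enc t) m" "holds_bits j (enc t') m'" "\<And>a. a < 2 ^ j \<Longrightarrow> m a = m' a"
  shows "t = t'"
proof (cases "j \<ge> 2")
  case True
  define bs where "bs m = map (\<lambda>k. bit (m (k div j)) (k mod j)) [0..<j * 2 ^ j]" for m :: "nat \<Rightarrow> nat"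
  have pre: "\<exists>ys. bs m = tree_code t @ ys"
    if "holds_bits j (enc t) m" "w (size t) = j" for t and m :: "nat \<Rightarrow> nat"
  proof -
    have "size t < 2 ^ j" using size_less[of "size t"] that(2) by simp
    moreover have "2 * 2 ^ j \<le> j * 2 ^ j" using True by (rule mult_le_mono1)
    ultimately have "2 * size t + 1 \<le> j * 2 ^ j" by linarith
    then have len: "length (tree_code t) \<le> length (bs m)" by (simp add: bs_def)
    have "take (length (tree_code t)) (bs m) = tree_code t"
    proof (rule nth_equalityI)
      fix k assume "k < length (take (length (tree_code t)) (bs m))"
      then have "k < length (tree_code t)" "k < j * 2 ^ j" by (auto simp: bs_def)
      then show "take (length (tree_code t)) (bs m) ! k = tree_code t ! k"
        using that assms(3) by (simp add: bs_def enc_def holds_bits_def)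
    qed (use len in simp)
    then show ?thesis by (metis append_take_drop_id)
  qed
  have "k div j < 2 ^ j" if "k < j * 2 ^ j" for k
    using that True by (simp add: less_mult_imp_div_less mult.commute)
  then have "bs m = bs m'" using assms(8) by (simp add: bs_def)
  then show ?thesis using pre[OF assms(6,1)] pre[OF assms(7,2)] tree_code_prefix_free by metis
next
  case False
  have single: "t = Node Leaf () Leaf" if "w (size t) = j" "t \<noteq> Leaf" for t :: bintree
  proof -
    have "size t < 2 ^ j" using size_less[of "size t"] that(1) by simp
    also have "(2::nat) ^ j \<le> 2 ^ 1" using False by (intro power_increasing) auto
    finally show ?thesis using that(2) by (cases t) auto
  qed
  show ?thesis using single assms by metis
qed

text \<open>The argument registers and the \<open>2 ^ j\<close> accessible cells determine the tree
  and the nodes, so \<open>ram_determined\<close> applies. The bound on \<open>f\<close> makes the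
  answers fit into a word.\<close>

lemma ram_small:
  assumes k: "k = 1 \<or> k = 2" and f: "\<And>t u v. u \<in> nodes t \<Longrightarrow> v \<in> nodes t \<Longrightarrow> f t u v \<le> size t" and j: "j \<le> w0"
  shows "ram {x \<in> inputs k. wd x = j} (\<lambda>(t, s, u, v). f t u v)" (is "ram ?D ?f")
proof (rule ram_determined[where k = "k + 2 ^ j" and W = j and g = "\<lambda>i x. if i < k then ar x i else mm x (i - k)"])
  show "ram ?D (\<lambda>x. if i < k then ar x i else mm x (i - k))" if "i < k + 2 ^ j" for i
  proof (cases "i < k")
    case False
    then have "i - k < 2 ^ j" using that by simp
    then have "ram ?D (\<lambda>x. mm x (i - k))" by (intro ram_load ram_const) auto
    then show ?thesis using False by simp
  qed (simp add: ram_arg)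
  show "wd x = j" if "x \<in> ?D" for x using that by blast
  show "?f x < 2 ^ j" if "x \<in> ?D" for x
  proof -
    obtain t s u v where x: "x = (t, s, u, v)" by (cases x)
    have "f t u v \<le> size t" using that x by (intro f) (auto simp: inputs_def)
    also have "\<dots> < 2 ^ j" using size_less[of "size t"] that x by (auto simp: wd_def)
    finally show ?thesis using x by simp
  qed
  show "?f x = ?f y" if xy: "x \<in> ?D" "y \<in> ?D"
    and eq: "\<And>i. i < k + 2 ^ j \<Longrightarrow> (if i < k then ar x i else mm x (i - k)) = (if i < k then ar y i else mm y (i - k))"
    for x y
  proof -
    obtain t s u v where x: "x = (t, s, u, v)" by (cases x)
    obtain t' s' u' v' where y: "y = (t', s', u', v')" by (cases y)
    have in_x: "(t, s, u, v) \<in> inputs k" "w (size t) = j" and in_y: "(t', s', u', v') \<in> inputs k" "w (size t') = j"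
      using xy by (auto simp: x y wd_def)
    have mem: "mem s a = mem s' a" if "a < 2 ^ j" for a
      using eq[of "k + a"] that unfolding x y inputs_mm[OF in_x(1)] inputs_mm[OF in_y(1)] by simp
    have reg: "regs s i = regs s' i" if "i < k" for i
      using eq[of i] that unfolding x y inputs_ar[OF in_x(1)] inputs_ar[OF in_y(1)] by simp
    have X: "holds_bits j (enc t) (mem s)" "u \<in> nodes t" "v \<in> nodes t" "regs s 0 = num t u"
      "if k = 2 then regs s 1 = num t v else u = v"
      using in_x by (auto simp: inputs_def)
    have Y: "holds_bits j (enc t') (mem s')" "u' \<in> nodes t'" "v' \<in> nodes t'" "regs s' 0 = num t' u'"
      "if k = 2 then regs s' 1 = num t' v' else u' = v'"
      using in_y by (auto simp: inputs_def)
    have "t \<noteq> Leaf" "t' \<noteq> Leaf" using X(2) Y(2) by auto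
    then have t: "t = t'"
      using small_tree_eq[OF in_x(2) in_y(2) _ _ _ X(1) Y(1) mem] j by simp
    have u: "u = u'" using reg[of 0] X(2,4) Y(2,4) k t numbering_eq[OF numbering_num] by auto
    have "v = v'"
    proof (cases "k = 2")
      case True
      then show ?thesis using reg[of 1] X(3,5) Y(3,5) t numbering_eq[OF numbering_num] by simp
    next
      case False
      then show ?thesis using X(5) Y(5) u by simp
    qed
    with t u show ?thesis by (simp add: x y)
  qed
qed

definition large_inputs :: "nat \<Rightarrow> input set" where
  "large_inputs k = {x \<in> inputs k. w0 < wd x}"

lemma ram_inputs:
  assumes "k = 1 \<or> k = 2" "\<And>t u v. u \<in> nodes t \<Longrightarrow> v \<in> nodes t \<Longrightarrow> f t u v \<le> size t"
    "ram (large_inputs k) (\<lambda>(t, s, u, v). f t u v)"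
  shows "ram (inputs k) (\<lambda>(t, s, u, v). f t u v)"
proof (rule ram_bounded_wd[of w0])
  show "ram {x \<in> inputs k. wd x = j} (\<lambda>(t, s, u, v). f t u v)" if "j \<le> w0" for j
    using assms(1,2) that by (rule ram_small)
qed (use assms(3) in \<open>simp add: large_inputs_def\<close>)

lemma large_ops:
  fixes k :: nat
  defines "E \<equiv> large_inputs k"
  shows "ops E fst (\<lambda>x. num (fst x))" "node_fn E fst (\<lambda>x. num (fst x)) (\<lambda>(t, s, u, v). u)"
    "k = 2 \<Longrightarrow> node_fn E fst (\<lambda>x. num (fst x)) (\<lambda>(t, s, u, v). v)"
proof -
  have inE: "(t, s, u, v) \<in> inputs k" "w0 < w (size t)" if "(t, s, u, v) \<in> E" for t s u v
    using that by (auto simp: E_def large_inputs_def wd_def)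
  have num: "num (fst x) = big_num (root8 (size (fst x))) (fst x)" if "x \<in> E" for x
    using that inE by (cases x) (auto simp: num_def)
  have siz: "sizes (root8 (size (fst x))) (wd x) (fst x)" if "x \<in> E" for x
    using that by (auto simp: E_def large_inputs_def wd_def intro!: sizes)
  interpret big wd mm ar E fst "\<lambda>x. root8 (size (fst x))"
  proof (unfold_locales, goal_cases)
    case (1 x)
    then show ?case using sizes.t[OF siz] by blast
  next
    case (2 x)
    show ?case using sizes.r(1)[OF siz[OF 2]] by linarith
  next
    case (3 x)
    then show ?case using sizes.w_facts(1)[OF siz] by blast
  next
    case (4 x)
    then show ?case using sizes.w_facts(2)[OF siz] by blast
  next
    case (5 x)
    obtain t s u v where x: "x = (t, s, u, v)" by (cases x)
    have "holds_bits (w (size t)) (enc t) (mem s)" using inE(1) 5 x by (auto simp: inputs_def)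
    then show ?case
      using inputs_mm[OF inE(1)] inE(2) 5 unfolding x holds_bits_seg by (simp add: enc_def wd_def)
  next
    case (6 x)
    then show ?case using sizes.addr[OF siz] by blast
  next
    case (7 x)
    then show ?case using size_less by (simp add: wd_def)
  next
    case (8 x t)
    then show ?case using length_mini_bits_less sizes.r[OF siz] by blast
  next
    case (9 x)
    then show ?case using sizes.flog_facts(1)[OF siz] by blast
  next
    case (10 x)
    then show ?case using sizes.flog_facts(2)[OF siz] by blast
  qed
  have "ops E fst (\<lambda>x. big_num (root8 (size (fst x))) (fst x))" by (rule ops_big)
  then show "ops E fst (\<lambda>x. num (fst x))" by (rule ops_cong) (simp add: num)
  show "node_fn E fst (\<lambda>x. num (fst x)) (\<lambda>(t, s, u, v). u)"
    unfolding node_fn_def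
  proof
    show "ram E (\<lambda>x. num (fst x) ((\<lambda>(t, s, u, v). u) x))"
    proof (rule ram_cong[OF ram_arg[of _ 0]])
      fix x assume x: "x \<in> E"
      obtain t s u v where eq: "x = (t, s, u, v)" by (cases x)
      show "ar x 0 = num (fst x) ((\<lambda>(t, s, u, v). u) x)"
        using inE(1)[OF x[unfolded eq]]
        unfolding eq inputs_ar[OF inE(1)[OF x[unfolded eq]]] by (simp add: inputs_def)
    qed
  qed (use inE in \<open>auto simp: inputs_def\<close>)
  show "node_fn E fst (\<lambda>x. num (fst x)) (\<lambda>(t, s, u, v). v)" if k: "k = 2"
    unfolding node_fn_def
  proof
    show "ram E (\<lambda>x. num (fst x) ((\<lambda>(t, s, u, v). v) x))"
    proof (rule ram_cong[OF ram_arg[of _ 1]])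
      fix x assume x: "x \<in> E"
      obtain t s u v where eq: "x = (t, s, u, v)" by (cases x)
      show "ar x 1 = num (fst x) ((\<lambda>(t, s, u, v). v) x)"
      proof -
        have "regs s 1 = num t v" using inE(1)[OF x[unfolded eq]] k by (simp add: inputs_def)
        then show ?thesis unfolding eq inputs_ar[OF inE(1)[OF x[unfolded eq]]] by simp
      qed
    qed
  qed (use inE in \<open>auto simp: inputs_def\<close>)
qed

lemma op_le:
  assumes "u \<in> nodes t" "v \<in> nodes t"
  shows "handle (num t) (child d t u) \<le> size t" "handle (num t) (parent t u) \<le> size t"
    "subtree_size t u \<le> size t" "inorder_rank t u \<le> size t" "preorder_rank t u \<le> size t"
    "num t (lca t u v) \<le> size t"
proof -
  have num: "n \<in> nodes t \<Longrightarrow> num t n \<le> size t" for n using numbering_range[OF numbering_num] by blast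
  show "handle (num t) (child d t u) \<le> size t" using num by (simp add: child_def)
  have "butlast u \<in> nodes t" using assms(1) by (rule nodes_prefix) (rule prefixeq_butlast)
  then show "handle (num t) (parent t u) \<le> size t" using num by (simp add: parent_def)
  have card: "card {n \<in> nodes t. P n} < size t" if "\<not> P u" for P
    unfolding card_nodes[symmetric] using assms(1) that by (intro psubset_card_mono) auto
  show "subtree_size t u \<le> size t"
    unfolding subtree_size_card[OF assms(1)] card_nodes[symmetric] by (rule card_mono) auto
  show "inorder_rank t u \<le> size t" "preorder_rank t u \<le> size t"
    unfolding inorder_rank_card[OF assms(1)] preorder_rank_card[OF assms(1)]
    by (rule Suc_leI, rule card, simp)+
  have "lca t u v \<in> nodes t"
    unfolding lca_eq[OF assms] using assms(1) by (rule nodes_prefix) (rule longest_common_prefix_prefix1)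
  then show "num t (lca t u v) \<le> size t" by (rule num)
qed

lemma supported:
  "supports1 w enc num (\<lambda>t u. handle (num t) (child d t u))"
  "supports1 w enc num (\<lambda>t u. handle (num t) (parent t u))"
  "supports1 w enc num subtree_size"
  "supports1 w enc num inorder_rank"
  "supports1 w enc num preorder_rank"
  "supports2 w enc num (\<lambda>t u v. num t (lca t u v))"
proof -
  have 1: "supports1 w enc num f"
    if "\<And>t u. u \<in> nodes t \<Longrightarrow> f t u \<le> size t" "ram (large_inputs 1) (\<lambda>x. f (fst x) ((\<lambda>(t, s, u, v). u) x))" for f
    by (intro supports1I ram_inputs[where f = "\<lambda>t u v. f t u"])
      (use that in \<open>auto elim!: ram_cong\<close>)
  note ops = opsD[OF large_ops(1)[of 1] order_refl large_ops(2)[of 1]]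
  show "supports1 w enc num (\<lambda>t u. handle (num t) (child d t u))"
    by (rule 1[OF op_le(1) ops(1)])
  show "supports1 w enc num (\<lambda>t u. handle (num t) (parent t u))"
    by (rule 1[OF op_le(2) ops(2)])
  show "supports1 w enc num subtree_size" by (rule 1[OF op_le(3) ops(3)])
  show "supports1 w enc num inorder_rank" by (rule 1[OF op_le(4) ops(4)])
  show "supports1 w enc num preorder_rank" by (rule 1[OF op_le(5) ops(5)])
  have "ram (large_inputs 2) (\<lambda>x. num (fst x) (lca (fst x) ((\<lambda>(t, s, u, v). u) x) ((\<lambda>(t, s, u, v). v) x)))"
    by (rule opsD(6)[OF large_ops(1) order_refl large_ops(2,3)]) simp
  then have "ram (large_inputs 2) (\<lambda>(t, s, u, v). num t (lca t u v))"
    by (rule ram_cong) auto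
  then show "supports2 w enc num (\<lambda>t u v. num t (lca t u v))"
    by (intro supports2I ram_inputs op_le(6)) auto
qed

end

theorem theorem3:
  fixes w :: "nat \<Rightarrow> nat"
  assumes "(\<lambda>n. real (w n)) \<in> \<Theta>(\<lambda>n. log 2 (real n))"
    and "\<And>n. n < 2 ^ w n"
  shows "\<exists>(c :: real) (redundancy :: nat \<Rightarrow> real)
          (enc :: bintree \<Rightarrow> bool list) (num :: bintree \<Rightarrow> node \<Rightarrow> nat).
      c > 0 \<and>
      redundancy \<in> O(\<lambda>n. real n / (log 2 (real n)) powr c) \<and>
      (\<forall>t. real (length (enc t)) \<le> 2 * real (size t) + redundancy (size t)) \<and>
      valid_numbering num \<and>
      supports1 w enc num (\<lambda>t u. handle (num t) (left_child t u)) \<and>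
      supports1 w enc num (\<lambda>t u. handle (num t) (right_child t u)) \<and>
      supports1 w enc num (\<lambda>t u. handle (num t) (parent t u)) \<and>
      supports1 w enc num subtree_size \<and>
      supports2 w enc num (\<lambda>t u v. num t (lca t u v)) \<and>
      supports1 w enc num inorder_rank \<and>
      (supports1 w enc num preorder_rank \<or> supports1 w enc num postorder_rank)"
proof -
  interpret word_sizes w by standard (use assms in auto)
  have "valid_numbering num" using numbering_num by (simp add: valid_numbering_def numbering_def)
  \<comment> \<open>The exponent is \<open>1 / 8\<close>, as the redundancy is
    \<open>4 * n / r\<close> with \<open>r\<close> about the eighth root of \<open>log n\<close>. Of
    the two traversals, preorder is the one supported.\<close>
  then show ?thesis
    using redundancy_bigo length_enc supported
    by (intro exI[of _ "1 / 8"] exI[of _ redundancy] exI[of _ enc] exI[of _ num])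
      (simp add: child_left child_right)
qed

end
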